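(* Let $F:\mathbb{R}^3\to\mathbb{R}^3$ be a polynomial mapping which is a local diffeomorphism. Then the set $S_F$ of non-properness of $F$ is not a line, i.e., $S_F$ is not a closed subset of $\mathbb{R}^3$ homeomorphic to $\mathbb{R}$.
   Context: For a mapping $F:\mathbb{R}^n\to\mathbb{R}^n$, the set of non-properness is $S_F=\{y\in\mathbb{R}^n : \text{there exists an unbounded sequence } (x_k) \text{ in } \mathbb{R}^n \text{ with } F(x_k)\to y\}$. A subset of $\mathbb{R}^3$ is called a line if it is closed and homeomorphic to $\mathbb{R}$. *)

theory Defs
  imports "HOL-Analysis.Analysis"
begin

inductive_set poly_fun3 :: "(real^3 \<Rightarrow> real) set" where
  const: "(\<lambda>x. c) \<in> poly_fun3"
| coord: "(\<lambda>x. x $ i) \<in> poly_fun3"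
| add: "p \<in> poly_fun3 \<Longrightarrow> q \<in> poly_fun3 \<Longrightarrow> (\<lambda>x. p x + q x) \<in> poly_fun3"
| mult: "p \<in> poly_fun3 \<Longrightarrow> q \<in> poly_fun3 \<Longrightarrow> (\<lambda>x. p x * q x) \<in> poly_fun3"

definition polynomial_map3 :: "(real^3 \<Rightarrow> real^3) \<Rightarrow> bool" where
  "polynomial_map3 F \<longleftrightarrow> (\<forall>i. (\<lambda>x. F x $ i) \<in> poly_fun3)"

definition local_diffeo :: "('a::euclidean_space \<Rightarrow> 'a) \<Rightarrow> bool" where
  "local_diffeo F \<longleftrightarrow> (\<forall>x. \<exists>U V G. open U \<and> x \<in> U \<and> open V \<and>
      homeomorphism U V F G \<and> F differentiable_on U \<and> G differentiable_on V)"

definition nonproper_set :: "('a::real_normed_vector \<Rightarrow> 'b::topological_space) \<Rightarrow> 'b set" where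
  "nonproper_set F = {y. \<exists>x::nat \<Rightarrow> 'a. \<not> bounded (range x) \<and> (\<lambda>k. F (x k)) \<longlonglongrightarrow> y}"

definition is_line :: "'a::topological_space set \<Rightarrow> bool" where
  "is_line L \<longleftrightarrow> closed L \<and> L homeomorphic (UNIV :: real set)"

end

theory Submission
  imports Defs "HOL-Computational_Algebra.Polynomial" "HOL-Library.Multiset"
begin

text \<open>
  Let \<open>L\<close> be the non-properness set and suppose it is a line. Outside \<open>L\<close> the map \<open>F\<close> is a finite
  covering. By quantifier elimination \<open>L\<close> is semialgebraic, so small spheres about a point of \<open>L\<close>, and
  large spheres about the origin, meet \<open>L\<close> in exactly two points, which move continuously with the
  radius. Hence near each point of \<open>L\<close>, and near infinity, the complement of \<open>L\<close> is an interval times a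
  punctured plane, and a section of \<open>F\<close> given near some point of \<open>L\<close> extends to the whole neighbourhood.

  Since the source minus a ball is connected, the preimage of \<open>W - L\<close> is connected for every connected
  neighbourhood \<open>W\<close> of \<open>L\<close> and infinity. So lying on such a section is a locally constant property there:
  it holds everywhere as soon as it holds once. It does hold once, because \<open>F\<close> does not miss \<open>L\<close>, and \<open>F\<close>
  has local inverses. Thus the covering is trivial near every point of \<open>L\<close> and, the target being simply
  connected, it has a global section over the complement of \<open>L\<close>. Consequently \<open>F\<close> is injective; but an
  injective open map is proper over its image, whereas the image meets \<open>L\<close>.
\<close>

section \<open>Sign diagrams of real polynomials\<close>

text \<open>The complement of a line in space is never simply connected, and its fundamental group
  is complicated if the line is knotted, so the base alone cannot force the covering to be trivial:
  loops around \<open>L\<close> might permute the sheets. A point of the source over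
  \<open>L\<close> yields one sheet that such loops do not move, and this says nothing about the
  other sheets there. Only the connectedness of the preimage of \<open>W - L\<close> carries the
  property to all of them. For this \<open>W\<close> must be connected, contain \<open>L\<close> and
  have a compact complement, which is why infinity needs the same local description as the points of
  \<open>L\<close>. Afterwards sections are continued over growing balls of the whole target; in
  this way its simple connectivity is used, and never that of the complement of \<open>L\<close>.
  Polynomiality serves to exclude wild lines: a semialgebraic condition on a radius is eventually
  true or eventually false, and this is applied to rays and to the radii at which the distance along
  \<open>L\<close> has a local extremum.\<close>

text \<open>The points are inserted from left to right: up to the largest old point the old
  bijection is kept, and beyond it the graph continues along the straight line through the new
  point.\<close>

lemma strict_mono_interpolation:
  fixes g :: "real \<Rightarrow> real"
  assumes "finite Z" "strict_mono_on Z g"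
  shows "\<exists>\<psi>. strict_mono \<psi> \<and> surj \<psi> \<and> (\<forall>z\<in>Z. \<psi> z = g z)"
  using assms
proof (induction Z rule: finite_linorder_max_induct)
  case empty
  show ?case by (rule exI[of _ id]) (auto simp: strict_mono_def)
next
  case (insert z A)
  have "strict_mono_on A g"
    using insert.prems by (auto simp: strict_mono_on_def)
  then obtain \<psi> where \<psi>: "strict_mono \<psi>" "surj \<psi>" "\<forall>x\<in>A. \<psi> x = g x"
    using insert.IH by blast
  show ?case
  proof (cases "A = {}")
    case True
    show ?thesis
      by (rule exI[of _ "\<lambda>x. x + (g z - z)"])
        (auto simp: True strict_mono_def surj_def intro: exI[of _ "_ - (g z - z)"])
  next
    case False
    define m where "m = Max A"
    have m: "m \<in> A" "\<And>x. x \<in> A \<Longrightarrow> x \<le> m" using False insert.hyps by (auto simp: m_def)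
    have mz: "m < z" using m insert.hyps by auto
    have gm: "g m < g z" using insert.prems m mz by (auto simp: strict_mono_on_def)
    define k where "k = (g z - g m) / (z - m)"
    have k: "k > 0" using mz gm by (simp add: k_def)
    define f where "f x = (if x \<le> m then \<psi> x else g m + (x - m) * k)" for x
    have "strict_mono f"
    proof (rule strict_monoI)
      fix x y :: real assume xy: "x < y"
      consider "y \<le> m" | "x \<le> m" "m < y" | "m < x" by linarith
      then show "f x < f y"
      proof cases
        case 1 then show ?thesis using xy \<psi>(1) by (auto simp: f_def strict_mono_def)
      next
        case 2
        have "\<psi> x \<le> \<psi> m" using 2 \<psi>(1) by (simp add: strict_mono_less_eq)
        moreover have "(y - m) * k > 0" using 2 k by simp
        ultimately show ?thesis using 2 \<psi>(3) m(1) by (auto simp: f_def)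
      next
        case 3 then show ?thesis using xy k by (auto simp: f_def)
      qed
    qed
    moreover have "surj f"
    proof (unfold surj_def, rule allI)
      fix y
      show "\<exists>x. y = f x"
      proof (cases "y \<le> g m")
        case True
        obtain x where x: "y = \<psi> x" using \<psi>(2) by (auto simp: surj_def)
        have "x \<le> m" using x True \<psi>(1,3) m(1) by (metis strict_mono_less_eq)
        then show ?thesis using x by (auto simp: f_def)
      next
        case False
        then have "f (m + (y - g m) / k) = y" using k by (auto simp: f_def field_simps)
        then show ?thesis by metis
      qed
    qed
    moreover have "f x = g x" if "x \<in> insert z A" for x
      using that m mz gm \<psi>(3) by (auto simp: f_def k_def)
    ultimately show ?thesis by blast
  qed
qed

lemma poly_sgn_eq_no_root:
  fixes p :: "real poly"
  assumes "x < y" "\<And>z. x \<le> z \<Longrightarrow> z \<le> y \<Longrightarrow> poly p z \<noteq> 0"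
  shows "sgn (poly p x) = sgn (poly p y)"
proof (rule ccontr)
  assume "\<not> ?thesis"
  then have "(poly p x < 0 \<and> 0 < poly p y) \<or> (poly p y < 0 \<and> 0 < poly p x)"
    using assms by (auto simp: sgn_real_def split: if_splits dest: spec[of _ x] spec[of _ y])
      (smt (verit))+
  then show False
    using poly_IVT_pos[OF assms(1), of p] poly_IVT_neg[OF assms(1), of p] assms(2)
    by (smt (verit))
qed

lemma poly_sgn_at_top:
  fixes p :: "real poly"
  assumes "p \<noteq> 0"
  shows "\<exists>n. \<forall>x\<ge>n. sgn (poly p x) = sgn (lead_coeff p)"
proof (cases "lead_coeff p > 0")
  case True
  then show ?thesis using poly_pinfty_gt_lc[OF True] by (metis less_le_trans sgn_pos)
next
  case False
  then have "lead_coeff (- p) > 0" using assms by (simp add: less_le lead_coeff_minus)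
  from poly_pinfty_gt_lc[OF this] obtain n where "\<forall>x\<ge>n. lead_coeff (- p) \<le> poly (- p) x" by blast
  then have "poly p x < 0" if "x \<ge> n" for x
    using \<open>lead_coeff (- p) > 0\<close> that by (metis less_le_trans neg_0_less_iff_less poly_minus)
  moreover have "lead_coeff p < 0" using \<open>lead_coeff (- p) > 0\<close> by (simp add: lead_coeff_minus)
  ultimately show ?thesis by (metis sgn_neg)
qed

lemma poly_sgn_at_bot:
  fixes p :: "real poly"
  assumes "p \<noteq> 0"
  shows "\<exists>n. \<forall>x\<le>n. sgn (poly p x) = sgn ((-1) ^ degree p * lead_coeff p)"
proof -
  let ?q = "pcompose p [:0, -1:]"
  have lc: "lead_coeff ?q = lead_coeff p * (-1) ^ degree p"
    using lead_coeff_comp[of "[:0, -1 :: real:]" p] by simp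
  have "?q \<noteq> 0" using lc assms by (metis leading_coeff_0_iff mult_eq_0_iff power_eq_0_iff neg_equal_0_iff_equal zero_neq_one)
  from poly_sgn_at_top[OF this] obtain n where n: "\<forall>x\<ge>n. sgn (poly ?q x) = sgn (lead_coeff ?q)" by blast
  have "sgn (poly p x) = sgn ((-1) ^ degree p * lead_coeff p)" if "x \<le> - n" for x
    using n[rule_format, of "- x"] that lc by (simp add: poly_pcompose mult.commute)
  then show ?thesis by blast
qed

lemma poly_root_between_deriv:
  fixes p :: "real poly"
  assumes "x < y" "poly p x = 0" "poly p y = 0"
  shows "\<exists>z. x < z \<and> z < y \<and> poly (pderiv p) z = 0"
  using poly_MVT[OF assms(1), of p] assms by auto

text \<open>The increment has the sign of the derivative at an inner point. The interval is
  half-open because in the applications \<open>y\<close> may be a root of the derivative.\<close>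

lemma poly_MVT_sgn_left:
  fixes p :: "real poly"
  assumes "x < y" "\<And>t. x \<le> t \<Longrightarrow> t < y \<Longrightarrow> poly (pderiv p) t \<noteq> 0"
  shows "sgn (poly p y - poly p x) = sgn (poly (pderiv p) x)"
proof -
  obtain \<xi> where \<xi>: "x < \<xi>" "\<xi> < y" "poly p y - poly p x = (y - x) * poly (pderiv p) \<xi>"
    using poly_MVT[OF assms(1), of p] by blast
  have "sgn (poly (pderiv p) x) = sgn (poly (pderiv p) \<xi>)"
    by (rule poly_sgn_eq_no_root) (use \<xi> assms in auto)
  then show ?thesis using \<xi> assms(1) by (simp add: sgn_mult)
qed

lemma poly_MVT_sgn_right:
  fixes p :: "real poly"
  assumes "x < y" "\<And>t. x < t \<Longrightarrow> t \<le> y \<Longrightarrow> poly (pderiv p) t \<noteq> 0"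
  shows "sgn (poly p y - poly p x) = sgn (poly (pderiv p) y)"
proof -
  obtain \<xi> where \<xi>: "x < \<xi>" "\<xi> < y" "poly p y - poly p x = (y - x) * poly (pderiv p) \<xi>"
    using poly_MVT[OF assms(1), of p] by blast
  have "sgn (poly (pderiv p) \<xi>) = sgn (poly (pderiv p) y)"
    by (rule poly_sgn_eq_no_root) (use \<xi> assms in auto)
  then show ?thesis using \<xi> assms(1) by (simp add: sgn_mult)
qed

text \<open>\<open>Z\<close> contains all roots of the derivative of \<open>p\<close>. At the root
  \<open>z\<close> outside \<open>Z\<close> this derivative has a sign \<open>c\<close>, so
  \<open>p\<close> has sign \<open>c\<close> at the next point of \<open>Z\<close> on the right and
  \<open>- c\<close> at the next one on the left. These signs carry over to \<open>q\<close>, which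
  must vanish in between. Where \<open>Z\<close> has no such neighbour, the sign near infinity is
  read off from the degree and the leading coefficient.\<close>

lemma poly_root_transfer:
  fixes p q :: "real poly" and \<phi> :: "real \<Rightarrow> real"
  assumes fin: "finite Z" and mono: "strict_mono \<phi>"
    and rp: "\<And>x. poly (pderiv p) x = 0 \<Longrightarrow> x \<in> Z"
    and sd: "\<And>x. sgn (poly (pderiv p) x) = sgn (poly (pderiv q) (\<phi> x))"
    and sZ: "\<And>x. x \<in> Z \<Longrightarrow> sgn (poly p x) = sgn (poly q (\<phi> x))"
    and nz: "p \<noteq> 0" "q \<noteq> 0" and deg: "degree p = degree q"
    and lc: "sgn (lead_coeff p) = sgn (lead_coeff q)"
    and z: "poly p z = 0" "z \<notin> Z"
  shows "\<exists>w. poly q w = 0 \<and> w \<notin> \<phi> ` Z \<and> (\<forall>t\<in>Z. t < z \<longleftrightarrow> \<phi> t < w)"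
proof -
  define c where "c = sgn (poly (pderiv p) z)"
  have c0: "c \<noteq> 0" using rp[of z] z by (auto simp: c_def sgn_zero_iff)
  have "\<exists>v. \<phi> z < v \<and> (\<forall>t\<in>Z. z < t \<longrightarrow> v \<le> \<phi> t) \<and> sgn (poly q v) = c"
  proof (cases "{t\<in>Z. z < t} = {}")
    case False
    define t where "t = Min {t\<in>Z. z < t}"
    have t: "t \<in> Z" "z < t" "\<And>s. s \<in> Z \<Longrightarrow> z < s \<Longrightarrow> t \<le> s"
      using Min_in[OF _ False] fin by (auto simp: t_def)
    have "sgn (poly p t - poly p z) = c" unfolding c_def
      by (rule poly_MVT_sgn_left) (use t z rp in \<open>force simp: not_le[symmetric]\<close>)+
    then show ?thesis using t sZ[OF t(1)] z mono
      by (intro exI[of _ "\<phi> t"]) (auto simp: strict_mono_less strict_mono_less_eq)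
  next
    case True
    obtain n where n: "\<forall>x\<ge>n. sgn (poly p x) = sgn (lead_coeff p)" using poly_sgn_at_top nz by blast
    have "sgn (poly p (max n (z + 1)) - poly p z) = c" unfolding c_def
      by (rule poly_MVT_sgn_left) (use True z rp in force)+
    then have "sgn (lead_coeff q) = c" using n z lc by simp
    moreover obtain m where "\<forall>x\<ge>m. sgn (poly q x) = sgn (lead_coeff q)" using poly_sgn_at_top nz by blast
    ultimately show ?thesis using True by (intro exI[of _ "max m (\<phi> z + 1)"]) auto
  qed
  then obtain v where v: "\<phi> z < v" "\<And>t. t \<in> Z \<Longrightarrow> z < t \<Longrightarrow> v \<le> \<phi> t" "sgn (poly q v) = c" by blast
  have "\<exists>u. u < \<phi> z \<and> (\<forall>t\<in>Z. t < z \<longrightarrow> \<phi> t \<le> u) \<and> sgn (poly q u) = - c"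
  proof (cases "{t\<in>Z. t < z} = {}")
    case False
    define t where "t = Max {t\<in>Z. t < z}"
    have t: "t \<in> Z" "t < z" "\<And>s. s \<in> Z \<Longrightarrow> s < z \<Longrightarrow> s \<le> t"
      using Max_in[OF _ False] fin by (auto simp: t_def)
    have "sgn (poly p z - poly p t) = c" unfolding c_def
      by (rule poly_MVT_sgn_right) (use t z rp in \<open>force simp: not_le[symmetric]\<close>)+
    then have "sgn (poly p t) = - c" using z by (simp add: sgn_minus)
    then show ?thesis using t sZ[OF t(1)] z mono
      by (intro exI[of _ "\<phi> t"]) (auto simp: strict_mono_less strict_mono_less_eq)
  next
    case True
    obtain n where n: "\<forall>x\<le>n. sgn (poly p x) = sgn ((-1) ^ degree p * lead_coeff p)"
      using poly_sgn_at_bot nz by blast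
    have "sgn (poly p z - poly p (min n (z - 1))) = c" unfolding c_def
      by (rule poly_MVT_sgn_right) (use True z rp in force)+
    then have "sgn (poly p (min n (z - 1))) = - c" using z by (simp add: sgn_minus)
    then have "sgn ((-1) ^ degree q * lead_coeff q) = - c" using n lc deg by (simp add: sgn_mult)
    moreover obtain m where "\<forall>x\<le>m. sgn (poly q x) = sgn ((-1) ^ degree q * lead_coeff q)"
      using poly_sgn_at_bot nz by blast
    ultimately show ?thesis using True by (intro exI[of _ "min m (\<phi> z - 1)"]) auto
  qed
  then obtain u where u: "u < \<phi> z" "\<And>t. t \<in> Z \<Longrightarrow> t < z \<Longrightarrow> \<phi> t \<le> u" "sgn (poly q u) = - c" by blast
  have "\<exists>w. u < w \<and> w < v \<and> poly q w = 0"
    using poly_IVT_pos[of u v q] poly_IVT_neg[of u v q] u v c0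
    by (smt (verit, ccfv_threshold) sgn_if c_def)
  then obtain w where w: "u < w" "w < v" "poly q w = 0" by blast
  have ord: "t < z \<longleftrightarrow> \<phi> t < w" if "t \<in> Z" for t
    using u(2)[OF that] v(2)[OF that] w z(2) that by (metis le_less_trans less_le_trans linorder_neqE_linordered_idom order_less_asym')
  moreover have "w \<notin> \<phi> ` Z"
  proof
    assume "w \<in> \<phi> ` Z"
    then obtain t where t: "t \<in> Z" "w = \<phi> t" by blast
    with z have "t < z \<or> z < t" by (metis linorder_neqE_linordered_idom)
    with u(2)[OF t(1)] v(2)[OF t(1)] w t show False by auto
  qed
  ultimately show ?thesis using w by blast
qed

text \<open>\<open>A\<close> pairs the polynomials whose sign diagrams \<open>\<phi>\<close> already
  matches, among them the derivatives of \<open>p\<close> and \<open>q\<close>. Between neighbouring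
  roots of \<open>A\<close> the polynomial \<open>p\<close> is monotone, so it has at most one new
  root there, and then \<open>q\<close> has one in the corresponding gap. Keeping
  \<open>\<phi>\<close> at the old roots and sending new roots to new roots gives the values that
  \<open>\<psi>\<close> interpolates. The hypothesis \<open>rt\<close> compares \<open>p\<close> and
  \<open>q\<close> at the old roots.\<close>

lemma sign_preserving_extend:
  fixes A :: "(real poly \<times> real poly) set" and \<phi> :: "real \<Rightarrow> real"
  assumes fin: "finite A" and mono: "strict_mono \<phi>" and surj: "surj \<phi>"
    and nzA: "\<And>a b. (a, b) \<in> A \<Longrightarrow> a \<noteq> 0 \<and> b \<noteq> 0"
    and sA: "\<And>a b x. (a, b) \<in> A \<Longrightarrow> sgn (poly a x) = sgn (poly b (\<phi> x))"
    and der: "(pderiv p, pderiv q) \<in> A"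
    and nz: "p \<noteq> 0" "q \<noteq> 0" and deg: "degree p = degree q"
    and lc: "sgn (lead_coeff p) = sgn (lead_coeff q)"
    and rt: "\<And>a b x. (a, b) \<in> A \<Longrightarrow> poly a x = 0 \<Longrightarrow> sgn (poly p x) = sgn (poly q (\<phi> x))"
  shows "\<exists>\<psi>. strict_mono \<psi> \<and> surj \<psi> \<and> (\<forall>(a, b) \<in> insert (p, q) A. \<forall>x. sgn (poly a x) = sgn (poly b (\<psi> x)))"
proof -
  define Z where "Z = (\<Union>(a, b)\<in>A. {x. poly a x = 0})"
  have finZ: "finite Z" unfolding Z_def using fin nzA by (auto intro!: poly_roots_finite)
  have Zimg: "\<phi> ` Z = (\<Union>(a, b)\<in>A. {x. poly b x = 0})"
  proof -
    have *: "poly a x = 0 \<longleftrightarrow> poly b (\<phi> x) = 0" if "(a, b) \<in> A" for a b x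
      using sA[OF that, of x] by (metis sgn_zero_iff)
    show ?thesis
    proof (intro equalityI subsetI)
      fix y assume "y \<in> \<phi> ` Z" then show "y \<in> (\<Union>(a, b)\<in>A. {x. poly b x = 0})"
        using * unfolding Z_def by fastforce
    next
      fix y assume "y \<in> (\<Union>(a, b)\<in>A. {x. poly b x = 0})"
      then obtain a b where ab: "(a, b) \<in> A" "poly b y = 0" by auto
      obtain x where "y = \<phi> x" using surj by (auto simp: surj_def)
      then show "y \<in> \<phi> ` Z" using * ab unfolding Z_def by fastforce
    qed
  qed
  have sd: "sgn (poly (pderiv p) x) = sgn (poly (pderiv q) (\<phi> x))" for x by (rule sA[OF der])
  have rp: "x \<in> Z" if "poly (pderiv p) x = 0" for x using that der by (auto simp: Z_def)
  have rq: "x \<in> \<phi> ` Z" if "poly (pderiv q) x = 0" for x using that der by (auto simp: Zimg)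
  have sZ: "sgn (poly p x) = sgn (poly q (\<phi> x))" if "x \<in> Z" for x using that rt by (auto simp: Z_def)
  define Z1 where "Z1 = {z. poly p z = 0 \<and> z \<notin> Z}"
  have finZ1: "finite Z1" unfolding Z1_def using poly_roots_finite[OF nz(1)] by (rule finite_subset[rotated]) auto
  have "\<forall>z\<in>Z1. \<exists>w. poly q w = 0 \<and> w \<notin> \<phi> ` Z \<and> (\<forall>t\<in>Z. t < z \<longleftrightarrow> \<phi> t < w)"
    using poly_root_transfer[OF finZ mono rp sd sZ nz deg lc] by (auto simp: Z1_def)
  then obtain g1 where g1: "\<And>z. z \<in> Z1 \<Longrightarrow> poly q (g1 z) = 0" "\<And>z. z \<in> Z1 \<Longrightarrow> g1 z \<notin> \<phi> ` Z"
    "\<And>z t. z \<in> Z1 \<Longrightarrow> t \<in> Z \<Longrightarrow> t < z \<longleftrightarrow> \<phi> t < g1 z"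
    by metis
  have g1': "g1 z < \<phi> t" if "z \<in> Z1" "t \<in> Z" "z < t" for z t
  proof -
    have "\<not> \<phi> t < g1 z" using g1(3)[OF that(1,2)] that(3) by simp
    moreover have "\<phi> t \<noteq> g1 z" using g1(2)[OF that(1)] that(2) by (metis imageI)
    ultimately show ?thesis by simp
  qed
  define g where "g z = (if z \<in> Z then \<phi> z else g1 z)" for z
  have gmono: "strict_mono_on (Z \<union> Z1) g"
  proof (rule strict_mono_onI)
    fix r s assume rs: "r \<in> Z \<union> Z1" "s \<in> Z \<union> Z1" "r < s"
    consider "r \<in> Z" "s \<in> Z" | "r \<in> Z" "s \<in> Z1" | "r \<in> Z1" "s \<in> Z" | "r \<in> Z1" "s \<in> Z1" using rs by blast
    then show "g r < g s"
    proof cases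
      case 1 then show ?thesis using rs mono by (simp add: g_def strict_mono_less)
    next
      case 2 then show ?thesis using rs g1(3) by (auto simp: g_def Z1_def)
    next
      case 3
      then have "g1 r < \<phi> s" using rs g1' by blast
      with 3 show ?thesis by (auto simp: g_def Z1_def)
    next
      case 4
      \<comment> \<open>By Rolle's theorem two new roots are separated by a root of the derivative,
        hence by a point of \<open>Z\<close>, and the image of that point separates their
        images.\<close>
      then obtain t where t: "r < t" "t < s" "poly (pderiv p) t = 0"
        using poly_root_between_deriv[OF rs(3)] by (auto simp: Z1_def)
      then have "t \<in> Z" using rp by blast
      then have "g1 r < \<phi> t" using t g1' 4 by blast
      moreover have "\<phi> t < g1 s" using g1(3)[OF 4(2) \<open>t \<in> Z\<close>] t by simp
      ultimately show ?thesis using 4 by (auto simp: g_def Z1_def)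
    qed
  qed
  obtain \<psi> where \<psi>: "strict_mono \<psi>" "surj \<psi>" "\<And>z. z \<in> Z \<union> Z1 \<Longrightarrow> \<psi> z = g z"
    using strict_mono_interpolation[OF _ gmono] finZ finZ1 by auto
  have \<psi>Z: "\<psi> z = \<phi> z" if "z \<in> Z" for z using \<psi>(3)[of z] that by (simp add: g_def)
  have \<psi>Z1: "poly q (\<psi> z) = 0" if "z \<in> Z1" for z using \<psi>(3)[of z] that g1(1) by (simp add: g_def Z1_def)
  have inj\<psi>: "\<psi> x = \<psi> y \<longleftrightarrow> x = y" for x y using \<psi>(1) by (simp add: strict_mono_eq)
  have \<psi>less: "\<psi> x < \<psi> y \<longleftrightarrow> x < y" for x y using \<psi>(1) by (simp add: strict_mono_less)
  have \<psi>le: "\<psi> x \<le> \<psi> y \<longleftrightarrow> x \<le> y" for x y using \<psi>(1) by (simp add: strict_mono_less_eq)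
  have in\<phi>Z: "\<psi> x \<in> \<phi> ` Z \<longleftrightarrow> x \<in> Z" for x
    using \<psi>Z inj\<psi> by (metis image_iff)
  have sA\<psi>: "sgn (poly a x) = sgn (poly b (\<psi> x))" if ab: "(a, b) \<in> A" for a b x
  proof (cases "x \<in> Z")
    case True then show ?thesis using sA[OF ab] \<psi>Z by simp
  next
    case False
    \<comment> \<open>\<open>\<phi>\<close> and \<open>\<psi>\<close> agree on \<open>Z\<close>, so
      \<open>\<phi> x\<close> and \<open>\<psi> x\<close> lie in the same gap of the image of
      \<open>Z\<close>, where \<open>b\<close> has no root.\<close>
    have nr: "poly b y \<noteq> 0" if y: "min (\<phi> x) (\<psi> x) \<le> y" "y \<le> max (\<phi> x) (\<psi> x)" for y
    proof
      assume "poly b y = 0"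
      then have "y \<in> \<phi> ` Z" using Zimg ab by auto
      then obtain t where t: "t \<in> Z" "y = \<phi> t" by blast
      have "t \<noteq> x" using t False by auto
      then consider "t < x" | "x < t" by linarith
      then show False
      proof cases
        case 1
        then have "\<phi> t < \<phi> x" "\<psi> t < \<psi> x" using mono \<psi>less by (auto simp: strict_mono_less)
        with y t \<psi>Z show False by auto
      next
        case 2
        then have "\<phi> x < \<phi> t" "\<psi> x < \<psi> t" using mono \<psi>less by (auto simp: strict_mono_less)
        with y t \<psi>Z show False by auto
      qed
    qed
    have "sgn (poly b (\<phi> x)) = sgn (poly b (\<psi> x))"
    proof (cases "\<phi> x" "\<psi> x" rule: linorder_cases)
      case less then show ?thesis by (intro poly_sgn_eq_no_root nr) auto
    next
      case greater
      have "sgn (poly b (\<psi> x)) = sgn (poly b (\<phi> x))"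
        by (rule poly_sgn_eq_no_root[OF greater]) (rule nr, use greater in auto)
      then show ?thesis by simp
    qed auto
    then show ?thesis using sA[OF ab] by simp
  qed
  \<comment> \<open>No root of \<open>q\<close> is overlooked: the transfer is applied to the
    inverse of \<open>\<phi>\<close> with \<open>p\<close> and \<open>q\<close> exchanged. It gives
    a root of \<open>p\<close> in the gap of \<open>x\<close>; its image and \<open>\<psi> x\<close>
    would be two roots of \<open>q\<close> with no root of the derivative in between.\<close>
  have root_q: "x \<in> Z \<union> Z1" if r: "poly q (\<psi> x) = 0" for x
  proof (rule ccontr)
    assume nx: "x \<notin> Z \<union> Z1"
    let ?i = "inv \<phi>"
    have i: "\<phi> (?i y) = y" "?i (\<phi> y) = y" for y
      using surj mono by (auto simp: surj_f_inv_f strict_mono_imp_inj_on inv_f_f)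
    have imono: "strict_mono ?i"
      by (rule strict_monoI) (metis i(1) mono strict_mono_less)
    have "\<exists>w. poly p w = 0 \<and> w \<notin> ?i ` (\<phi> ` Z) \<and> (\<forall>t\<in>\<phi> ` Z. t < \<psi> x \<longleftrightarrow> ?i t < w)"
    proof (rule poly_root_transfer[of "\<phi> ` Z" ?i q p "\<psi> x"])
      show "sgn (poly (pderiv q) y) = sgn (poly (pderiv p) (inv \<phi> y))" for y using sd[of "?i y"] i by simp
      show "sgn (poly q y) = sgn (poly p (inv \<phi> y))" if "y \<in> \<phi> ` Z" for y using sZ i that by fastforce
      show "\<psi> x \<notin> \<phi> ` Z" using in\<phi>Z nx by blast
    qed (use finZ imono rq nz deg lc r in auto)
    then obtain w where w: "poly p w = 0" "w \<notin> Z" "\<And>t. t \<in> Z \<Longrightarrow> \<phi> t < \<psi> x \<longleftrightarrow> t < w"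
      using i by (auto simp: image_image)
    then have wZ1: "w \<in> Z1" by (simp add: Z1_def)
    have "w \<noteq> x" using wZ1 nx by auto
    moreover have "poly q (\<psi> w) = 0" by (rule \<psi>Z1[OF wZ1])
    ultimately obtain t where t: "poly (pderiv q) (\<psi> t) = 0" "(w < t \<and> t < x) \<or> (x < t \<and> t < w)"
      using poly_root_between_deriv[of "\<psi> w" "\<psi> x" q] poly_root_between_deriv[of "\<psi> x" "\<psi> w" q] r \<psi>less \<psi>(2)
      by (metis linorder_neqE_linordered_idom surj_def)
    then have tZ: "t \<in> Z" using rq in\<phi>Z by blast
    have "t < x \<longleftrightarrow> t < w" using w(3)[OF tZ] \<psi>less \<psi>Z[OF tZ] by metis
    with t show False by auto
  qed
  have sp: "sgn (poly p x) = sgn (poly q (\<psi> x))" for x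
  proof (cases "x \<in> Z \<union> Z1")
    case True
    then show ?thesis using sZ \<psi>Z \<psi>Z1 by (auto simp: Z1_def)
  next
    case nx: False
    have sder: "sgn (poly (pderiv p) y) = sgn (poly (pderiv q) (\<psi> y))" for y by (rule sA\<psi>[OF der])
    \<comment> \<open>The sign at \<open>x\<close> is read off from the next marked point
      \<open>t\<close> on the right. If \<open>p\<close> vanishes at \<open>t\<close>, it is
      opposite to the sign of the derivative at \<open>x\<close>; otherwise it is the sign at
      \<open>t\<close>. Without such a point it is the sign near infinity.\<close>
    show ?thesis
    proof (cases "{t \<in> Z \<union> Z1. x < t} = {}")
      case True
      have np: "poly p y \<noteq> 0" if "x \<le> y" for y using nx True that by (force simp: Z1_def)
      have nq: "poly q y \<noteq> 0" if "\<psi> x \<le> y" for y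
      proof -
        obtain s where s: "y = \<psi> s" using \<psi>(2) by (auto simp: surj_def)
        with that have "x \<le> s" using \<psi>le by simp
        then show ?thesis using root_q[of s] s nx True by force
      qed
      obtain n where n: "\<forall>x\<ge>n. sgn (poly p x) = sgn (lead_coeff p)" using poly_sgn_at_top nz by blast
      obtain m where m: "\<forall>x\<ge>m. sgn (poly q x) = sgn (lead_coeff q)" using poly_sgn_at_top nz by blast
      have "sgn (poly p x) = sgn (poly p (max n (x + 1)))" by (rule poly_sgn_eq_no_root) (use np in auto)
      moreover have "sgn (poly q (\<psi> x)) = sgn (poly q (max m (\<psi> x + 1)))"
        by (rule poly_sgn_eq_no_root) (use nq in auto)
      ultimately show ?thesis using n m lc by simp
    next
      case False
      define t where "t = Min {t \<in> Z \<union> Z1. x < t}"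
      have t: "t \<in> Z \<union> Z1" "x < t" "\<And>s. s \<in> Z \<union> Z1 \<Longrightarrow> x < s \<Longrightarrow> t \<le> s"
        using Min_in[OF _ False] finZ finZ1 by (auto simp: t_def)
      have gap: "s \<notin> Z \<union> Z1" if "x \<le> s" "s < t" for s using t(3)[of s] nx that by force
      have gapq: "\<exists>s. y = \<psi> s \<and> x \<le> s \<and> s < t" if "\<psi> x \<le> y" "y < \<psi> t" for y
        using that \<psi>(2) \<psi>le \<psi>less by (metis surj_def)
      show ?thesis
      proof (cases "poly p t = 0")
        case True
        have "poly q (\<psi> t) = 0"
          using t(1) True \<psi>Z1 \<psi>Z sZ by (metis Un_iff sgn_zero_iff)
        moreover have "sgn (poly q (\<psi> t) - poly q (\<psi> x)) = sgn (poly (pderiv q) (\<psi> x))"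
          by (rule poly_MVT_sgn_left) (use t \<psi>less gapq gap rq in\<phi>Z in blast)+
        moreover have "sgn (poly p t - poly p x) = sgn (poly (pderiv p) x)"
          by (rule poly_MVT_sgn_left) (use t gap rp in blast)+
        ultimately have "- sgn (poly p x) = - sgn (poly q (\<psi> x))"
          using True sder[of x] by (simp add: sgn_minus)
        then show ?thesis by simp
      next
        case False
        then have tZ: "t \<in> Z" using t(1) by (auto simp: Z1_def)
        have st: "sgn (poly p t) = sgn (poly q (\<psi> t))" using sZ[OF tZ] \<psi>Z[OF tZ] by simp
        have "sgn (poly p x) = sgn (poly p t)"
          by (rule poly_sgn_eq_no_root[OF t(2)]) (use gap False in \<open>force simp: Z1_def\<close>)
        moreover have "sgn (poly q (\<psi> x)) = sgn (poly q (\<psi> t))"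
        proof (rule poly_sgn_eq_no_root)
          show "\<psi> x < \<psi> t" using t \<psi>less by simp
          fix y assume y: "\<psi> x \<le> y" "y \<le> \<psi> t"
          show "poly q y \<noteq> 0"
          proof (cases "y = \<psi> t")
            case True then show ?thesis using st False by (metis sgn_zero_iff)
          next
            case False
            then show ?thesis using gapq[of y] y gap root_q by force
          qed
        qed
        ultimately show ?thesis using st by simp
      qed
    qed
  qed
  show ?thesis using \<psi>(1,2) sA\<psi> sp by blast
qed

section \<open>Quantifier elimination\<close>

text \<open>The argument is a valuation of countably many variables, so that quantifying over the
  variable \<open>i\<close> means quantifying over \<open>x\<close> in \<open>e(i := x)\<close>,
  without any syntax of formulas.\<close>

inductive_set mpoly_fun :: "((nat \<Rightarrow> real) \<Rightarrow> real) set" where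
  const: "(\<lambda>e. c) \<in> mpoly_fun"
| coord: "(\<lambda>e. e i) \<in> mpoly_fun"
| add: "p \<in> mpoly_fun \<Longrightarrow> q \<in> mpoly_fun \<Longrightarrow> (\<lambda>e. p e + q e) \<in> mpoly_fun"
| mult: "p \<in> mpoly_fun \<Longrightarrow> q \<in> mpoly_fun \<Longrightarrow> (\<lambda>e. p e * q e) \<in> mpoly_fun"

lemma mpoly_fun_minus: "p \<in> mpoly_fun \<Longrightarrow> (\<lambda>e. - p e) \<in> mpoly_fun"
  using mpoly_fun.mult[OF mpoly_fun.const[of "-1"], of p] by simp

lemma mpoly_fun_diff: "p \<in> mpoly_fun \<Longrightarrow> q \<in> mpoly_fun \<Longrightarrow> (\<lambda>e. p e - q e) \<in> mpoly_fun"
  using mpoly_fun.add[OF _ mpoly_fun_minus, of p q] by simp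

lemma mpoly_fun_sum:
  "finite A \<Longrightarrow> (\<And>k. k \<in> A \<Longrightarrow> f k \<in> mpoly_fun) \<Longrightarrow> (\<lambda>e. \<Sum>k\<in>A. f k e) \<in> mpoly_fun"
  by (induction A rule: finite_induct) (auto intro: mpoly_fun.intros)

lemma mpoly_fun_power: "p \<in> mpoly_fun \<Longrightarrow> (\<lambda>e. p e ^ k) \<in> mpoly_fun"
  by (induction k) (auto intro: mpoly_fun.intros)

lemma poly_degree_0: "degree p = 0 \<Longrightarrow> poly p x = coeff p 0"
  by (elim degree_eq_zeroE) simp

text \<open>\<open>n\<close> is only a formal degree: the coefficient at \<open>n\<close> may vanish
  at some or all parameters.\<close>

definition polyfam :: "nat \<Rightarrow> ((nat \<Rightarrow> real) \<Rightarrow> real poly) \<Rightarrow> bool" where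
  "polyfam n f \<longleftrightarrow> (\<forall>k. (\<lambda>e. coeff (f e) k) \<in> mpoly_fun) \<and> (\<forall>e. degree (f e) \<le> n)"

lemma polyfam_coeff: "polyfam n f \<Longrightarrow> (\<lambda>e. coeff (f e) k) \<in> mpoly_fun"
  and polyfam_degree: "polyfam n f \<Longrightarrow> degree (f e) \<le> n"
  by (auto simp: polyfam_def)

lemma polyfam_const: "c \<in> mpoly_fun \<Longrightarrow> polyfam 0 (\<lambda>e. [:c e:])"
  unfolding polyfam_def
proof (intro conjI allI)
  fix k assume "c \<in> mpoly_fun"
  then show "(\<lambda>e. coeff [:c e:] k) \<in> mpoly_fun" by (cases k) (auto intro: mpoly_fun.intros)
qed auto

lemma polyfam_add: "polyfam n f \<Longrightarrow> polyfam m g \<Longrightarrow> polyfam (max n m) (\<lambda>e. f e + g e)"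
  unfolding polyfam_def
  by (auto intro!: mpoly_fun.intros degree_add_le_max[THEN order_trans] max.mono)

lemma polyfam_mult: "polyfam n f \<Longrightarrow> polyfam m g \<Longrightarrow> polyfam (n + m) (\<lambda>e. f e * g e)"
  unfolding polyfam_def coeff_mult
  by (intro conjI allI mpoly_fun_sum mpoly_fun.mult order_trans[OF degree_mult_le] add_mono) auto

lemma polyfam_X: "polyfam 1 (\<lambda>e. [:0, 1:])"
  unfolding polyfam_def by (auto intro: mpoly_fun.intros)

lemma polyfam_pderiv: "polyfam n f \<Longrightarrow> polyfam (n - 1) (\<lambda>e. pderiv (f e))"
  unfolding polyfam_def coeff_pderiv
  by (intro conjI allI mpoly_fun.mult mpoly_fun.const) (simp_all add: degree_pderiv diff_le_mono)

lemma polyfam_monom: "c \<in> mpoly_fun \<Longrightarrow> polyfam k (\<lambda>e. monom (c e) k)"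
  unfolding polyfam_def
proof (intro conjI allI)
  fix j assume "c \<in> mpoly_fun"
  then show "(\<lambda>e. coeff (monom (c e) k) j) \<in> mpoly_fun"
    by (cases "k = j") (auto simp: coeff_monom intro: mpoly_fun.intros)
qed (rule degree_monom_le)

lemma polyfam_diff: "polyfam n f \<Longrightarrow> polyfam n g \<Longrightarrow> polyfam n (\<lambda>e. f e - g e)"
  unfolding polyfam_def by (auto intro!: mpoly_fun_diff degree_diff_le)

lemma polyfam_reduce:
  assumes "polyfam n f" "0 < n" "\<And>e. coeff (f e) n = 0"
  shows "polyfam (n - 1) f"
  unfolding polyfam_def
proof (intro conjI allI)
  fix e
  have "degree (f e) \<le> n" using assms(1) by (rule polyfam_degree)
  moreover have "degree (f e) \<noteq> n"
    using assms(2) assms(3)[of e] by (metis degree_0 leading_coeff_0_iff less_irrefl)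
  ultimately show "degree (f e) \<le> n - 1" by linarith
qed (use assms(1) in \<open>auto simp: polyfam_def\<close>)

lemma polyfam_truncate:
  assumes "polyfam n f" "0 < n"
  shows "polyfam (n - 1) (\<lambda>e. f e - monom (coeff (f e) n) n)"
  by (rule polyfam_reduce)
    (use assms in \<open>auto intro!: polyfam_diff polyfam_monom polyfam_coeff\<close>)

lemma polyfam_subst:
  assumes "q \<in> mpoly_fun"
  shows "\<exists>n f. polyfam n f \<and> (\<forall>e x. q (e(i := x)) = poly (f e) x)"
  using assms
proof induction
  case (const c)
  show ?case by (intro exI[of _ 0] exI[of _ "\<lambda>e. [:c:]"]) (auto intro: polyfam_const mpoly_fun.intros)
next
  case (coord j)
  show ?case
  proof (cases "j = i")
    case True
    then show ?thesis by (intro exI[of _ 1] exI[of _ "\<lambda>e. [:0, 1:]"]) (auto intro: polyfam_X[simplified])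
  next
    case False
    then show ?thesis
      by (intro exI[of _ 0] exI[of _ "\<lambda>e. [:e j:]"]) (auto intro: polyfam_const mpoly_fun.intros)
  qed
next
  case (add p q)
  then obtain n f m g where "polyfam n f" "polyfam m g"
    "\<forall>e x. p (e(i := x)) = poly (f e) x" "\<forall>e x. q (e(i := x)) = poly (g e) x" by blast
  then show ?case by (intro exI[of _ "max n m"] exI[of _ "\<lambda>e. f e + g e"]) (auto intro: polyfam_add simp del: fun_upd_apply)
next
  case (mult p q)
  then obtain n f m g where "polyfam n f" "polyfam m g"
    "\<forall>e x. p (e(i := x)) = poly (f e) x" "\<forall>e x. q (e(i := x)) = poly (g e) x" by blast
  then show ?case by (intro exI[of _ "n + m"] exI[of _ "\<lambda>e. f e * g e"]) (auto intro: polyfam_mult simp del: fun_upd_apply)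
qed

text \<open>A pseudo-remainder, specified only through its values at the roots of the divisor.\<close>
lemma polyfam_pseudo_remainder:
  assumes "polyfam n f" "polyfam m g" "0 < m"
  shows "\<exists>r k. polyfam (m - 1) r \<and>
    (\<forall>e x. poly (g e) x = 0 \<longrightarrow> poly (r e) x = coeff (g e) m ^ k * poly (f e) x)"
  using assms(1)
proof (induction n arbitrary: f rule: less_induct)
  case (less n)
  show ?case
  proof (cases "n < m")
    case True
    then have "polyfam (m - 1) f" using less.prems unfolding polyfam_def
      by (metis Suc_diff_1 Suc_leI Suc_le_mono assms(3) order_trans)
    then show ?thesis by (intro exI[of _ f] exI[of _ 0]) auto
  next
    case False
    \<comment> \<open>One division step: after multiplication by the formal leading coefficient of
      \<open>g\<close> the leading terms cancel, and at a root of \<open>g\<close> the new value is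
      that coefficient times the old one.\<close>
    define f' where "f' e = [:coeff (g e) m:] * f e - monom (coeff (f e) n) (n - m) * g e" for e
    have *: "polyfam (0 + n) (\<lambda>e. [:coeff (g e) m:] * f e)"
      by (intro polyfam_mult polyfam_const polyfam_coeff[OF assms(2)] less.prems)
    have **: "polyfam ((n - m) + m) (\<lambda>e. monom (coeff (f e) n) (n - m) * g e)"
      by (intro polyfam_mult polyfam_monom polyfam_coeff[OF less.prems] assms)
    have pf: "polyfam n f'" unfolding f'_def
      by (intro polyfam_diff) (use * ** False in auto)
    have "polyfam (n - 1) f'"
      by (rule polyfam_reduce[OF pf])
        (use assms(3) False in \<open>auto simp: f'_def coeff_monom_mult\<close>)
    moreover have "n - 1 < n" using assms(3) False by simp
    ultimately obtain r k where r: "polyfam (m - 1) r"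
      "\<forall>e x. poly (g e) x = 0 \<longrightarrow> poly (r e) x = coeff (g e) m ^ k * poly (f' e) x"
      using less.IH by blast
    then show ?thesis
      by (intro exI[of _ r] exI[of _ "Suc k"]) (auto simp: f'_def)
  qed
qed

text \<open>The bijection \<open>\<phi>\<close> matches the sign diagrams of the whole family at the parameters \<open>e\<close> and \<open>e'\<close>.\<close>
definition sign_determines ::
  "((nat \<Rightarrow> real) \<Rightarrow> real) set \<Rightarrow> ((nat \<Rightarrow> real) \<Rightarrow> real poly) set \<Rightarrow> bool" where
  "sign_determines Q P \<longleftrightarrow> finite Q \<and> Q \<subseteq> mpoly_fun \<and>
     (\<forall>e e'. (\<forall>q\<in>Q. sgn (q e) = sgn (q e')) \<longrightarrow>
       (\<exists>\<phi>. strict_mono \<phi> \<and> surj \<phi> \<and> (\<forall>f\<in>P. \<forall>x. sgn (poly (f e) x) = sgn (poly (f e') (\<phi> x)))))"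

lemma sign_determinesD:
  assumes "sign_determines Q P"
  shows "finite Q" "Q \<subseteq> mpoly_fun"
    "(\<And>q. q \<in> Q \<Longrightarrow> sgn (q e) = sgn (q e')) \<Longrightarrow>
      \<exists>\<phi>. strict_mono \<phi> \<and> surj \<phi> \<and> (\<forall>f\<in>P. \<forall>x. sgn (poly (f e) x) = sgn (poly (f e') (\<phi> x)))"
  using assms unfolding sign_determines_def by simp_all

text \<open>If all leading coefficients are nonzero, replace a polynomial of maximal degree by its derivative
  and its pseudo-remainders modulo the others; otherwise drop a vanishing leading term.\<close>
lemma ex_sign_determines:
  assumes "\<And>n f. (n, f) \<in> set ps \<Longrightarrow> polyfam n f"
  shows "\<exists>Q. sign_determines Q (snd ` set ps)"
  using assms
\<comment> \<open>The measure is the multiset of formal degrees. Replacing an entry by any number of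
  smaller ones decreases it, which pays for the many pseudo-remainders.\<close>
proof (induction ps rule: wf_induct_rule[OF wf_inv_image[OF wf_mult[OF wf_less_than],
      of "\<lambda>ps. mset (map fst ps)"], case_names less])
  case (less ps)
  note fam = less.prems
  show ?case
  proof (cases "\<forall>(n, f) \<in> set ps. n = 0")
    case True
    let ?Q = "(\<lambda>f e. coeff (f e) 0) ` snd ` set ps"
    have c: "poly (f e) x = coeff (f e) 0" if f: "(n, f) \<in> set ps" for n f e x
    proof -
      have "n = 0" using True f by auto
      then have "degree (f e) = 0" using polyfam_degree[OF fam[OF f], of e] by simp
      then show ?thesis by (rule poly_degree_0)
    qed
    show ?thesis unfolding sign_determines_def
    proof (intro exI[of _ ?Q] conjI allI impI)
      show "?Q \<subseteq> mpoly_fun" using fam polyfam_coeff by force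
      fix e e' assume "\<forall>q\<in>?Q. sgn (q e) = sgn (q e')"
      then show "\<exists>\<phi>. strict_mono \<phi> \<and> surj \<phi> \<and> (\<forall>f\<in>snd ` set ps. \<forall>x. sgn (poly (f e) x) = sgn (poly (f e') (\<phi> x)))"
        by (intro exI[of _ id]) (auto simp: strict_mono_def c)
    qed auto
  next
    case False
    define n where "n = Max (fst ` set ps)"
    have ne: "set ps \<noteq> {}" using False by auto
    then have "n \<in> fst ` set ps" unfolding n_def by (intro Max_in) auto
    then obtain f where f: "(n, f) \<in> set ps" by force
    have nmax: "m \<le> n" if "(m, g) \<in> set ps" for m g
      unfolding n_def by (rule Max_ge) (use that in force)+
    have n0: "0 < n" using False nmax by fastforce
    \<comment> \<open>One copy of \<open>f\<close> is exchanged for its derivative;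
      \<open>ps2\<close> adds a pseudo-remainder of \<open>f\<close> modulo every member of
      \<open>rest\<close> of positive formal degree.\<close>
    define rest where "rest = (n - 1, \<lambda>e. pderiv (f e)) # remove1 (n, f) ps"
    have famf: "polyfam n f" using fam f by blast
    have famr: "polyfam m g" if "(m, g) \<in> set rest" for m g
      using that fam polyfam_pderiv[OF famf] set_remove1_subset[of "(n, f)" ps] by (auto simp: rest_def)
    have restn: "m \<le> n" if "(m, g) \<in> set rest" for m g
      using that nmax set_remove1_subset[of "(n, f)" ps] by (auto simp: rest_def)
    have "\<forall>p\<in>set rest. \<exists>r k. 0 < fst p \<longrightarrow> polyfam (fst p - 1) r \<and>
       (\<forall>e x. poly (snd p e) x = 0 \<longrightarrow> poly (r e) x = coeff (snd p e) (fst p) ^ k * poly (f e) x)"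
      using polyfam_pseudo_remainder[OF famf] famr by (metis prod.collapse)
    then obtain R K where RK: "\<And>m g. (m, g) \<in> set rest \<Longrightarrow> 0 < m \<Longrightarrow> polyfam (m - 1) (R (m, g)) \<and>
       (\<forall>e x. poly (g e) x = 0 \<longrightarrow> poly (R (m, g) e) x = coeff (g e) m ^ K (m, g) * poly (f e) x)"
      by (metis fst_conv snd_conv)
    define ps2 where "ps2 = rest @ map (\<lambda>p. (fst p - 1, R p)) (filter (\<lambda>p. 0 < fst p) rest)"
    have in_rem: "p \<in> set (remove1 q ps)" if "p \<in> set ps" "p \<noteq> q" for p q
      using that by (simp add: in_set_remove1)
    have fromps: "\<exists>k. (k, h) \<in> set ps" if "h \<in> snd ` set ps" for h
      using that by force
    have split: "mset (map fst ps) = mset (map fst (remove1 p ps)) + {#fst p#}" if "p \<in> set ps" for p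
    proof -
      have "mset ps = add_mset p (mset (remove1 p ps))" using that by simp
      then show ?thesis by (metis add_mset_add_single image_mset_add_mset mset_map)
    qed
    have dec: "(M + N, M + {#k#}) \<in> mult less_than" if "\<And>j. j \<in># N \<Longrightarrow> j < k" for M N :: "nat multiset" and k
      by (rule one_step_implies_mult) (use that in auto)
    have "(mset (map fst ps2), mset (map fst ps)) \<in> mult less_than"
    proof -
      have "mset (map fst ps2) = mset (map fst (remove1 (n, f) ps)) +
          mset ((n - 1) # map (\<lambda>p. fst p - 1) (filter (\<lambda>p. 0 < fst p) rest))"
        unfolding ps2_def rest_def by (simp add: comp_def)
      moreover have "j < n" if "j \<in># mset ((n - 1) # map (\<lambda>p. fst p - 1) (filter (\<lambda>p. 0 < fst p) rest))" for j
        using that n0 restn by force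
      ultimately show ?thesis using dec split[OF f] by (metis fst_conv)
    qed
    moreover have "polyfam m g" if "(m, g) \<in> set ps2" for m g
      using that famr RK by (auto simp: ps2_def)
    ultimately obtain Q2 where Q2: "sign_determines Q2 (snd ` set ps2)"
      using less.IH[of ps2] by (auto simp: in_inv_image)
    \<comment> \<open>For parameters at which the formal leading coefficient of \<open>p\<close>
      vanishes: at formal degree 0 the polynomial is then zero and is dropped, otherwise it loses
      its leading term.\<close>
    define tr where "tr p = (if fst p = 0 then remove1 p ps else
       (fst p - 1, \<lambda>e. snd p e - monom (coeff (snd p e) (fst p)) (fst p)) # remove1 p ps)" for p
    have "\<exists>Q. sign_determines Q (snd ` set (tr p))" if p: "p \<in> set ps" for p
    proof (rule less.IH)
      have "(mset (map fst (tr p)), mset (map fst ps)) \<in> mult less_than"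
      proof (cases "fst p = 0")
        case True then show ?thesis using split[OF p] dec[of "{#}" "fst p"] by (simp add: tr_def)
      next
        case False
        then have "mset (map fst (tr p)) = mset (map fst (remove1 p ps)) + {#fst p - 1#}" by (simp add: tr_def)
        then show ?thesis using split[OF p] dec[of "{#fst p - 1#}" "fst p"] False by simp
      qed
      then show "(tr p, ps) \<in> inv_image (mult less_than) (\<lambda>ps. mset (map fst ps))" by (simp add: in_inv_image)
    next
      fix m g assume "(m, g) \<in> set (tr p)"
      then show "polyfam m g" using fam set_remove1_subset[of p ps] p polyfam_truncate[of "fst p" "snd p"]
        by (auto simp: tr_def split: if_splits)
    qed
    then obtain QQ where QQ: "\<And>p. p \<in> set ps \<Longrightarrow> sign_determines (QQ p) (snd ` set (tr p))" by metis
    \<comment> \<open>The signs of the formal leading coefficients decide which case applies; the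
      other members are the polynomials required in each case.\<close>
    define Q where "Q = (\<lambda>p e. coeff (snd p e) (fst p)) ` set ps \<union> \<Union> (QQ ` set ps) \<union> Q2"
    show ?thesis unfolding sign_determines_def
    proof (intro exI[of _ Q] conjI allI impI)
      show "finite Q" unfolding Q_def using QQ Q2 by (auto dest: sign_determinesD)
      have "(\<lambda>e. coeff (snd p e) (fst p)) \<in> mpoly_fun" if "p \<in> set ps" for p
        using that fam polyfam_coeff by (metis prod.collapse)
      then show "Q \<subseteq> mpoly_fun" unfolding Q_def using sign_determinesD(2)[OF QQ] sign_determinesD(2)[OF Q2] by blast
      fix e e' assume eq: "\<forall>q\<in>Q. sgn (q e) = sgn (q e')"
      have lead: "sgn (coeff (snd p e) (fst p)) = sgn (coeff (snd p e') (fst p))" if "p \<in> set ps" for p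
      proof -
        have "(\<lambda>e. coeff (snd p e) (fst p)) \<in> Q" using that unfolding Q_def by blast
        from eq[rule_format, OF this] show ?thesis .
      qed
      have eqQQ: "sgn (q e) = sgn (q e')" if "p \<in> set ps" "q \<in> QQ p" for p q
      proof -
        have "q \<in> Q" using that unfolding Q_def by blast
        from eq[rule_format, OF this] show ?thesis .
      qed
      have eqQ2: "sgn (q e) = sgn (q e')" if "q \<in> Q2" for q
      proof -
        have "q \<in> Q" using that unfolding Q_def by blast
        from eq[rule_format, OF this] show ?thesis .
      qed
      show "\<exists>\<phi>. strict_mono \<phi> \<and> surj \<phi> \<and> (\<forall>f\<in>snd ` set ps. \<forall>x. sgn (poly (f e) x) = sgn (poly (f e') (\<phi> x)))"
      proof (cases "\<exists>p\<in>set ps. coeff (snd p e) (fst p) = 0")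
        case True
        then obtain m g where p: "(m, g) \<in> set ps" "coeff (g e) m = 0" by fastforce
        then have p': "coeff (g e') m = 0" using lead[OF p(1)] by (simp add: sgn_zero_iff)
        obtain \<phi> where \<phi>: "strict_mono \<phi>" "surj \<phi>"
          "\<forall>f\<in>snd ` set (tr (m, g)). \<forall>x. sgn (poly (f e) x) = sgn (poly (f e') (\<phi> x))"
          using sign_determinesD(3)[OF QQ[OF p(1)], of e e', OF eqQQ[OF p(1)]] by blast
        have "sgn (poly (h e) x) = sgn (poly (h e') (\<phi> x))" if h: "(k, h) \<in> set ps" for k h x
        proof (cases "(k, h) = (m, g)")
          case False
          have "set (remove1 (m, g) ps) \<subseteq> set (tr (m, g))" unfolding tr_def by auto
          then have "(k, h) \<in> set (tr (m, g))" using in_rem[OF h False] by blast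
          then have in_tr: "h \<in> snd ` set (tr (m, g))" by (rule image_eqI[rotated]) simp
          show ?thesis by (rule \<phi>(3)[rule_format, OF in_tr])
        next
          case True
          show ?thesis
          proof (cases "m = 0")
            case m: True
            have "g e = 0" "g e' = 0"
              using polyfam_degree[OF fam[OF p(1)]] p(2) p' m by (metis le_zero_eq leading_coeff_0_iff)+
            then show ?thesis using True by simp
          next
            case False
            then have in_tr: "(\<lambda>e. g e - monom (coeff (g e) m) m) \<in> snd ` set (tr (m, g))" by (simp add: tr_def)
            have "sgn (poly (g e - monom (coeff (g e) m) m) x) = sgn (poly (g e' - monom (coeff (g e') m) m) (\<phi> x))"
              using \<phi>(3)[rule_format, OF in_tr, of x] .
            then show ?thesis using p(2) p' True by simp
          qed
        qed
        then show ?thesis using \<phi>(1,2) fromps by (intro exI[of _ \<phi>]) blast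
      next
        case False
        then have nz: "coeff (g e) m \<noteq> 0" "coeff (g e') m \<noteq> 0" if "(m, g) \<in> set ps" for m g
        proof -
          show g: "coeff (g e) m \<noteq> 0" using False that by (metis fst_conv snd_conv)
          then show "coeff (g e') m \<noteq> 0" using lead[OF that] by (metis fst_conv snd_conv sgn_zero_iff)
        qed
        obtain \<phi> where \<phi>: "strict_mono \<phi>" "surj \<phi>"
          "\<And>f x. f \<in> snd ` set ps2 \<Longrightarrow> sgn (poly (f e) x) = sgn (poly (f e') (\<phi> x))"
          using sign_determinesD(3)[OF Q2, of e e', OF eqQ2] by blast
        have nzr: "coeff (g e) m \<noteq> 0 \<and> coeff (g e') m \<noteq> 0 \<and> sgn (coeff (g e) m) = sgn (coeff (g e') m)"
          if "(m, g) \<in> set rest" for m g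
        proof (cases "(m, g) \<in> set ps")
          case True then show ?thesis using nz[OF True] lead[OF True] by simp
        next
          case F: False
          then have "m = n - 1" "g = (\<lambda>e. pderiv (f e))"
            using that set_remove1_subset[of "(n, f)" ps] by (auto simp: rest_def)
          then show ?thesis using nz[OF f] lead[OF f] n0 by (simp add: coeff_pderiv sgn_mult)
        qed
        have degn: "degree (f e) = n" "degree (f e') = n"
          using nz[OF f] polyfam_degree[OF famf] by (auto intro: antisym le_degree)
        define A where "A = (\<lambda>g. (g e, g e')) ` snd ` set rest"
        have "\<exists>\<psi>. strict_mono \<psi> \<and> surj \<psi> \<and>
          (\<forall>(a, b) \<in> insert (f e, f e') A. \<forall>x. sgn (poly a x) = sgn (poly b (\<psi> x)))"
        proof (rule sign_preserving_extend[OF _ \<phi>(1,2)])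
          show "finite A" by (simp add: A_def)
          show "a \<noteq> 0 \<and> b \<noteq> 0" if ab: "(a, b) \<in> A" for a b
          proof -
            obtain m g where g: "(m, g) \<in> set rest" "a = g e" "b = g e'" using ab by (auto simp: A_def)
            have "coeff a m \<noteq> 0" "coeff b m \<noteq> 0" using nzr[OF g(1)] unfolding g(2,3) by blast+
            then show ?thesis by (metis coeff_0)
          qed
          show "sgn (poly a x) = sgn (poly b (\<phi> x))" if ab: "(a, b) \<in> A" for a b x
          proof -
            obtain m g where g: "(m, g) \<in> set rest" "a = g e" "b = g e'" using ab by (auto simp: A_def)
            have "(m, g) \<in> set ps2" using g(1) unfolding ps2_def by simp
            then have "g \<in> snd ` set ps2" by (rule image_eqI[rotated]) simp
            then show ?thesis unfolding g(2,3) by (rule \<phi>(3))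
          qed
          show "(pderiv (f e), pderiv (f e')) \<in> A" by (auto simp: A_def rest_def)
          show "f e \<noteq> 0" using nz(1)[OF f] by (metis coeff_0)
          show "f e' \<noteq> 0" using nz(2)[OF f] by (metis coeff_0)
          show "degree (f e) = degree (f e')" using degn by simp
          show "sgn (lead_coeff (f e)) = sgn (lead_coeff (f e'))" using lead[OF f] degn by simp
          show "sgn (poly (f e) x) = sgn (poly (f e') (\<phi> x))" if ab: "(a, b) \<in> A" and root: "poly a x = 0" for a b x
          proof -
            obtain m g where g: "(m, g) \<in> set rest" "a = g e" "b = g e'" using ab by (auto simp: A_def)
            have "(m, g) \<in> set ps2" using g(1) unfolding ps2_def by simp
            then have "g \<in> snd ` set ps2" by (rule image_eqI[rotated]) simp
            then have "sgn (poly (g e) x) = sgn (poly (g e') (\<phi> x))" by (rule \<phi>(3))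
            then have root': "poly (g e') (\<phi> x) = 0" using root g(2) by (simp add: sgn_zero_iff)
            have m0: "0 < m"
            proof (rule ccontr)
              assume "\<not> 0 < m"
              then have "degree (g e) = 0" using polyfam_degree[OF famr[OF g(1)], of e] by simp
              then have "poly (g e) x = coeff (g e) 0" by (rule poly_degree_0)
              then show False using nzr[OF g(1)] root g \<open>\<not> 0 < m\<close> by simp
            qed
            have "(m, g) \<in> set (filter (\<lambda>p. 0 < fst p) rest)" using g(1) m0 by simp
            then have "(m - 1, R (m, g)) \<in> (\<lambda>p. (fst p - 1, R p)) ` set (filter (\<lambda>p. 0 < fst p) rest)"
              by (rule image_eqI[rotated]) simp
            then have "(m - 1, R (m, g)) \<in> set ps2" unfolding ps2_def by simp
            then have "R (m, g) \<in> snd ` set ps2" by (rule image_eqI[rotated]) simp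
            then have "sgn (poly (R (m, g) e) x) = sgn (poly (R (m, g) e') (\<phi> x))" by (rule \<phi>(3))
            \<comment> \<open>\<open>x\<close> and \<open>\<phi> x\<close> are roots of
              \<open>g e\<close> and \<open>g e'\<close>, so there the remainders are values of
              \<open>f\<close> times a power of the leading coefficient of \<open>g\<close>. These
              coefficients are nonzero of equal sign and cancel.\<close>
            then have "sgn (coeff (g e) m) ^ K (m, g) * sgn (poly (f e) x)
               = sgn (coeff (g e') m) ^ K (m, g) * sgn (poly (f e') (\<phi> x))"
              using RK[OF g(1) m0] root root' g by (simp add: sgn_mult power_sgn)
            then show ?thesis using nzr[OF g(1)] by (auto simp: sgn_zero_iff)
          qed
        qed
        then obtain \<psi> where \<psi>: "strict_mono \<psi>" "surj \<psi>"
          "\<And>a b x. (a, b) \<in> insert (f e, f e') A \<Longrightarrow> sgn (poly a x) = sgn (poly b (\<psi> x))" by blast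
        have "sgn (poly (h e) x) = sgn (poly (h e') (\<psi> x))" if h: "(k, h) \<in> set ps" for k h x
        proof (rule \<psi>(3), cases "(k, h) = (n, f)")
          case False
          have "set (remove1 (n, f) ps) \<subseteq> set rest" unfolding rest_def by auto
          then have "(k, h) \<in> set rest" using in_rem[OF h False] by blast
          then have "h \<in> snd ` set rest" by (rule image_eqI[rotated]) simp
          then show "(h e, h e') \<in> insert (f e, f e') A" unfolding A_def by blast
        qed auto
        then show ?thesis using \<psi>(1,2) fromps by (intro exI[of _ \<psi>]) blast
      qed
    qed
  qed
qed

section \<open>Semialgebraic predicates and elimination of a variable\<close>

text \<open>Being decided by the sign vector of finitely many polynomials is the same as being a
  Boolean combination of polynomial inequalities, and it is the form that the sign determination
  above delivers.\<close>

definition semialgebraic :: "((nat \<Rightarrow> real) \<Rightarrow> bool) \<Rightarrow> bool" where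
  "semialgebraic P \<longleftrightarrow> (\<exists>Q. finite Q \<and> Q \<subseteq> mpoly_fun \<and>
     (\<forall>e e'. (\<forall>q\<in>Q. sgn (q e) = sgn (q e')) \<longrightarrow> P e = P e'))"

lemma semialgebraic_less: "p \<in> mpoly_fun \<Longrightarrow> q \<in> mpoly_fun \<Longrightarrow> semialgebraic (\<lambda>e. p e < q e)"
  unfolding semialgebraic_def
proof (intro exI[of _ "{\<lambda>e. q e - p e}"] conjI allI impI)
  fix e e'
  assume "\<forall>r\<in>{\<lambda>e. q e - p e}. sgn (r e) = sgn (r e')"
  then have "sgn (q e - p e) = sgn (q e' - p e')" by simp
  then show "(p e < q e) = (p e' < q e')" by (metis diff_gt_0_iff_gt sgn_greater)
qed (auto intro: mpoly_fun_diff)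

lemma semialgebraic_not: "semialgebraic P \<Longrightarrow> semialgebraic (\<lambda>e. \<not> P e)"
  unfolding semialgebraic_def by simp

lemma semialgebraic_conj:
  assumes "semialgebraic P" "semialgebraic P'"
  shows "semialgebraic (\<lambda>e. P e \<and> P' e)"
proof -
  obtain Q where Q: "finite Q" "Q \<subseteq> mpoly_fun" "\<And>e e'. (\<forall>q\<in>Q. sgn (q e) = sgn (q e')) \<Longrightarrow> P e = P e'"
    using assms(1) unfolding semialgebraic_def by blast
  obtain Q' where Q': "finite Q'" "Q' \<subseteq> mpoly_fun" "\<And>e e'. (\<forall>q\<in>Q'. sgn (q e) = sgn (q e')) \<Longrightarrow> P' e = P' e'"
    using assms(2) unfolding semialgebraic_def by blast
  show ?thesis unfolding semialgebraic_def
    using Q Q' by (intro exI[of _ "Q \<union> Q'"]) blast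
qed

lemma semialgebraic_disj: "semialgebraic P \<Longrightarrow> semialgebraic P' \<Longrightarrow> semialgebraic (\<lambda>e. P e \<or> P' e)"
  using semialgebraic_not[OF semialgebraic_conj[OF semialgebraic_not semialgebraic_not], of P P'] by simp

lemma semialgebraic_imp: "semialgebraic P \<Longrightarrow> semialgebraic P' \<Longrightarrow> semialgebraic (\<lambda>e. P e \<longrightarrow> P' e)"
  unfolding imp_conv_disj by (intro semialgebraic_disj semialgebraic_not)

lemma semialgebraic_le: "p \<in> mpoly_fun \<Longrightarrow> q \<in> mpoly_fun \<Longrightarrow> semialgebraic (\<lambda>e. p e \<le> q e)"
  unfolding not_less[symmetric] by (intro semialgebraic_not semialgebraic_less)

lemma semialgebraic_eq: "p \<in> mpoly_fun \<Longrightarrow> q \<in> mpoly_fun \<Longrightarrow> semialgebraic (\<lambda>e. p e = q e)"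
  unfolding eq_iff by (intro semialgebraic_conj semialgebraic_le)

text \<open>The Tarski-Seidenberg theorem. If \<open>e\<close> and \<open>e'\<close> have the same
  signs on \<open>R\<close>, the bijection \<open>\<phi>\<close> matches the sign vectors along the
  two coordinate lines, so a witness \<open>x\<close> for \<open>e\<close> becomes the witness
  \<open>\<phi> x\<close> for \<open>e'\<close>.\<close>

theorem semialgebraic_ex_upd:
  assumes "semialgebraic P"
  shows "semialgebraic (\<lambda>e. \<exists>x. P (e(i := x)))"
proof -
  obtain Q where Q: "finite Q" "Q \<subseteq> mpoly_fun" "\<And>e e'. (\<forall>q\<in>Q. sgn (q e) = sgn (q e')) \<Longrightarrow> P e = P e'"
    using assms unfolding semialgebraic_def by blast
  have "\<forall>q\<in>Q. \<exists>p. polyfam (fst p) (snd p) \<and> (\<forall>e x. q (e(i := x)) = poly (snd p e) x)"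
    using polyfam_subst Q(2) by fastforce
  then obtain G where G: "\<And>q. q \<in> Q \<Longrightarrow> polyfam (fst (G q)) (snd (G q))"
    "\<And>q e x. q \<in> Q \<Longrightarrow> q (e(i := x)) = poly (snd (G q) e) x"
    by metis
  obtain ps where ps: "set ps = G ` Q" using Q(1) by (metis finite_imageI finite_list)
  have "\<exists>R. sign_determines R (snd ` set ps)"
  proof (rule ex_sign_determines)
    fix n f assume "(n, f) \<in> set ps"
    then obtain q where "q \<in> Q" "G q = (n, f)" using ps by force
    then show "polyfam n f" using G(1)[of q] by simp
  qed
  then obtain R where R: "sign_determines R (snd ` set ps)" by blast
  have "\<exists>x. P (e'(i := x))" if eq: "\<forall>q\<in>R. sgn (q e) = sgn (q e')" and P: "P (e(i := x))" for e e' x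
  proof -
    obtain \<phi> where "\<forall>f\<in>snd ` set ps. \<forall>x. sgn (poly (f e) x) = sgn (poly (f e') (\<phi> x))" using sign_determinesD(3)[OF R, of e e'] eq by blast
    then have "sgn (q (e(i := x))) = sgn (q (e'(i := \<phi> x)))" if "q \<in> Q" for q
      using that G(2)[OF that] ps by auto
    then show ?thesis using Q(3) P by metis
  qed
  then show ?thesis unfolding semialgebraic_def using sign_determinesD(1,2)[OF R] by metis
qed

lemma eventually_sgn_poly:
  fixes p :: "real poly"
  shows "\<exists>s. eventually (\<lambda>x. sgn (poly p x) = s) at_top"
    and "\<exists>s. eventually (\<lambda>x. sgn (poly p x) = s) (at_right 0)"
proof -
  show "\<exists>s. eventually (\<lambda>x. sgn (poly p x) = s) at_top"
    using poly_sgn_at_top[of p] by (cases "p = 0") (auto simp: eventually_at_top_linorder)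
  show "\<exists>s. eventually (\<lambda>x. sgn (poly p x) = s) (at_right 0)"
  proof (cases "p = 0")
    case False
    define R where "R = {x. poly p x = 0 \<and> 0 < x}"
    have fin: "finite R" unfolding R_def using poly_roots_finite[OF False] by (rule finite_subset[rotated]) auto
    define b where "b = (if R = {} then 1 else Min R)"
    have b: "0 < b" "\<And>x. 0 < x \<Longrightarrow> x < b \<Longrightarrow> poly p x \<noteq> 0"
      using fin by (auto simp: b_def R_def split: if_splits)
    have "sgn (poly p x) = sgn (poly p (b / 2))" if "0 < x" "x < b" for x
    proof (cases x "b / 2" rule: linorder_cases)
      case less then show ?thesis by (rule poly_sgn_eq_no_root) (use b that in auto)
    next
      case greater
      have "sgn (poly p (b / 2)) = sgn (poly p x)" by (rule poly_sgn_eq_no_root[OF greater]) (use b that in auto)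
      then show ?thesis by simp
    qed auto
    then show ?thesis using b(1) by (auto simp: eventually_at_right[of 0 1])
  qed auto
qed

text \<open>In one variable each of the finitely many deciding polynomials has a constant sign near
  infinity and near 0 on the right. All tameness of the line is later drawn from this
  dichotomy.\<close>

lemma semialgebraic_eventually:
  assumes P: "semialgebraic P" and F: "F = at_top \<or> F = at_right 0"
  shows "eventually (\<lambda>x. P (e(i := x))) F \<or> eventually (\<lambda>x. \<not> P (e(i := x))) F"
proof -
  obtain Q where Q: "finite Q" "Q \<subseteq> mpoly_fun" "\<And>e e'. (\<forall>q\<in>Q. sgn (q e) = sgn (q e')) \<Longrightarrow> P e = P e'"
    using P unfolding semialgebraic_def by blast
  have "\<exists>s. eventually (\<lambda>x. sgn (q (e(i := x))) = s) F" if q: "q \<in> Q" for q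
  proof -
    obtain n f where f: "\<forall>e x. q (e(i := x)) = poly (f e) x" using polyfam_subst q Q(2) by blast
    show ?thesis using eventually_sgn_poly[of "f e"] F f by (auto simp del: fun_upd_apply)
  qed
  then obtain s where s: "\<And>q. q \<in> Q \<Longrightarrow> eventually (\<lambda>x. sgn (q (e(i := x))) = s q) F" by metis
  then have ev: "eventually (\<lambda>x. \<forall>q\<in>Q. sgn (q (e(i := x))) = s q) F"
    using Q(1) by (simp add: eventually_ball_finite)
  show ?thesis
  proof (cases "\<exists>x. (\<forall>q\<in>Q. sgn (q (e(i := x))) = s q) \<and> P (e(i := x))")
    case True
    then obtain x0 where x0: "\<forall>q\<in>Q. sgn (q (e(i := x0))) = s q" "P (e(i := x0))" by blast
    have "eventually (\<lambda>x. P (e(i := x))) F"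
      using ev by eventually_elim (use Q(3) x0 in metis)
    then show ?thesis ..
  next
    case False
    have "eventually (\<lambda>x. \<not> P (e(i := x))) F"
      using ev by eventually_elim (use False in blast)
    then show ?thesis ..
  qed
qed

section \<open>The complement of two curves in a shell\<close>

text \<open>Twice the orthogonal projection to the line of \<open>w\<close>, minus the identity: in
  dimension three the rotation by 180 degrees about that line. It is an isometric involution, and
  with the axis \<open>b + b'\<close> it exchanges the unit vectors \<open>b\<close> and
  \<open>b'\<close>.\<close>

definition half_turn :: "'a::real_inner \<Rightarrow> 'a \<Rightarrow> 'a" where
  "half_turn w u = (2 * (u \<bullet> w) / (w \<bullet> w)) *\<^sub>R w - u"

lemma half_turn_half_turn: "w \<noteq> 0 \<Longrightarrow> half_turn w (half_turn w u) = u"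
  by (simp add: half_turn_def inner_diff_left algebra_simps)

lemma norm_half_turn: 
  assumes "w \<noteq> 0" shows "norm (half_turn w u) = norm u"
proof -
  have "half_turn w u \<bullet> half_turn w u = u \<bullet> u"
    using assms unfolding half_turn_def
    by (simp add: inner_diff_left inner_diff_right inner_commute field_simps power2_eq_square)
  then show ?thesis by (simp add: norm_eq_sqrt_inner)
qed

lemma half_turn_swap:
  fixes b b' :: "'a::real_inner"
  assumes "norm b = 1" "norm b' = 1" "b + b' \<noteq> 0"
  shows "half_turn (b + b') b = b'"
proof -
  have "b \<bullet> b = 1" "b' \<bullet> b' = 1" using assms by (simp_all add: dot_square_norm)
  then have "(b + b') \<bullet> (b + b') = 2 * (b \<bullet> (b + b'))"
    by (simp add: inner_add_left inner_add_right inner_commute)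
  moreover have "(b + b') \<bullet> (b + b') \<noteq> 0" using assms by simp
  ultimately have f: "2 * (b \<bullet> (b + b')) / ((b + b') \<bullet> (b + b')) = 1" by (metis divide_self)
  show ?thesis unfolding half_turn_def f by simp
qed

lemma continuous_on_half_turn [continuous_intros]:
  assumes "continuous_on S f" "continuous_on S g" "\<And>x. x \<in> S \<Longrightarrow> f x \<noteq> 0"
  shows "continuous_on S (\<lambda>x. half_turn (f x) (g x))"
  unfolding half_turn_def by (intro continuous_intros) (use assms in auto)

text \<open>With \<open>I\<close> an interval starting at 0 this is a punctured ball, with
  \<open>I\<close> a ray the outside of a ball, so that points of the line and infinity are treated
  alike.\<close>

definition shell :: "'a::real_normed_vector \<Rightarrow> real set \<Rightarrow> 'a set" where
  "shell c I = {z. norm (z - c) \<in> I}"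

text \<open>The direction \<open>v\<close> missed by both curves provides a continuous choice of rotations carrying
  \<open>b r\<close> to the fixed pole \<open>- v\<close>, namely half-turns about \<open>b r - v\<close>.\<close>
definition two_curves :: "'a::real_normed_vector set \<Rightarrow> 'a \<Rightarrow> real set \<Rightarrow> (real \<Rightarrow> 'a) \<Rightarrow> (real \<Rightarrow> 'a) \<Rightarrow> 'a \<Rightarrow> bool" where
  "two_curves L c I a b v \<longleftrightarrow> continuous_on I a \<and> continuous_on I b \<and> norm v = 1 \<and>
     (\<forall>r\<in>I. 0 < r \<and> norm (a r) = 1 \<and> norm (b r) = 1 \<and> a r \<noteq> b r \<and> a r \<noteq> v \<and> b r \<noteq> v) \<and>
     L \<inter> shell c I = (\<lambda>r. c + r *\<^sub>R a r) ` I \<union> (\<lambda>r. c + r *\<^sub>R b r) ` I"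

lemma two_curves_swap: "two_curves L c I a b v \<Longrightarrow> two_curves L c I b a v"
  unfolding two_curves_def by (auto simp: Un_commute)

lemma two_curves_subset:
  assumes "two_curves L c I a b v" "J \<subseteq> I"
  shows "two_curves L c J a b v"
proof -
  have "L \<inter> shell c J = (L \<inter> shell c I) \<inter> shell c J" using assms(2) by (auto simp: shell_def)
  also have "\<dots> = (\<lambda>r. c + r *\<^sub>R a r) ` J \<union> (\<lambda>r. c + r *\<^sub>R b r) ` J"
  proof -
    have mem: "c + r *\<^sub>R a r \<in> shell c J \<longleftrightarrow> r \<in> J" "c + r *\<^sub>R b r \<in> shell c J \<longleftrightarrow> r \<in> J" if "r \<in> I" for r
      using assms(1) that unfolding two_curves_def by (auto simp: shell_def)
    have "L \<inter> shell c I = (\<lambda>r. c + r *\<^sub>R a r) ` I \<union> (\<lambda>r. c + r *\<^sub>R b r) ` I"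
      using assms(1) unfolding two_curves_def by blast
    then show ?thesis using mem assms(2) by (auto simp: subset_iff)
  qed
  finally show ?thesis using assms unfolding two_curves_def by (auto intro: continuous_on_subset)
qed

text \<open>On the sphere of radius \<open>r\<close> a half turn moves the direction
  \<open>b r\<close> to a fixed pole, stereographic projection from that pole maps the rest to the
  hyperplane \<open>P\<close>, and a translation moves the image of \<open>a r\<close> to 0. All
  three depend continuously on \<open>r\<close>. The second curve goes to infinity and the first
  becomes the axis.\<close>

lemma two_curves_chart:
  fixes c :: "'a::euclidean_space"
  assumes tc: "two_curves L c I a b v" and dim: "3 \<le> DIM('a)"
  obtains P :: "'a set" and \<Phi> \<Psi> where "subspace P" "connected (P - {0})" "P - {0} \<noteq> {}" "continuous_on (I \<times> P) \<Phi>"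
    "\<And>r. r \<in> I \<Longrightarrow> \<Phi> (r, 0) = c + r *\<^sub>R a r"
    "homeomorphism (I \<times> (P - {0})) (shell c I - L) \<Phi> \<Psi>"
proof -
  have a: "continuous_on I a" "\<And>r. r \<in> I \<Longrightarrow> norm (a r) = 1"
    and b: "continuous_on I b" "\<And>r. r \<in> I \<Longrightarrow> norm (b r) = 1"
    and v: "norm v = 1" "\<And>r. r \<in> I \<Longrightarrow> b r \<noteq> v"
    and ab: "\<And>r. r \<in> I \<Longrightarrow> a r \<noteq> b r" and pos: "\<And>r. r \<in> I \<Longrightarrow> 0 < r"
    and L: "L \<inter> shell c I = (\<lambda>r. c + r *\<^sub>R a r) ` I \<union> (\<lambda>r. c + r *\<^sub>R b r) ` I"
    using tc unfolding two_curves_def by auto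
  define b0 where "b0 = - v"
  define w where "w r = b r + b0" for r
  have nb0: "norm b0 = 1" "b0 \<noteq> 0" using v by (auto simp: b0_def)
  have w: "w r \<noteq> 0" if "r \<in> I" for r using v(2)[OF that] by (simp add: w_def b0_def)
  have wc: "continuous_on I w" unfolding w_def by (intro continuous_intros b)
  define P where "P = {x. b0 \<bullet> x = 0}"
  have subP: "subspace P" unfolding P_def by (rule subspace_hyperplane)
  have affP: "aff_dim P = DIM('a) - 1" unfolding P_def using nb0 by simp
  have conP: "connected (P - {0})"
    by (rule connected_punctured_convex) (use affP dim subP in \<open>auto simp: subspace_imp_convex\<close>)
  have neP: "P - {0} \<noteq> {}"
  proof
    assume "P - {0} = {}"
    then have "P \<subseteq> {0}" by auto
    then have "aff_dim P \<le> aff_dim {0::'a}" by (rule aff_dim_subset)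
    then show False using affP dim by simp
  qed
  have "(sphere 0 1 - {b0}) homeomorphic P" unfolding P_def
    by (rule homeomorphic_punctured_sphere_hyperplane) (use nb0 in auto)
  then obtain \<sigma> \<tau> where st: "homeomorphism (sphere 0 1 - {b0}) P \<sigma> \<tau>" unfolding homeomorphic_def by blast
  then have \<sigma>c: "continuous_on (sphere 0 1 - {b0}) \<sigma>" and \<tau>c: "continuous_on P \<tau>"
    and im: "\<sigma> ` (sphere 0 1 - {b0}) = P" "\<tau> ` P = sphere 0 1 - {b0}"
    and inv: "\<And>u. u \<in> sphere 0 1 - {b0} \<Longrightarrow> \<tau> (\<sigma> u) = u" and \<sigma>\<tau>: "\<And>x. x \<in> P \<Longrightarrow> \<sigma> (\<tau> x) = x"
    unfolding homeomorphism_def by blast+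
  have \<sigma>im: "\<sigma> u \<in> P" and \<tau>\<sigma>: "\<tau> (\<sigma> u) = u" if "norm u = 1" "u \<noteq> b0" for u
  proof -
    have "u \<in> sphere 0 1 - {b0}" using that by simp
    then show "\<sigma> u \<in> P" "\<tau> (\<sigma> u) = u" using im(1) inv by blast+
  qed
  have \<tau>im: "norm (\<tau> x) = 1" "\<tau> x \<noteq> b0" if "x \<in> P" for x
  proof -
    have "\<tau> x \<in> sphere 0 1 - {b0}" using im(2) that by blast
    then show "norm (\<tau> x) = 1" "\<tau> x \<noteq> b0" by simp_all
  qed
  define T where "T r = half_turn (w r)" for r
  have TT: "T r (T r u) = u" and nT: "norm (T r u) = norm u" if "r \<in> I" for r u
    using that w by (simp_all add: T_def half_turn_half_turn norm_half_turn)
  have Tb: "T r (b r) = b0" if "r \<in> I" for r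
    using half_turn_swap[of "b r" b0] b(2) nb0 w that by (simp add: T_def w_def)
  have Tne: "T r u \<noteq> b0" if "r \<in> I" "u \<noteq> b r" for r u
    using TT that Tb by metis
  define A where "A r = \<sigma> (T r (a r))" for r
  have AP: "A r \<in> P" if "r \<in> I" for r
    unfolding A_def by (rule \<sigma>im) (use that nT a Tne ab in auto)
  have \<tau>A: "\<tau> (A r) = T r (a r)" if "r \<in> I" for r
    unfolding A_def by (rule \<tau>\<sigma>) (use that nT a Tne ab in auto)
  have Tac: "continuous_on I (\<lambda>r. T r (a r))"
    unfolding T_def by (intro continuous_intros wc a w)
  have Ta: "T r (a r) \<in> sphere 0 1 - {b0}" if "r \<in> I" for r
    using nT[OF that, of "a r"] a(2)[OF that] Tne[OF that ab[OF that]] by simp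
  have Ac: "continuous_on I A" unfolding A_def
    by (rule continuous_on_compose2[OF \<sigma>c Tac]) (use Ta in blast)
  define \<Phi> where "\<Phi> = (\<lambda>(r, x). c + r *\<^sub>R T r (\<tau> (x + A r)))"
  define \<Psi> where "\<Psi> z = (norm (z - c), \<sigma> (T (norm (z - c)) ((z - c) /\<^sub>R norm (z - c))) - A (norm (z - c)))" for z
  have plusP: "x + A r \<in> P" if "x \<in> P" "r \<in> I" for x r using that AP subP by (simp add: subspace_add)
  have \<Phi>c: "continuous_on (I \<times> P) \<Phi>"
  proof -
    have 1: "continuous_on (I \<times> P) (\<lambda>z. w (fst z))" by (rule continuous_on_compose2[OF wc]) (auto intro: continuous_intros)
    have 2: "continuous_on (I \<times> P) (\<lambda>z. \<tau> (snd z + A (fst z)))"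
      by (rule continuous_on_compose2[OF \<tau>c])
        (auto intro!: continuous_intros continuous_on_compose2[OF Ac] plusP)
    show ?thesis unfolding \<Phi>_def T_def case_prod_beta
      by (intro continuous_intros 1 2) (use w in auto)
  qed
  have \<Phi>0: "\<Phi> (r, 0) = c + r *\<^sub>R a r" if "r \<in> I" for r
    using that by (simp add: \<Phi>_def \<tau>A TT)
  have notL: "z \<in> shell c I - L \<longleftrightarrow> r \<in> I \<and> (z - c) /\<^sub>R r \<noteq> a r \<and> (z - c) /\<^sub>R r \<noteq> b r"
    if "r = norm (z - c)" for z r
  proof (cases "r \<in> I")
    case True
    have iff: "z = c + s *\<^sub>R d s \<and> s \<in> I \<longleftrightarrow> s = r \<and> (z - c) /\<^sub>R r = d r" if d: "\<And>r. r \<in> I \<Longrightarrow> norm (d r) = 1" for d s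
    proof
      assume s: "z = c + s *\<^sub>R d s \<and> s \<in> I"
      then have "r = s" using pos[of s] d[of s] \<open>r = norm (z - c)\<close> by simp
      then show "s = r \<and> (z - c) /\<^sub>R r = d r" using s pos[of s] by simp
    next
      assume s: "s = r \<and> (z - c) /\<^sub>R r = d r"
      then have "s *\<^sub>R d s = z - c" using pos[OF True] by (metis divideR_right less_irrefl)
      then show "z = c + s *\<^sub>R d s \<and> s \<in> I" using s True by simp
    qed
    have ex_a: "(\<exists>s. z = c + s *\<^sub>R a s \<and> s \<in> I) \<longleftrightarrow> (z - c) /\<^sub>R r = a r"
      by (simp only: iff[of a, OF a(2)] simp_thms ex_simps)
    have ex_b: "(\<exists>s. z = c + s *\<^sub>R b s \<and> s \<in> I) \<longleftrightarrow> (z - c) /\<^sub>R r = b r"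
      by (simp only: iff[of b, OF b(2)] simp_thms ex_simps)
    have "z \<in> L \<longleftrightarrow> z \<in> L \<inter> shell c I" using True that by (simp add: shell_def)
    also have "\<dots> \<longleftrightarrow> (\<exists>s. z = c + s *\<^sub>R a s \<and> s \<in> I) \<or> (\<exists>s. z = c + s *\<^sub>R b s \<and> s \<in> I)" unfolding L by auto
    also have "\<dots> \<longleftrightarrow> (z - c) /\<^sub>R r = a r \<or> (z - c) /\<^sub>R r = b r" by (simp only: ex_a ex_b)
    finally show ?thesis using True that by (auto simp: shell_def)
  qed (auto simp: shell_def that)
  have unit: "norm ((z - c) /\<^sub>R norm (z - c)) = 1" if "norm (z - c) \<in> I" for z
    using pos[OF that] by simp
  have "homeomorphism (I \<times> (P - {0})) (shell c I - L) \<Phi> \<Psi>"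
  proof (rule homeomorphismI)
    show "continuous_on (I \<times> (P - {0})) \<Phi>" by (rule continuous_on_subset[OF \<Phi>c]) auto
    have nc: "continuous_on (shell c I - L) (\<lambda>z. norm (z - c))" by (intro continuous_intros)
    have 1: "continuous_on (shell c I - L) (\<lambda>z. T (norm (z - c)) ((z - c) /\<^sub>R norm (z - c)))"
      unfolding T_def
      by (intro continuous_intros continuous_on_compose2[OF wc nc])
        (use pos w in \<open>fastforce simp: shell_def\<close>)+
    have 2: "continuous_on (shell c I - L) (\<lambda>z. \<sigma> (T (norm (z - c)) ((z - c) /\<^sub>R norm (z - c))))"
    proof (rule continuous_on_compose2[OF \<sigma>c 1])
      show "(\<lambda>z. T (norm (z - c)) ((z - c) /\<^sub>R norm (z - c))) ` (shell c I - L) \<subseteq> sphere 0 1 - {b0}"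
      proof (clarify, intro DiffI)
        fix z assume z: "z \<in> shell c I" "z \<notin> L"
        then have r: "norm (z - c) \<in> I" by (simp add: shell_def)
        show "T (norm (z - c)) ((z - c) /\<^sub>R norm (z - c)) \<in> sphere 0 1" using nT[OF r] unit[OF r] by simp
        show "T (norm (z - c)) ((z - c) /\<^sub>R norm (z - c)) \<notin> {b0}"
          using Tne[OF r] notL[OF refl, of z] z by simp
      qed
    qed
    show "continuous_on (shell c I - L) \<Psi>" unfolding \<Psi>_def
      by (intro continuous_intros 2 nc continuous_on_compose2[OF Ac nc]) (auto simp: shell_def)
    have key: "norm (\<Phi> (r, x) - c) = r" "(\<Phi> (r, x) - c) /\<^sub>R r = T r (\<tau> (x + A r))" if "r \<in> I" "x \<in> P" for r x
      using that pos[OF that(1)] nT \<tau>im(1)[OF plusP] by (simp_all add: \<Phi>_def)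
    show "\<Phi> ` (I \<times> (P - {0})) \<subseteq> shell c I - L"
    proof (rule image_subsetI)
      fix p assume "p \<in> I \<times> (P - {0})"
      then obtain r x where p: "p = (r, x)" and r: "r \<in> I" and x: "x \<in> P" "x \<noteq> 0" by auto
      have "T r (\<tau> (x + A r)) \<noteq> a r"
      proof
        assume "T r (\<tau> (x + A r)) = a r"
        then have "\<tau> (x + A r) = \<tau> (A r)" using TT[OF r] \<tau>A[OF r] by metis
        then have "x + A r = A r" using \<sigma>\<tau> plusP[OF x(1) r] AP[OF r] by metis
        then show False using x by simp
      qed
      moreover have "T r (\<tau> (x + A r)) \<noteq> b r"
        using Tb[OF r] TT[OF r] \<tau>im(2)[OF plusP[OF x(1) r]] by metis
      ultimately show "\<Phi> p \<in> shell c I - L"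
        unfolding p using notL[OF refl, of "\<Phi> (r, x)"] key[OF r x(1)] r by simp
    qed
    show "\<Psi> ` (shell c I - L) \<subseteq> I \<times> (P - {0})"
    proof (rule image_subsetI)
      fix z assume z: "z \<in> shell c I - L"
      define r u where "r = norm (z - c)" and "u = (z - c) /\<^sub>R r"
      have r: "r \<in> I" and u: "norm u = 1" "u \<noteq> a r" "u \<noteq> b r"
        using z notL[OF r_def] unit by (auto simp: r_def u_def shell_def)
      have "\<sigma> (T r u) \<in> P" by (rule \<sigma>im) (use r u nT Tne in auto)
      then have "\<sigma> (T r u) - A r \<in> P" using AP[OF r] subP by (simp add: subspace_diff)
      moreover have "\<sigma> (T r u) \<noteq> A r"
      proof
        assume "\<sigma> (T r u) = A r"
        then have "T r u = T r (a r)" using \<tau>\<sigma>[of "T r u"] \<tau>A[OF r] nT[OF r] u Tne[OF r] by metis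
        then show False using TT[OF r] u by metis
      qed
      ultimately show "\<Psi> z \<in> I \<times> (P - {0})" using r by (simp add: \<Psi>_def r_def[symmetric] u_def[symmetric])
    qed
    show "\<Psi> (\<Phi> p) = p" if p: "p \<in> I \<times> (P - {0})" for p
    proof -
      obtain r x where rx: "p = (r, x)" "r \<in> I" "x \<in> P" using p by auto
      show ?thesis unfolding rx(1) \<Psi>_def key[OF rx(2,3)] TT[OF rx(2)] using \<sigma>\<tau>[OF plusP[OF rx(3,2)]] by simp
    qed
    show "\<Phi> (\<Psi> z) = z" if z: "z \<in> shell c I - L" for z
    proof -
      define r u where "r = norm (z - c)" and "u = (z - c) /\<^sub>R r"
      have r: "r \<in> I" and u: "norm u = 1" "u \<noteq> a r" "u \<noteq> b r"
        using z notL[OF r_def] unit by (auto simp: r_def u_def shell_def)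
      have "\<tau> (\<sigma> (T r u)) = T r u" by (rule \<tau>\<sigma>) (use r u nT Tne in auto)
      then have "\<Phi> (\<Psi> z) = c + r *\<^sub>R u"
        by (simp add: \<Phi>_def \<Psi>_def r_def[symmetric] u_def[symmetric] TT[OF r])
      also have "\<dots> = z" using pos[OF r] by (simp add: u_def)
      finally show ?thesis .
    qed
  qed
  with subP conP neP \<Phi>c \<Phi>0 show ?thesis by (rule that)
qed

lemma two_curves_shell_connected:
  fixes c :: "'a::euclidean_space"
  assumes "two_curves L c I a b v" "3 \<le> DIM('a)" "connected I"
  shows "connected (shell c I - L)" "I \<noteq> {} \<Longrightarrow> shell c I - L \<noteq> {}"
proof -
  obtain P :: "'a set" and \<Phi> \<Psi> where P: "connected (P - {0})" "P - {0} \<noteq> {}"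
    and h: "homeomorphism (I \<times> (P - {0})) (shell c I - L) \<Phi> \<Psi>"
    using two_curves_chart[OF assms(1,2)] by metis
  have "connected (I \<times> (P - {0}))" using P assms(3) by (intro connected_Times)
  then have "connected (\<Phi> ` (I \<times> (P - {0})))"
    using h by (intro connected_continuous_image) (auto simp: homeomorphism_def)
  then show "connected (shell c I - L)" using h by (simp add: homeomorphism_def)
  show "shell c I - L \<noteq> {}" if "I \<noteq> {}" using that P h unfolding homeomorphism_def by auto
qed

lemma covering_section_unique:
  fixes s t :: "'b::real_normed_vector \<Rightarrow> 'a::real_normed_vector"
  assumes "covering_space X F U" "connected O'" "O' \<subseteq> U"
    "continuous_on O' s" "s \<in> O' \<rightarrow> X" "\<And>y. y \<in> O' \<Longrightarrow> F (s y) = y"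
    "continuous_on O' t" "t \<in> O' \<rightarrow> X" "\<And>y. y \<in> O' \<Longrightarrow> F (t y) = y"
    "p \<in> O'" "s p = t p" "q \<in> O'"
  shows "s q = t q"
  by (rule covering_space_lift_unique[where f = "\<lambda>y. y" and T = O' and a = p and p = F and S = U and c = X])
    (use assms in auto)

text \<open>In the chart the shell minus the two curves is an interval times a punctured hyperplane, which
  contracts into any neighbourhood of a point of the curve; homotopy lifting then extends the section.\<close>
lemma two_curves_section_extend:
  fixes c :: "'a::euclidean_space" and F :: "'a \<Rightarrow> 'a"
  assumes tc: "two_curves L c I a b v" and dim: "3 \<le> DIM('a)" and I: "open I" "connected I"
    and cov: "covering_space X F U" and sub: "shell c I - L \<subseteq> U"
    and z0: "z0 \<in> L" "z0 \<in> shell c I" and N: "open N" "z0 \<in> N" 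
    and s: "continuous_on (N - L) s" "s \<in> (N - L) \<rightarrow> X" "\<And>y. y \<in> N - L \<Longrightarrow> F (s y) = y"
  obtains \<sigma> y where "continuous_on (shell c I - L) \<sigma>" "\<sigma> \<in> (shell c I - L) \<rightarrow> X"
    "\<And>y. y \<in> shell c I - L \<Longrightarrow> F (\<sigma> y) = y" "y \<in> N - L" "y \<in> shell c I" "\<sigma> y = s y"
proof -
  have "z0 \<in> (\<lambda>r. c + r *\<^sub>R a r) ` I \<union> (\<lambda>r. c + r *\<^sub>R b r) ` I"
    using tc z0 unfolding two_curves_def by blast
  \<comment> \<open>The two curves play symmetric roles; \<open>a'\<close> is the one through
    \<open>z0\<close>, so that the chart puts \<open>z0\<close> at \<open>(r0, 0)\<close>.\<close>
  then obtain a' b' r0 where tc': "two_curves L c I a' b' v" and r0: "r0 \<in> I" "z0 = c + r0 *\<^sub>R a' r0"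
    using tc two_curves_swap[OF tc] by blast
  obtain P :: "'a set" and \<Phi> \<Psi> where P: "subspace P" "connected (P - {0})" "P - {0} \<noteq> {}"
    and \<Phi>: "continuous_on (I \<times> P) \<Phi>" "\<And>r. r \<in> I \<Longrightarrow> \<Phi> (r, 0) = c + r *\<^sub>R a' r"
    and h: "homeomorphism (I \<times> (P - {0})) (shell c I - L) \<Phi> \<Psi>"
    using two_curves_chart[OF tc' dim] by metis
  define Q where "Q = I \<times> (P - {0})"
  have \<Phi>Q: "\<Phi> q \<in> shell c I - L" if "q \<in> Q" for q using h that unfolding homeomorphism_def Q_def by blast
  have convI: "convex I" using I(2) is_interval_connected_1 is_interval_convex_1 by blast
  have "openin (top_of_set (I \<times> P)) (I \<times> P \<inter> \<Phi> -` N)"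
    using \<Phi>(1) N(1) by (rule continuous_openin_preimage_gen)
  moreover have p0: "(r0, 0) \<in> I \<times> P \<inter> \<Phi> -` N" using r0 \<Phi>(2) N P subspace_0 by auto
  ultimately obtain e where e: "0 < e" "\<And>q. q \<in> I \<times> P \<Longrightarrow> dist q (r0, 0) < e \<Longrightarrow> \<Phi> q \<in> N"
    unfolding openin_euclidean_subtopology_iff by (metis IntE vimageE)
  define d where "d = min 1 (e / 2)"
  have d: "0 < d" "d \<le> 1" "2 * d \<le> e" using e by (auto simp: d_def)
  have small: "\<Phi> (r, x) \<in> N" if "r \<in> I" "x \<in> P" "\<bar>r - r0\<bar> < d" "norm x < d" for r x
  proof (rule e(2))
    have "dist (r, x) (r0, 0) \<le> dist r r0 + dist x 0"
      by (simp add: dist_Pair_Pair sqrt_sum_squares_le_sum)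
    also have "\<dots> < e" using that d by (simp add: dist_real_def)
    finally show "dist (r, x) (r0, 0) < e" .
  qed (use that in auto)
  \<comment> \<open>A scaling factor that is 1 at \<open>t = 1\<close> and
    \<open>d / (1 + n)\<close> at \<open>t = 0\<close>, where it brings every length
    \<open>n\<close> below \<open>d\<close>. It stays positive, so nothing is moved into the removed
    axis.\<close>
  define \<alpha> where "\<alpha> t n = t + (1 - t) * (d / (1 + n))" for t n :: real
  have \<alpha>: "0 < \<alpha> t n" "\<alpha> t n \<le> 1" if "0 \<le> t" "t \<le> 1" "0 \<le> n" for t n
  proof -
    have q: "0 < d / (1 + n)" "d / (1 + n) \<le> 1" using d that by (auto simp: field_simps)
    show "0 < \<alpha> t n"
    proof (cases "t = 0")
      case False
      then have "0 < t" "0 \<le> (1 - t) * (d / (1 + n))" using that q by (simp, intro mult_nonneg_nonneg) auto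
      then show ?thesis unfolding \<alpha>_def by (rule add_pos_nonneg)
    qed (use q in \<open>simp add: \<alpha>_def\<close>)
    have "(1 - t) * (d / (1 + n)) \<le> (1 - t) * 1" using that q by (intro mult_left_mono) auto
    then show "\<alpha> t n \<le> 1" by (simp add: \<alpha>_def)
  qed
  \<comment> \<open>The contraction of the interval towards \<open>r0\<close> and of the punctured
    hyperplane towards 0, run backwards: at time 0 everything lies in the small box that is mapped
    into \<open>N\<close>.\<close>
  define H where "H z = (r0 + \<alpha> (fst z) \<bar>fst (snd z) - r0\<bar> * (fst (snd z) - r0),
      \<alpha> (fst z) (norm (snd (snd z))) *\<^sub>R snd (snd z))" for z :: "real \<times> real \<times> 'a"
  have HQ: "H (t, q) \<in> Q" if "t \<in> {0..1}" "q \<in> Q" for t q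
  proof -
    obtain r x where q: "q = (r, x)" "r \<in> I" "x \<in> P" "x \<noteq> 0" using \<open>q \<in> Q\<close> by (auto simp: Q_def)
    let ?\<alpha> = "\<alpha> t \<bar>r - r0\<bar>"
    have "(1 - ?\<alpha>) *\<^sub>R r0 + ?\<alpha> *\<^sub>R r \<in> I"
      using convexD_alt[OF convI r0(1) q(2), of ?\<alpha>] \<alpha>[of t "\<bar>r - r0\<bar>"] that by auto
    then have "r0 + ?\<alpha> * (r - r0) \<in> I" by (simp add: algebra_simps)
    moreover have "\<alpha> t (norm x) *\<^sub>R x \<in> P - {0}"
      using q P(1) \<alpha>(1)[of t "norm x"] that by (auto simp: subspace_scale)
    ultimately show ?thesis by (simp add: H_def q(1) Q_def)
  qed
  have H1: "H (1, q) = q" for q by (simp add: H_def \<alpha>_def)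
  have Hc: "continuous_on ({0..1} \<times> Q) H"
    unfolding H_def \<alpha>_def by (intro continuous_intros) (auto simp: add_nonneg_eq_0_iff intro: add_pos_nonneg less_imp_neq[symmetric])
  have scale: "\<alpha> 0 n * n < d" if "0 \<le> n" for n
    using d that by (simp add: \<alpha>_def field_simps)
  have scale': "\<alpha> t n * n \<le> n" if "0 \<le> n" "t \<in> {0..1}" for t n
    using \<alpha>[of t n] that by (simp add: mult_left_le_one_le)
  have Hd: "\<bar>fst (H z) - r0\<bar> = \<alpha> (fst z) \<bar>fst (snd z) - r0\<bar> * \<bar>fst (snd z) - r0\<bar>"
    "norm (snd (H z)) = \<alpha> (fst z) (norm (snd (snd z))) * norm (snd (snd z))" if "fst z \<in> {0..1}" for z
    using that \<alpha>(1)[of "fst z" "\<bar>fst (snd z) - r0\<bar>"] \<alpha>(1)[of "fst z" "norm (snd (snd z))"]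
    by (simp_all add: H_def abs_mult)
  have inN: "\<Phi> (H (t, q)) \<in> N - L" if "t \<in> {0..1}" "q \<in> Q" "t = 0 \<or> \<bar>fst q - r0\<bar> < d \<and> norm (snd q) < d" for t q
  proof -
    obtain r x where rx: "H (t, q) = (r, x)" by fastforce
    have rQ: "(r, x) \<in> Q" using HQ[OF that(1,2)] rx by simp
    have "\<alpha> t n * n < d" if "0 \<le> n" "t = 0 \<or> n < d" for n
      using scale[OF that(1)] scale'[OF that(1) \<open>t \<in> {0..1}\<close>] that(2) by auto
    then have "\<bar>r - r0\<bar> < d" "norm x < d"
      using Hd[of "(t, q)"] that rx by auto
    then have "\<Phi> (r, x) \<in> N" using small rQ by (auto simp: Q_def)
    then show ?thesis using \<Phi>Q[OF rQ] rx by simp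
  qed
  have \<Phi>c: "continuous_on Q \<Phi>" using h unfolding homeomorphism_def Q_def by blast
  have inU: "\<Phi> (H (t, q)) \<in> U" if "t \<in> {0..1}" "q \<in> Q" for t q
    using \<Phi>Q[OF HQ[OF that]] sub by blast
  have c0: "continuous_on Q (\<lambda>q. H (0, q))"
    by (rule continuous_on_compose2[OF Hc]) (auto intro!: continuous_intros)
  have "continuous_on Q (\<lambda>q. s (\<Phi> (H (0, q))))"
    by (rule continuous_on_compose2[OF s(1)], rule continuous_on_compose2[OF \<Phi>c c0]) (use HQ inN in auto)
  moreover have "(\<lambda>q. s (\<Phi> (H (0, q)))) \<in> Q \<rightarrow> X" using s(2) inN[of 0] by auto
  moreover have c1: "continuous_on ({0..1} \<times> Q) (\<lambda>z. \<Phi> (H z))"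
    by (rule continuous_on_compose2[OF \<Phi>c Hc]) (use HQ in auto)
  moreover have c2: "(\<lambda>z. \<Phi> (H z)) \<in> {0..1} \<times> Q \<rightarrow> U" using inU by auto
  ultimately obtain k where k: "continuous_on ({0..1} \<times> Q) k" "k \<in> ({0..1} \<times> Q) \<rightarrow> X"
    "\<And>q. q \<in> Q \<Longrightarrow> k (0, q) = s (\<Phi> (H (0, q)))" "\<And>z. z \<in> {0..1} \<times> Q \<Longrightarrow> \<Phi> (H z) = F (k z)"
    using covering_space_lift_homotopy[OF cov, of Q "\<lambda>z. \<Phi> (H z)" "\<lambda>q. s (\<Phi> (H (0, q)))"] s(3) inN[of 0]
    by auto
  have kX: "k (t, q) \<in> X" if "t \<in> {0..1}" "q \<in> Q" for t q using k(2) that by auto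
  define \<sigma> where "\<sigma> z = k (1, \<Psi> z)" for z
  have \<Psi>: "continuous_on (shell c I - L) \<Psi>" "\<And>z. z \<in> shell c I - L \<Longrightarrow> \<Psi> z \<in> Q"
    "\<And>z. z \<in> shell c I - L \<Longrightarrow> \<Phi> (\<Psi> z) = z" "\<And>q. q \<in> Q \<Longrightarrow> \<Psi> (\<Phi> q) = q"
    using h unfolding homeomorphism_def Q_def by blast+
  obtain x1 where x1: "x1 \<in> P" "x1 \<noteq> 0" using P(3) by blast
  define x where "x = (d / (2 * norm x1)) *\<^sub>R x1"
  have x: "x \<in> P" "x \<noteq> 0" "norm x < d" using x1 P(1) d by (auto simp: x_def subspace_scale)
  have qQ: "(r0, x) \<in> Q" using r0 x by (simp add: Q_def)
  \<comment> \<open>The track of a point of the small box never leaves the box, so along it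
    \<open>s\<close> provides a second lift, which agrees with \<open>k\<close> at time 0.\<close>
  have "k (1, r0, x) = s (\<Phi> (H (1, r0, x)))"
  proof (rule covering_space_lift_unique[OF cov, where T = "{0..1}" and f = "\<lambda>t. \<Phi> (H (t, r0, x))"
        and ?g1.0 = "\<lambda>t. k (t, r0, x)" and ?g2.0 = "\<lambda>t. s (\<Phi> (H (t, r0, x)))" and a = 0])
    show "k (0, r0, x) = s (\<Phi> (H (0, r0, x)))" by (rule k(3)[OF qQ])
    show c3: "continuous_on {0..1} (\<lambda>t. \<Phi> (H (t, r0, x)))"
      by (rule continuous_on_compose2[OF c1]) (use qQ in \<open>auto intro!: continuous_intros\<close>)
    show "(\<lambda>t. \<Phi> (H (t, r0, x))) \<in> {0..1} \<rightarrow> U" using inU qQ by auto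
    show "continuous_on {0..1} (\<lambda>t. k (t, r0, x))"
      by (rule continuous_on_compose2[OF k(1)]) (use qQ in \<open>auto intro!: continuous_intros\<close>)
    show "(\<lambda>t. k (t, r0, x)) \<in> {0..1} \<rightarrow> X" using kX qQ by auto
    show "continuous_on {0..1} (\<lambda>t. s (\<Phi> (H (t, r0, x))))"
      by (rule continuous_on_compose2[OF s(1) c3]) (use inN qQ x d in auto)
    show "(\<lambda>t. s (\<Phi> (H (t, r0, x)))) \<in> {0..1} \<rightarrow> X" using s(2) inN[OF _ qQ] x d by auto
    show "\<Phi> (H (t, r0, x)) = F (k (t, r0, x))" if "t \<in> {0..1}" for t using k(4) that qQ by blast
    show "\<Phi> (H (t, r0, x)) = F (s (\<Phi> (H (t, r0, x))))" if "t \<in> {0..1}" for t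
      using s(3)[OF inN[OF that qQ]] x d by simp
  qed auto
  then have "\<sigma> (\<Phi> (r0, x)) = s (\<Phi> (r0, x))" using \<Psi>(4)[OF qQ] H1 by (simp add: \<sigma>_def)
  moreover have "\<Phi> (r0, x) \<in> N - L" using inN[of 1 "(r0, x)"] qQ x d H1 by simp
  moreover have "continuous_on (shell c I - L) \<sigma>" unfolding \<sigma>_def
    by (rule continuous_on_compose2[OF k(1)]) (use \<Psi> in \<open>auto intro!: continuous_intros\<close>)
  moreover have "\<sigma> \<in> (shell c I - L) \<rightarrow> X" using kX \<Psi>(2) by (auto simp: \<sigma>_def)
  moreover have "F (\<sigma> y) = y" if "y \<in> shell c I - L" for y
    using k(4)[of "(1, \<Psi> y)"] \<Psi>(2,3)[OF that] H1 by (simp add: \<sigma>_def)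
  ultimately show ?thesis using that \<Phi>Q[OF qQ] by blast
qed

section \<open>The covering outside the line\<close>

lemma nonseparating_dense:
  fixes C :: "'a::metric_space set"
  assumes loc: "\<And>x \<epsilon>. 0 < \<epsilon> \<Longrightarrow> \<exists>N. open N \<and> x \<in> N \<and> N \<subseteq> ball x \<epsilon> \<and> connected (N - C) \<and> N - C \<noteq> {}"
    and W: "open W" "W \<noteq> {}"
  shows "W - C \<noteq> {}"
proof -
  obtain x where "x \<in> W" using W(2) by blast
  then obtain \<epsilon> where "0 < \<epsilon>" "ball x \<epsilon> \<subseteq> W" using W(1) by (meson open_contains_ball)
  with loc[of \<epsilon> x] show ?thesis by blast
qed

text \<open>A splitting of \<open>S - C\<close> would extend to one of \<open>S\<close>: each small
  neighbourhood minus \<open>C\<close> is connected and hence lies on one side. The two extended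
  sides cannot overlap, since an open overlap would contain points outside \<open>C\<close>.\<close>

lemma nonseparating_connected:
  fixes C :: "'a::metric_space set"
  assumes loc: "\<And>x \<epsilon>. 0 < \<epsilon> \<Longrightarrow> \<exists>N. open N \<and> x \<in> N \<and> N \<subseteq> ball x \<epsilon> \<and> connected (N - C) \<and> N - C \<noteq> {}"
    and S: "open S" "connected S"
  shows "connected (S - C)"
proof (rule ccontr)
  assume "\<not> connected (S - C)"
  then obtain A B where AB: "open A" "open B" "S - C \<subseteq> A \<union> B" "A \<inter> B \<inter> (S - C) = {}"
    "A \<inter> (S - C) \<noteq> {}" "B \<inter> (S - C) \<noteq> {}" unfolding connected_def by blast
  define A' where "A' = \<Union>{N. open N \<and> N \<subseteq> S \<and> N - C \<subseteq> A}"
  define B' where "B' = \<Union>{N. open N \<and> N \<subseteq> S \<and> N - C \<subseteq> B}"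
  have op: "open A'" "open B'" by (auto simp: A'_def B'_def)
  have cover: "(x \<in> A' \<and> (x \<notin> C \<longrightarrow> x \<in> A)) \<or> (x \<in> B' \<and> (x \<notin> C \<longrightarrow> x \<in> B))" if x: "x \<in> S" for x
  proof -
    obtain \<epsilon> where "0 < \<epsilon>" "ball x \<epsilon> \<subseteq> S" using x S(1) by (meson open_contains_ball)
    then obtain N where N: "open N" "x \<in> N" "N \<subseteq> S" "connected (N - C)" using loc[of \<epsilon> x] by blast
    have "A \<inter> (N - C) = {} \<or> B \<inter> (N - C) = {}"
      by (rule connectedD[OF N(4) AB(1,2)]) (use AB(3,4) N(3) in blast)+
    then have "N - C \<subseteq> A \<or> N - C \<subseteq> B" using AB(3) N(3) by blast
    then show ?thesis using N by (auto simp: A'_def B'_def)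
  qed
  have "A' \<inter> B' = {}"
  proof (rule ccontr)
    assume "A' \<inter> B' \<noteq> {}"
    then obtain N1 N2 where N: "open N1" "N1 \<subseteq> S" "N1 - C \<subseteq> A" "open N2" "N2 - C \<subseteq> B" "N1 \<inter> N2 \<noteq> {}"
      unfolding A'_def B'_def by blast
    then have "N1 \<inter> N2 - C \<noteq> {}" by (intro nonseparating_dense[OF loc]) auto
    then show False using N(2,3,5) AB(4) by blast
  qed
  moreover have "A' \<inter> S \<noteq> {}" "B' \<inter> S \<noteq> {}" using cover AB(4-6) by blast+
  moreover have "S \<subseteq> A' \<union> B'" using cover by blast
  ultimately show False using connectedD[OF S(2) op] by blast
qed

text \<open>The bounded part of the closed set \<open>L\<close> is compact, and the inverse
  parametrization maps it onto this set. So the parametrization is proper and leaves every ball at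
  both ends.\<close>

lemma line_compact_preimage:
  fixes l :: "real \<Rightarrow> 'a::euclidean_space"
  assumes "homeomorphism UNIV L l h" "closed L"
  shows "compact {t. norm (l t) \<le> R}"
proof -
  have "{t. norm (l t) \<le> R} = h ` (L \<inter> cball 0 R)"
  proof (intro equalityI subsetI)
    fix t assume "t \<in> {t. norm (l t) \<le> R}"
    then have "l t \<in> L \<inter> cball 0 R" "t = h (l t)" using assms(1) by (auto simp: homeomorphism_def)
    then show "t \<in> h ` (L \<inter> cball 0 R)" by blast
  qed (use assms(1) in \<open>auto simp: homeomorphism_def\<close>)
  moreover have "compact (h ` (L \<inter> cball 0 R))"
    using assms by (intro compact_continuous_image closed_Int_compact) (auto simp: homeomorphism_def intro: continuous_on_subset)
  ultimately show ?thesis by simp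
qed

text \<open>The assumptions of the indirect proof, shown at the end to be contradictory.
  Semialgebraicity is represented here by \<open>near\<close> and \<open>infty\<close>.\<close>

locale line_nonproper =
  fixes F :: "'a::euclidean_space \<Rightarrow> 'a" and L :: "'a set" and l :: "real \<Rightarrow> 'a" and h :: "'a \<Rightarrow> real"
  assumes dim: "3 \<le> DIM('a)"
    and local_homeo: "\<And>x. \<exists>U V G. open U \<and> x \<in> U \<and> open V \<and> homeomorphism U V F G"
    and nonproper: "nonproper_set F = L"
    and cl: "closed L" and hom: "homeomorphism UNIV L l h"
    and near: "\<And>c. c \<in> L \<Longrightarrow> \<exists>r>0. \<exists>a b v. two_curves L c {0<..<r} a b v"
    and infty: "\<exists>R>0. \<exists>a b v. two_curves L 0 {R<..} a b v"
begin

lemma F_cont: "continuous_on S F"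
proof -
  have "isCont F x" for x
    using local_homeo[of x] by (metis continuous_on_eq_continuous_at homeomorphism_def)
  then show ?thesis by (simp add: continuous_at_imp_continuous_on)
qed

lemma F_open: 
  assumes "open S" shows "open (F ` S)"
  unfolding open_contains_ball
proof
  fix y assume "y \<in> F ` S"
  then obtain x where x: "x \<in> S" "y = F x" by blast
  obtain U V G where U: "open U" "x \<in> U" "open V" "homeomorphism U V F G" using local_homeo by blast
  have "openin (top_of_set V) (F ` (U \<inter> S))"
    by (rule homeomorphism_imp_open_map[OF U(4)]) (use U(1) assms in \<open>simp add: openin_open_Int\<close>)
  then have "open (F ` (U \<inter> S))" using U(3) openin_open_trans by blast
  moreover have "y \<in> F ` (U \<inter> S)" using x U(2) by blast
  ultimately obtain e where "e > 0" "ball y e \<subseteq> F ` (U \<inter> S)" by (meson open_contains_ball)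
  then show "\<exists>e>0. ball y e \<subseteq> F ` S" by blast
qed

lemma ball_minus_line:
  assumes "c \<in> L" shows "ball c r - L = shell c {0<..<r} - L"
  using assms by (auto simp: shell_def dist_norm norm_minus_commute)

lemma connected_small_ball:
  assumes "c \<in> L" "two_curves L c {0<..<r} a b v" "0 < \<rho>" "\<rho> \<le> r"
  shows "connected (ball c \<rho> - L)" "ball c \<rho> - L \<noteq> {}"
proof -
  have tc: "two_curves L c {0<..<\<rho>} a b v" by (rule two_curves_subset[OF assms(2)]) (use assms in auto)
  show "connected (ball c \<rho> - L)" unfolding ball_minus_line[OF assms(1)]
    by (rule two_curves_shell_connected[OF tc dim]) simp
  show "ball c \<rho> - L \<noteq> {}" unfolding ball_minus_line[OF assms(1)]
    by (rule two_curves_shell_connected[OF tc dim]) (use assms(3) in simp_all)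
qed

lemma line_nonseparating:
  assumes "0 < \<epsilon>"
  shows "\<exists>N. open N \<and> x \<in> N \<and> N \<subseteq> ball x \<epsilon> \<and> connected (N - L) \<and> N - L \<noteq> {}"
proof (cases "x \<in> L")
  case True
  obtain r a b v where r: "r > 0" "two_curves L x {0<..<r} a b v" using near[OF True] by blast
  define \<rho> where "\<rho> = min r \<epsilon>"
  have "0 < \<rho>" "\<rho> \<le> r" "\<rho> \<le> \<epsilon>" using r assms by (auto simp: \<rho>_def)
  then show ?thesis using connected_small_ball[OF True r(2), of \<rho>] by (intro exI[of _ "ball x \<rho>"]) auto
next
  case False
  then obtain e where e: "e > 0" "ball x e \<subseteq> - L" using cl by (metis ComplI open_Compl open_contains_ball)
  define \<rho> where "\<rho> = min e \<epsilon>"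
  have \<rho>: "0 < \<rho>" "\<rho> \<le> \<epsilon>" "ball x \<rho> - L = ball x \<rho>" using e assms by (auto simp: \<rho>_def)
  then show ?thesis by (intro exI[of _ "ball x \<rho>"]) auto
qed

lemma connected_minus_line: "open S \<Longrightarrow> connected S \<Longrightarrow> connected (S - L)"
  by (rule nonseparating_connected[OF line_nonseparating])

lemma open_minus_line_nonempty: "open W \<Longrightarrow> W \<noteq> {} \<Longrightarrow> W - L \<noteq> {}"
  by (rule nonseparating_dense[OF line_nonseparating])

text \<open>A local inverse at \<open>x\<close> transports a small neighbourhood of
  \<open>F x\<close> whose part off \<open>L\<close> is connected; \<open>N'\<close> is its preimage
  within the sheet through \<open>x\<close>.\<close>

lemma preimage_line_nonseparating:
  assumes "0 < \<epsilon>"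
  shows "\<exists>N. open N \<and> x \<in> N \<and> N \<subseteq> ball x \<epsilon> \<and> connected (N - F -` L) \<and> N - F -` L \<noteq> {}"
proof -
  obtain U V G where U: "open U" "x \<in> U" "open V" "homeomorphism U V F G" using local_homeo by blast
  have "open (F ` (U \<inter> ball x \<epsilon>))" by (intro F_open open_Int U(1) open_ball)
  moreover have "F x \<in> F ` (U \<inter> ball x \<epsilon>)" using U(2) assms by auto
  ultimately obtain e where e: "e > 0" "ball (F x) e \<subseteq> F ` (U \<inter> ball x \<epsilon>)" by (meson open_contains_ball)
  obtain N where N: "open N" "F x \<in> N" "N \<subseteq> ball (F x) e" "connected (N - L)" "N - L \<noteq> {}"
    using line_nonseparating[OF e(1), of "F x"] by blast
  have GF: "G (F z) = z" if "z \<in> U" for z using U(4) that by (rule homeomorphism_apply1)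
  have NU: "N \<subseteq> F ` (U \<inter> ball x \<epsilon>)" using N(3) e(2) by blast
  define N' where "N' = (U \<inter> ball x \<epsilon>) \<inter> F -` N"
  have eq: "G ` (N - L) = N' - F -` L"
  proof (intro equalityI subsetI)
    fix z assume "z \<in> G ` (N - L)"
    then obtain y where y: "y \<in> N" "y \<notin> L" "z = G y" by blast
    then obtain w where w: "w \<in> U \<inter> ball x \<epsilon>" "y = F w" using NU by blast
    then have "z = w" using GF y by auto
    then show "z \<in> N' - F -` L" using w y by (auto simp: N'_def)
  next
    fix z assume z: "z \<in> N' - F -` L"
    then have "z = G (F z)" "F z \<in> N - L" using GF by (auto simp: N'_def)
    then show "z \<in> G ` (N - L)" by blast
  qed
  have "N - L \<subseteq> V" using NU U(4) by (auto simp: homeomorphism_def)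
  then have "continuous_on (N - L) G" using U(4) by (meson continuous_on_subset homeomorphism_def)
  then have "connected (N' - F -` L)" using N(4) eq connected_continuous_image by metis
  moreover have "N' - F -` L \<noteq> {}" using eq N(5) by blast
  moreover have "open N'" unfolding N'_def
    by (intro open_Int U(1) open_ball continuous_open_vimage N(1))
      (use F_cont[of UNIV] in \<open>simp add: continuous_on_eq_continuous_at\<close>)
  moreover have "x \<in> N'" "N' \<subseteq> ball x \<epsilon>" using U(2) N(2) assms by (auto simp: N'_def)
  ultimately show ?thesis by blast
qed

lemma connected_minus_preimage: "open S \<Longrightarrow> connected S \<Longrightarrow> connected (S - F -` L)"
  by (rule nonseparating_connected[OF preimage_line_nonseparating])

lemma F_vimage_open: "open S \<Longrightarrow> open (F -` S)"
  using F_cont[of UNIV] by (simp add: continuous_on_open_vimage)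

text \<open>Properness away from \<open>L\<close>: an unbounded sequence in the preimage would have
  images accumulating at a point of \<open>K\<close>, and that point would belong to the
  non-properness set.\<close>

lemma compact_preimage:
  assumes "compact K" "K \<inter> L = {}"
  shows "compact (F -` K)"
proof -
  have "closed (F -` K)"
    using F_cont[of UNIV] assms(1) by (simp add: continuous_on_closed_vimage compact_imp_closed)
  moreover have "bounded (F -` K)"
  proof (rule ccontr)
    assume "\<not> bounded (F -` K)"
    then have "\<exists>x. F x \<in> K \<and> real n < norm x" for n
      unfolding bounded_iff by (metis not_le vimageE)
    then obtain x where x: "\<And>n. F (x n) \<in> K" "\<And>n. real n < norm (x n)" by metis
    obtain y s where s: "y \<in> K" "strict_mono s" "((\<lambda>n. F (x n)) \<circ> s) \<longlonglongrightarrow> y"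
      using assms(1) x(1) unfolding compact_def by metis
    have "\<not> bounded (range (x \<circ> s))"
    proof
      assume "bounded (range (x \<circ> s))"
      then obtain B where B: "\<And>n. norm (x (s n)) \<le> B" by (auto simp: bounded_iff)
      obtain n where "B < real n" using reals_Archimedean2 by blast
      also have "real n \<le> real (s n)" using seq_suble[OF s(2)] by simp
      also have "\<dots> < norm (x (s n))" by (rule x(2))
      finally show False using B[of n] by simp
    qed
    moreover have "(\<lambda>k. F ((x \<circ> s) k)) \<longlonglongrightarrow> y" using s(3) by (simp add: o_def)
    ultimately have "y \<in> nonproper_set F" unfolding nonproper_set_def by blast
    then show False using s(1) nonproper assms(2) by blast
  qed
  ultimately show ?thesis by (simp add: compact_eq_bounded_closed)
qed

text \<open>The image of a clopen piece of the preimage is open since \<open>F\<close> is open, and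
  closed in \<open>W\<close> since \<open>F\<close> is proper over \<open>W\<close>.\<close>

lemma clopen_image:
  assumes W: "open W" "connected W" "W \<inter> L = {}" and AB: "open A" "open B" "A \<union> B = F -` W" "A \<inter> B = {}"
    and ne: "A \<noteq> {}"
  shows "F ` A = W"
proof -
  have sub: "F ` A \<subseteq> W" using AB(3) by blast
  have op: "open (F ` A)" by (rule F_open[OF AB(1)])
  have "open (W - F ` A)"
    unfolding open_contains_ball
  proof
    fix y assume y: "y \<in> W - F ` A"
    then obtain \<delta> where \<delta>: "\<delta> > 0" "cball y \<delta> \<subseteq> W" using W(1) by (meson DiffE open_contains_cball)
    \<comment> \<open>The part of \<open>A\<close> over a small closed ball: compact, because it is
      what remains of a compact set after removing the open set \<open>B\<close>.\<close>
    define K where "K = F -` cball y \<delta> - B"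
    have "compact (F -` cball y \<delta>)" by (rule compact_preimage) (use \<delta> W(3) in auto)
    then have "compact (F ` K)" unfolding K_def
      by (intro compact_continuous_image compact_diff AB(2) F_cont)
    moreover have "y \<notin> F ` K" using y AB(3) \<delta> unfolding K_def by auto
    ultimately obtain e where e: "e > 0" "ball y e \<subseteq> - F ` K"
      by (metis ComplI compact_imp_closed open_Compl open_contains_ball)
    have "ball y (min e \<delta>) \<subseteq> W - F ` A"
    proof
      fix q assume q: "q \<in> ball y (min e \<delta>)"
      then have qW: "q \<in> W" "q \<in> cball y \<delta>" using \<delta>(2) by auto
      have "q \<notin> F ` A"
      proof
        assume "q \<in> F ` A"
        then have "q \<in> F ` K" using qW(2) AB(4) unfolding K_def by blast
        then show False using e(2) q by auto
      qed
      then show "q \<in> W - F ` A" using qW by blast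
    qed
    then show "\<exists>e>0. ball y e \<subseteq> W - F ` A" using e(1) \<delta>(1) by (intro exI[of _ "min e \<delta>"]) auto
  qed
  then have "F ` A \<inter> W = {} \<or> (W - F ` A) \<inter> W = {}"
    by (intro connectedD[OF W(2) op]) auto
  then show ?thesis using sub ne by blast
qed

lemma preimage_complement_nonempty: "- (F -` L) \<noteq> {}"
  using nonseparating_dense[OF preimage_line_nonseparating, of UNIV] by auto

lemma connected_complement_line: "connected (- L)"
  using connected_minus_line[OF open_UNIV connected_UNIV] by (simp add: Compl_eq_Diff_UNIV)

lemma F_covers: "F ` (- (F -` L)) = - L"
proof (rule clopen_image[where B = "{}"])
  show "open (- L)" using cl by auto
  then show "open (- (F -` L))" using F_vimage_open[of "- L"] by (simp add: vimage_Compl)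
qed (use connected_complement_line preimage_complement_nonempty in \<open>auto simp: vimage_Compl\<close>)

text \<open>The fibre is compact by properness and discrete by local injectivity.\<close>

lemma finite_fibre:
  assumes "y \<notin> L" shows "finite (F -` {y})"
proof (rule ccontr)
  assume "\<not> finite (F -` {y})"
  moreover have "compact (F -` {y})" by (rule compact_preimage) (use assms in auto)
  ultimately obtain x where x: "x \<in> F -` {y}" "x islimpt F -` {y}"
    by (metis Heine_Borel_imp_Bolzano_Weierstrass order_refl)
  obtain U V G where U: "open U" "x \<in> U" "homeomorphism U V F G" using local_homeo by blast
  obtain z where z: "z \<in> F -` {y}" "z \<in> U" "z \<noteq> x" using x(2) U(1,2) unfolding islimpt_def by blast
  have "z = x" using homeomorphism_apply1[OF U(3)] U(2) z(1,2) x(1) by (metis vimage_singleton_eq)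
  then show False using z(3) by blast
qed

lemma F_covering: "covering_space (- (F -` L)) F (- L)"
proof (rule covering_spaceI[OF F_cont F_covers])
  fix y assume y: "y \<in> - L"
  define D where "D = F -` {y}"
  have fin: "finite D" using finite_fibre y by (simp add: D_def)
  have "\<forall>p. \<exists>d>0. \<forall>q\<in>D. q \<noteq> p \<longrightarrow> d \<le> dist p q" using finite_set_avoid[OF fin] by blast
  then obtain d where d: "\<And>p. d p > 0" "\<And>p q. q \<in> D \<Longrightarrow> q \<noteq> p \<Longrightarrow> d p \<le> dist p q" by metis
  define e where "e = Min (insert 1 (d ` D))"
  have e: "0 < e" "\<And>p. p \<in> D \<Longrightarrow> e \<le> d p" using fin d(1) by (auto simp: e_def)
  obtain U V G where U: "\<And>x. open (U x)" "\<And>x. x \<in> U x" "\<And>x. homeomorphism (U x) (V x) F (G x)"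
    using local_homeo by metis
  define A where "A p = U p \<inter> ball p (e / 2)" for p
  have A: "open (A p)" "p \<in> A p" for p using U e(1) by (auto simp: A_def)
  have GF: "G p (F z) = z" if "z \<in> A p" for p z
    using homeomorphism_apply1[OF U(3)] that by (auto simp: A_def)
  have disj: "A p \<inter> A q = {}" if "p \<in> D" "q \<in> D" "p \<noteq> q" for p q
  proof -
    have "e \<le> dist p q" using d(2)[of q p] e(2)[of p] that by force
    then have "ball p (e / 2) \<inter> ball q (e / 2) = {}" by (intro disjoint_ballI) simp
    then show ?thesis by (auto simp: A_def)
  qed
  obtain \<delta> where \<delta>: "\<delta> > 0" "cball y \<delta> \<subseteq> - L" using cl y by (metis open_Compl open_contains_cball)
  \<comment> \<open>The points over a small closed ball that lie on none of the chosen sheets. Their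
    image is closed and misses \<open>y\<close>; removing it in \<open>T\<close> leaves an evenly
    covered neighbourhood.\<close>
  define K where "K = F -` cball y \<delta> - \<Union> (A ` D)"
  have "compact (F -` cball y \<delta>)" by (rule compact_preimage) (use \<delta> in auto)
  then have "compact (F ` K)" unfolding K_def
    by (intro compact_continuous_image compact_diff open_UN ballI A F_cont)
  then have clK: "closed (F ` K)" by (rule compact_imp_closed)
  define T where "T = (ball y \<delta> \<inter> (\<Inter>p\<in>D. F ` A p)) - F ` K"
  have opT: "open T" unfolding T_def
    by (intro open_Diff open_Int open_INT fin ballI F_open A clK open_ball)
  have yT: "y \<in> T"
  proof -
    have "y \<in> F ` A p" if "p \<in> D" for p using that A(2) by (auto simp: D_def)
    moreover have "y \<notin> F ` K" using A(2) by (auto simp: K_def D_def)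
    ultimately show ?thesis using \<delta>(1) by (auto simp: T_def)
  qed
  have "T \<subseteq> cball y \<delta>" by (auto simp: T_def)
  then have TL: "T \<subseteq> - L" using \<delta>(2) by (rule order_trans)
  have TA: "x \<in> \<Union> (A ` D)" if "F x \<in> T" for x
  proof (rule ccontr)
    assume n: "x \<notin> \<Union> (A ` D)"
    have "F x \<in> ball y \<delta>" using that by (simp add: T_def)
    then have "F x \<in> cball y \<delta>" by simp
    with n have "F x \<in> F ` K" unfolding K_def by blast
    then show False using that by (simp add: T_def)
  qed
  define v where "v = (\<lambda>p. A p \<inter> F -` T) ` D"
  have "\<Union> v = - (F -` L) \<inter> F -` T" using TL TA by (auto simp: v_def)
  moreover have "openin (top_of_set (- (F -` L))) u" if "u \<in> v" for u
  proof -
    have "open u" "u \<subseteq> - (F -` L)" using that TL by (auto simp: v_def intro!: A F_vimage_open opT)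
    then show ?thesis by (simp add: open_subset)
  qed
  moreover have "pairwise disjnt v"
    unfolding v_def pairwise_image by (rule pairwiseI) (use disj in \<open>auto simp: disjnt_def\<close>)
  moreover have "\<exists>q. homeomorphism u T F q" if u: "u \<in> v" for u
  proof -
    obtain p where p: "p \<in> D" "u = A p \<inter> F -` T" using u by (auto simp: v_def)
    have TFA: "t \<in> F ` A p" if "t \<in> T" for t using that p(1) by (auto simp: T_def)
    have "homeomorphism u T F (G p)"
    proof (rule homeomorphismI)
      have "T \<subseteq> V p"
      proof
        fix t assume "t \<in> T"
        then obtain z where "z \<in> A p" "t = F z" using TFA by blast
        then show "t \<in> V p" using U(3)[of p] by (auto simp: homeomorphism_def A_def)
      qed
      then show "continuous_on T (G p)" using U(3)[of p] by (meson continuous_on_subset homeomorphism_def)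
      show "G p ` T \<subseteq> u"
      proof (rule image_subsetI)
        fix t assume t: "t \<in> T"
        then obtain z where "z \<in> A p" "t = F z" using TFA by blast
        then show "G p t \<in> u" using GF t p(2) by simp
      qed
      show "F (G p t) = t" if "t \<in> T" for t using TFA[OF that] GF by auto
    qed (use p(2) GF F_cont in auto)
    then show ?thesis by blast
  qed
  ultimately show "\<exists>T. y \<in> T \<and> openin (top_of_set (- L)) T \<and>
           (\<exists>v. \<Union>v = - (F -` L) \<inter> F -` T \<and> (\<forall>u\<in>v. openin (top_of_set (- (F -` L))) u) \<and>
                pairwise disjnt v \<and> (\<forall>u\<in>v. \<exists>q. homeomorphism u T F q))"
    using yT opT TL by (intro exI[of _ T] conjI exI[of _ v] ballI) (auto simp: open_subset)
qed

lemma unbounded_outside: "\<not> bounded ({y. R < norm y} - L)"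
proof
  assume "bounded ({y. R < norm y} - L)"
  then obtain B where B: "\<And>y. y \<in> {y. R < norm y} - L \<Longrightarrow> norm y \<le> B" unfolding bounded_iff by blast
  have "- cball 0 (max R B) \<noteq> ({} :: 'a set)"
    using cobounded_imp_unbounded[of "- cball (0::'a) (max R B)"] by (metis bounded_cball bounded_empty double_complement)
  then have "- cball 0 (max R B) - L \<noteq> {}" by (intro open_minus_line_nonempty) auto
  then obtain y where "y \<notin> cball 0 (max R B)" "y \<notin> L" by blast
  then show False using B[of y] by (simp add: not_le)
qed

text \<open>The complement of a ball in the source is connected, so any two clopen pieces, being unbounded,
  meet there.\<close>
lemma connected_preimage_neighbourhood:
  assumes W: "open W" "connected W" "L \<subseteq> W" "{y. R < norm y} \<subseteq> W"
  shows "connected (F -` (W - L))"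
proof (rule ccontr)
  assume "\<not> connected (F -` (W - L))"
  then obtain A B where AB: "open A" "open B" "F -` (W - L) \<subseteq> A \<union> B" "A \<inter> B \<inter> F -` (W - L) = {}"
    "A \<inter> F -` (W - L) \<noteq> {}" "B \<inter> F -` (W - L) \<noteq> {}" unfolding connected_def by blast
  define P where "P = F -` (W - L)"
  have opW: "open (W - L)" using W(1) cl by (rule open_Diff)
  have opP: "open P" unfolding P_def by (rule F_vimage_open[OF opW])
  have con: "connected (W - L)" by (rule connected_minus_line[OF W(1,2)])
  have 1: "F ` (A \<inter> P) = W - L"
    by (rule clopen_image[OF opW con, where B = "B \<inter> P"]) (use AB opP in \<open>auto simp: P_def\<close>)
  have 2: "F ` (B \<inter> P) = W - L"
    by (rule clopen_image[OF opW con, where B = "A \<inter> P"]) (use AB opP in \<open>auto simp: P_def\<close>)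
  have "compact (- W)"
  proof -
    have "- W \<subseteq> cball 0 R" using W(4) by (force simp: not_less)
    then show ?thesis using W(1) by (metis bounded_cball bounded_subset closed_Compl compact_eq_bounded_closed)
  qed
  then have "compact (F -` (- W))" by (rule compact_preimage) (use W(3) in auto)
  then have "bounded (F -` (- W))" by (rule compact_imp_bounded)
  then obtain \<rho> where \<rho>: "\<And>x. F x \<notin> W \<Longrightarrow> norm x \<le> \<rho>"
    unfolding bounded_iff by auto
  \<comment> \<open>The ball contains everything not mapped into \<open>W\<close>, so
    \<open>E\<close> is a connected part of \<open>P\<close> that reaches out to infinity.\<close>
  define E where "E = - cball 0 \<rho> - F -` L"
  have "connected (- cball 0 \<rho> :: 'a set)"
    by (rule connected_complement_bounded_convex) (use dim in auto)
  then have "connected E" unfolding E_def by (intro connected_minus_preimage) auto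
  moreover have EP: "E \<subseteq> P" using \<rho> by (force simp: E_def P_def)
  \<comment> \<open>A piece that maps onto \<open>W - L\<close> cannot lie in a ball, as the image
    of a closed ball is bounded and \<open>W - L\<close> is not.\<close>
  moreover have meets: "X \<inter> E \<noteq> {}" if X: "F ` X = W - L" for X
  proof
    assume "X \<inter> E = {}"
    moreover have "X \<inter> F -` L = {}" using X by blast
    ultimately have "X \<subseteq> cball 0 \<rho>" unfolding E_def by blast
    then have "F ` X \<subseteq> F ` cball 0 \<rho>" by (rule image_mono)
    moreover have "bounded (F ` cball 0 \<rho>)"
      by (intro compact_imp_bounded compact_continuous_image F_cont compact_cball)
    ultimately have "bounded (W - L)" using X bounded_subset by metis
    then show False using unbounded_outside[of R] W(4) by (meson Diff_mono bounded_subset order_refl)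
  qed
  ultimately have "A \<inter> E = {} \<or> B \<inter> E = {}"
    by (intro connectedD[OF _ AB(1,2)]) (use AB(3,4) EP in \<open>auto simp: P_def\<close>)
  then show False using meets[OF 1] meets[OF 2] by blast
qed

end

section \<open>Points over the line exist: a winding argument\<close>

text \<open>The values lie in the discrete set of integer multiples of
  \<open>2 * pi * \<i>\<close>.\<close>

lemma exp_eq_1_constant:
  fixes f :: "'b::topological_space \<Rightarrow> complex"
  assumes "connected S" "continuous_on S f" "\<And>x. x \<in> S \<Longrightarrow> exp (f x) = 1" "x \<in> S" "y \<in> S"
  shows "f x = f y"
proof -
  have "f constant_on S"
  proof (rule continuous_discrete_range_constant[OF assms(1,2)])
    fix x assume x: "x \<in> S"
    have "2 * pi \<le> norm (f y - f x)" if y: "y \<in> S" "f y \<noteq> f x" for y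
    proof -
      have "exp (f y) = exp (f x)" using assms(3) x y by simp
      then obtain n :: int where n: "f y = f x + of_real (real_of_int (2 * n) * pi) * \<i>" using exp_eq by blast
      then have "n \<noteq> 0" using y(2) by auto
      then have "1 \<le> \<bar>real_of_int n\<bar>" by linarith
      moreover have "norm (f y - f x) = 2 * pi * \<bar>real_of_int n\<bar>" using n by (simp add: norm_mult)
      ultimately show ?thesis by simp
    qed
    then show "\<exists>e>0. \<forall>y. y \<in> S \<and> f y \<noteq> f x \<longrightarrow> e \<le> norm (f y - f x)"
      by (intro exI[of _ "2 * pi"]) auto
  qed
  then show ?thesis using assms(4,5) unfolding constant_on_def by metis
qed

text \<open>Moving each point radially outwards by \<open>\<rho>\<close> identifies the punctured
  space with the complement of the ball.\<close>

lemma simply_connected_complement_cball: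
  fixes a :: "'a::euclidean_space"
  assumes "3 \<le> DIM('a)" "0 \<le> \<rho>"
  shows "simply_connected (- cball (0::'a) \<rho>)"
proof -
  have "homeomorphism (- {0}) (- cball (0::'a) \<rho>) (\<lambda>x. (1 + \<rho> / norm x) *\<^sub>R x) (\<lambda>y. (1 - \<rho> / norm y) *\<^sub>R y)"
  proof (rule homeomorphismI)
    have n1: "norm ((1 + \<rho> / norm x) *\<^sub>R x) = norm x + \<rho>" if "x \<noteq> 0" for x :: 'a
    proof -
      have "0 \<le> \<rho> / norm x" using assms(2) by simp
      then have "\<bar>1 + \<rho> / norm x\<bar> = 1 + \<rho> / norm x" by simp
      then show ?thesis using that unfolding norm_scaleR by (simp add: distrib_right)
    qed
    have n2: "norm ((1 - \<rho> / norm y) *\<^sub>R y) = norm y - \<rho>" if "\<rho> < norm y" for y :: 'a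
    proof -
      have "\<rho> / norm y < 1" using that assms(2) by (simp add: divide_less_eq)
      then have "\<bar>1 - \<rho> / norm y\<bar> = 1 - \<rho> / norm y" by simp
      moreover have "norm y \<noteq> 0" using that assms(2) by linarith
      ultimately show ?thesis unfolding norm_scaleR by (simp add: left_diff_distrib)
    qed
    show "(\<lambda>x. (1 + \<rho> / norm x) *\<^sub>R x) ` (- {0}) \<subseteq> - cball (0::'a) \<rho>"
      using n1 by (auto simp del: norm_scaleR)
    show "(\<lambda>y. (1 - \<rho> / norm y) *\<^sub>R y) ` (- cball (0::'a) \<rho>) \<subseteq> - {0}"
    proof (rule image_subsetI)
      fix y :: 'a assume "y \<in> - cball 0 \<rho>"
      then have "0 < norm ((1 - \<rho> / norm y) *\<^sub>R y)" using n2[of y] by simp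
      then show "(1 - \<rho> / norm y) *\<^sub>R y \<in> - {0}" by (metis ComplI norm_zero less_irrefl singletonD)
    qed
    show "(1 - \<rho> / norm ((1 + \<rho> / norm x) *\<^sub>R x)) *\<^sub>R ((1 + \<rho> / norm x) *\<^sub>R x) = x" if "x \<in> - {0}" for x :: 'a
    proof -
      have "(1 - \<rho> / (norm x + \<rho>)) * (1 + \<rho> / norm x) = 1"
        using that assms(2) by (simp add: field_simps add_nonneg_eq_0_iff)
      then show ?thesis using n1[of x] that by (simp del: norm_scaleR)
    qed
    show "(1 + \<rho> / norm ((1 - \<rho> / norm y) *\<^sub>R y)) *\<^sub>R ((1 - \<rho> / norm y) *\<^sub>R y) = y" if "y \<in> - cball 0 \<rho>" for y :: 'a
    proof -
      have y: "\<rho> < norm y" using that by simp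
      moreover have "norm y \<noteq> 0" using y assms(2) by linarith
      ultimately have "(1 + \<rho> / (norm y - \<rho>)) * (1 - \<rho> / norm y) = 1"
        using assms(2) by (simp add: field_simps)
      then show ?thesis using n2[OF y] by (simp del: norm_scaleR)
    qed
  qed (auto intro!: continuous_intros simp: assms(2) not_le dest: le_less_trans[OF assms(2)])
  then have "- {0::'a} homeomorphic - cball (0::'a) \<rho>" unfolding homeomorphic_def by blast
  then show ?thesis
    using simply_connected_punctured_universe[OF assms(1), of 0] homeomorphic_simply_connected by blast
qed

context line_nonproper
begin

lemma line_points: "l t \<in> L" "h (l t) = t" and line_param: "z \<in> L \<Longrightarrow> l (h z) = z"
  using hom by (auto simp: homeomorphism_def)

lemma line_cont: "continuous_on S l" "continuous_on L h"
  using hom by (meson continuous_on_subset homeomorphism_def subset_UNIV)+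

text \<open>If the line were missed, a circle-valued function measuring the position along the line (closed
  up at infinity) would pull back to the simply connected complement of a ball and have a logarithm
  there; lifting a loop that runs once parallel to the line increases this logarithm by a full turn,
  but the fibres are finite.\<close>
lemma preimage_line_nonempty: "F -` L \<noteq> {}"
proof
  assume empty: "F -` L = {}"
  obtain hh where hh: "continuous_on UNIV hh" "\<And>y. y \<in> L \<Longrightarrow> hh y = h y"
    using Tietze_unbounded[OF line_cont(2), of UNIV] cl by auto
  \<comment> \<open>A ramp from 0 to \<open>2 * pi\<close> over the parameters from -1 to 1: as an
    angle it makes one full turn along the line and is trivial beyond.\<close>
  define \<kappa> :: "real \<Rightarrow> real" where "\<kappa> s = 2 * pi * max 0 (min 1 ((s + 1) / 2))" for s
  have \<kappa>lo: "\<kappa> s = 0" if "s \<le> - 1" for s using that by (simp add: \<kappa>_def)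
  have \<kappa>hi: "\<kappa> s = 2 * pi" if "1 \<le> s" for s using that by (simp add: \<kappa>_def min_def max_def)
  have \<kappa>c: "continuous_on S (\<lambda>y. \<kappa> (hh y))" for S unfolding \<kappa>_def
    by (intro continuous_intros continuous_on_subset[OF hh(1)]) auto
  have "bounded (l ` {-1..1})" by (intro compact_imp_bounded compact_continuous_image line_cont compact_Icc)
  then obtain R1 where R1: "\<And>t. - 1 \<le> t \<Longrightarrow> t \<le> 1 \<Longrightarrow> norm (l t) < R1"
    unfolding bounded_iff by (metis atLeastAtMost_iff imageI le_less_trans less_add_one)
  \<comment> \<open>The two formulas for \<open>\<theta>\<close>, the constant 1 outside radius
    \<open>R1\<close> and the exponential of the angle inside, can fail to fit only here. By the
    choice of \<open>R1\<close> the wall misses \<open>L\<close>, so its preimage is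
    bounded.\<close>
  define wall where "wall = {y. norm y = R1 \<and> \<bar>hh y\<bar> \<le> 1}"
  have "closed wall" unfolding wall_def
    by (intro closed_Collect_conj closed_Collect_eq closed_Collect_le continuous_intros hh(1))
  moreover have "bounded wall" unfolding wall_def bounded_iff by force
  ultimately have "compact wall" by (simp add: compact_eq_bounded_closed)
  moreover have "wall \<inter> L = {}"
  proof (rule ccontr)
    assume "wall \<inter> L \<noteq> {}"
    then obtain y where "y \<in> wall" "y \<in> L" by blast
    then have y: "y \<in> L" "norm y = R1" "\<bar>h y\<bar> \<le> 1" using hh(2)[of y] by (auto simp: wall_def)
    then have "norm (l (h y)) < R1" by (intro R1) auto
    then show False using y line_param by simp
  qed
  ultimately have "bounded (F -` wall)" by (intro compact_imp_bounded compact_preimage)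
  then obtain \<rho>0 where \<rho>0: "\<And>x. F x \<in> wall \<Longrightarrow> norm x \<le> \<rho>0" unfolding bounded_iff by auto
  define \<rho> where "\<rho> = max 0 \<rho>0"
  have \<rho>: "0 \<le> \<rho>" "\<And>x. F x \<in> wall \<Longrightarrow> norm x \<le> \<rho>" using \<rho>0 by (auto simp: \<rho>_def le_max_iff_disj)
  define O1 where "O1 = {y. norm y < R1} \<union> {y. 1 < \<bar>hh y\<bar>}"
  define O2 where "O2 = {y :: 'a. R1 < norm y}"
  have op: "open O1" "open O2" unfolding O1_def O2_def
    by (intro open_Un open_Collect_less continuous_intros hh(1))+
  have W: "- wall = O1 \<union> O2" by (auto simp: wall_def O1_def O2_def)
  define \<theta> :: "'a \<Rightarrow> complex" where "\<theta> y = (if R1 \<le> norm y then 1 else exp (\<i> * of_real (\<kappa> (hh y))))" for y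
  have \<theta>1: "\<theta> y = exp (\<i> * of_real (\<kappa> (hh y)))" if "y \<in> O1" for y
  proof (cases "norm y < R1")
    case False
    then have "hh y \<le> - 1 \<or> 1 \<le> hh y" using that by (auto simp: O1_def)
    then have "\<kappa> (hh y) = 0 \<or> \<kappa> (hh y) = 2 * pi" using \<kappa>lo \<kappa>hi by blast
    then have "exp (\<i> * of_real (\<kappa> (hh y))) = 1" by (auto simp: exp_eq_1)
    then show ?thesis using False by (simp add: \<theta>_def)
  qed (simp add: \<theta>_def)
  have \<theta>2: "\<theta> y = 1" if "y \<in> O2" for y using that by (simp add: \<theta>_def O2_def)
  have "continuous_on O1 \<theta>"
    by (rule continuous_on_eq[of _ "\<lambda>y. exp (\<i> * of_real (\<kappa> (hh y)))"]) (auto intro!: continuous_intros \<kappa>c simp: \<theta>1)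
  moreover have "continuous_on O2 \<theta>"
    by (rule continuous_on_eq[of _ "\<lambda>y. 1"]) (auto simp: \<theta>2)
  ultimately have \<theta>c: "continuous_on (- wall) \<theta>" unfolding W by (intro continuous_on_open_Un op)
  define S where "S = - cball (0::'a) \<rho>"
  have "continuous_on S (\<lambda>x. \<theta> (F x))"
    by (rule continuous_on_compose2[OF \<theta>c F_cont]) (use \<rho>(2) in \<open>auto simp: S_def\<close>)
  moreover have "simply_connected S" unfolding S_def by (rule simply_connected_complement_cball[OF dim \<rho>(1)])
  moreover have "locally path_connected S" unfolding S_def by (intro open_imp_locally_path_connected) auto
  ultimately obtain g where g: "continuous_on S g" "\<And>x. x \<in> S \<Longrightarrow> \<theta> (F x) = exp (g x)"
    by (rule continuous_logarithm_on_simply_connected) (auto simp: \<theta>_def)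
  \<comment> \<open>Compact, and disjoint from \<open>L\<close> because \<open>L\<close> is assumed
    to be missed. Paths that avoid it lift into \<open>S\<close>, where the logarithm
    \<open>g\<close> lives.\<close>
  define \<Gamma> where "\<Gamma> = F ` cball 0 \<rho>"
  have \<Gamma>: "compact \<Gamma>" "\<Gamma> \<inter> L = {}" using empty by (auto simp: \<Gamma>_def intro!: compact_continuous_image F_cont)
  have inS: "x \<in> S" if "F x \<notin> \<Gamma>" for x using that by (auto simp: S_def \<Gamma>_def)
  obtain R2 where R2: "R1 < R2" "\<And>y. y \<in> \<Gamma> \<Longrightarrow> norm y < R2"
  proof -
    obtain B where "\<And>y. y \<in> \<Gamma> \<Longrightarrow> norm y \<le> B" using compact_imp_bounded[OF \<Gamma>(1)] by (auto simp: bounded_iff)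
    then show ?thesis using that[of "max R1 B + 1"] by fastforce
  qed
  obtain T where T: "1 < T" "\<And>t. norm (l t) \<le> R2 \<Longrightarrow> \<bar>t\<bar> < T"
  proof -
    obtain B where "\<And>t. norm (l t) \<le> R2 \<Longrightarrow> \<bar>t\<bar> \<le> B"
      using compact_imp_bounded[OF line_compact_preimage[OF hom cl, of R2]] by (auto simp: bounded_iff)
    then show ?thesis using that[of "max 1 B + 1"] by fastforce
  qed
  \<comment> \<open>An arc of the line with both ends outside radius \<open>R2\<close>. Its tube
    \<open>N\<close> and the outside \<open>V\<close> of a ball both avoid \<open>\<Gamma>\<close>;
    the loop goes along the arc in \<open>N\<close> and returns in \<open>V\<close>.\<close>
  define A where "A = l ` {-T..T}"
  have A: "compact A" "connected A" "A \<subseteq> L"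
    unfolding A_def by (auto intro!: compact_continuous_image connected_continuous_image line_cont line_points)
  have LO1: "L \<subseteq> O1"
  proof
    fix y assume y: "y \<in> L"
    then have "norm (l (h y)) < R1 \<or> 1 < \<bar>h y\<bar>" using R1[of "h y"] by (auto simp: abs_if)
    then show "y \<in> O1" using y hh(2) line_param by (auto simp: O1_def)
  qed
  have "open (O1 \<inter> - \<Gamma>)" using op(1) \<Gamma>(1) by (intro open_Int open_Compl compact_imp_closed)
  moreover have "A \<subseteq> O1 \<inter> - \<Gamma>" using A(3) LO1 \<Gamma>(2) by blast
  ultimately obtain \<epsilon> where \<epsilon>: "\<epsilon> > 0" "(\<Union>x\<in>A. ball x \<epsilon>) \<subseteq> O1 \<inter> - \<Gamma>"
    using compact_subset_open_imp_ball_epsilon_subset[OF A(1)] by metis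
  define N where "N = (\<Union>x\<in>A. ball x \<epsilon>)"
  have N: "open N" "N \<subseteq> O1" "N \<inter> \<Gamma> = {}" using \<epsilon>(2) by (auto simp: N_def)
  have "connected N"
  proof -
    have "N = (\<lambda>(a, b). a + b) ` (A \<times> ball 0 \<epsilon>)"
    proof (intro equalityI subsetI)
      fix y assume "y \<in> N"
      then obtain x where "x \<in> A" "y \<in> ball x \<epsilon>" by (auto simp: N_def)
      then have "y = x + (y - x)" "y - x \<in> ball 0 \<epsilon>" by (auto simp: dist_norm norm_minus_commute)
      then show "y \<in> (\<lambda>(a, b). a + b) ` (A \<times> ball 0 \<epsilon>)" using \<open>x \<in> A\<close> by (intro image_eqI[of _ _ "(x, y - x)"]) auto
    next
      fix y assume "y \<in> (\<lambda>(a, b). a + b) ` (A \<times> ball 0 \<epsilon>)"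
      then obtain a b where "a \<in> A" "norm b < \<epsilon>" "y = a + b" by auto
      then have "y \<in> ball a \<epsilon>" by (simp add: dist_norm)
      then show "y \<in> N" using \<open>a \<in> A\<close> by (auto simp: N_def)
    qed
    moreover have "connected ((\<lambda>(a, b). a + b) ` (A \<times> ball 0 \<epsilon>))"
      using A(2) by (intro connected_continuous_image connected_Times) (auto intro!: continuous_intros simp: case_prod_beta)
    ultimately show ?thesis by simp
  qed
  define V where "V = - cball (0::'a) R2"
  have V: "open V" "V \<inter> \<Gamma> = {}" "V \<subseteq> O2" unfolding V_def using R2 by (force simp: O2_def)+
  have conV: "connected V" unfolding V_def by (rule connected_complement_bounded_convex) (use dim in auto)
  have pc: "path_connected (X - L)" if "open X" "connected X" for X
    using that cl connected_minus_line by (intro connected_open_path_connected open_Diff) auto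
  have ends: "l (- T) \<in> V" "l T \<in> V" using T(2)[of T] T(2)[of "- T"] T(1) by (auto simp: V_def)
  have "N \<inter> V \<inter> {y. hh y < - 1} - L \<noteq> {}" "N \<inter> V \<inter> {y. 1 < hh y} - L \<noteq> {}"
  proof -
    have "l (- T) \<in> A" "l T \<in> A" using T(1) by (auto simp: A_def)
    then have "l (- T) \<in> N" "l T \<in> N" unfolding N_def using \<epsilon>(1) centre_in_ball by blast+
    moreover have "hh (l (- T)) < - 1" "1 < hh (l T)" using T(1) hh(2) line_points by auto
    ultimately have "N \<inter> V \<inter> {y. hh y < - 1} \<noteq> {}" "N \<inter> V \<inter> {y. 1 < hh y} \<noteq> {}" using ends by blast+
    moreover have "open (N \<inter> V \<inter> {y. hh y < - 1})" "open (N \<inter> V \<inter> {y. 1 < hh y})"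
      by (intro open_Int N(1) V(1) open_Collect_less continuous_intros hh(1))+
    ultimately show "N \<inter> V \<inter> {y. hh y < - 1} - L \<noteq> {}" "N \<inter> V \<inter> {y. 1 < hh y} - L \<noteq> {}"
      by (blast dest: open_minus_line_nonempty)+
  qed
  then obtain b b' where b: "b \<in> N - L" "b \<in> V - L" "hh b < - 1" and b': "b' \<in> N - L" "b' \<in> V - L" "1 < hh b'"
    by blast
  obtain p where p: "path p" "path_image p \<subseteq> N - L" "pathstart p = b" "pathfinish p = b'"
    using pc[OF N(1) \<open>connected N\<close>] b(1) b'(1) unfolding path_connected_def by blast
  obtain q where q: "path q" "path_image q \<subseteq> V - L" "pathstart q = b'" "pathfinish q = b"
    using pc[OF V(1) conV] b(2) b'(2) unfolding path_connected_def by blast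
  define D where "D = F -` {b}"
  have finD: "finite D" using finite_fibre b by (auto simp: D_def)
  have "b \<in> F ` (- (F -` L))" unfolding F_covers using b by blast
  then have neD: "D \<noteq> {}" by (auto simp: D_def)
  \<comment> \<open>The starting point is the one in the finite fibre with the largest imaginary
    part of \<open>g\<close>; the lifted loop will end in the fibre with a value larger by
    \<open>2 * pi\<close>.\<close>
  have "Max ((\<lambda>x. Im (g x)) ` D) \<in> (\<lambda>x. Im (g x)) ` D" using finD neD by (intro Max_in) auto
  then obtain x where x: "x \<in> D" "Im (g x) = Max ((\<lambda>x. Im (g x)) ` D)" by auto
  have xmax: "Im (g z) \<le> Im (g x)" if "z \<in> D" for z unfolding x(2) using finD that by (intro Max_ge) auto
  have xX: "x \<in> - (F -` L)" "F x = b" using x(1) b by (auto simp: D_def)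
  obtain p' where p': "path p'" "pathstart p' = x" "\<And>t. t \<in> {0..1} \<Longrightarrow> F (p' t) = p t"
    using covering_space_lift_path_strong[OF F_covering xX(1) p(1)] p(2,3) xX(2) by (metis DiffE ComplI subset_iff)
  have pN: "p t \<in> N" if "t \<in> {0..1}" for t using p(2) that unfolding path_image_def by blast
  have p'S: "p' t \<in> S" if "t \<in> {0..1}" for t by (rule inS) (use p'(3) pN that N(3) in auto)
  have pc': "continuous_on {0..1} p" "continuous_on {0..1} p'" using p(1) p'(1) by (auto simp: path_def)
  define x' where "x' = p' 1"
  \<comment> \<open>Over \<open>N\<close> both \<open>g\<close> and \<open>\<i>\<close> times the
    angle are logarithms of \<open>\<theta>\<close>, so their difference is constant along the path,
    while the angle rises from 0 to \<open>2 * pi\<close>.\<close>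
  have "g (p' 0) - \<i> * of_real (\<kappa> (hh (p 0))) = g (p' 1) - \<i> * of_real (\<kappa> (hh (p 1)))"
  proof (rule exp_eq_1_constant[of "{0..1}" "\<lambda>t. g (p' t) - \<i> * of_real (\<kappa> (hh (p t)))"])
    show "continuous_on {0..1} (\<lambda>t. g (p' t) - \<i> * of_real (\<kappa> (hh (p t))))"
      by (intro continuous_intros continuous_on_compose2[OF g(1) pc'(2)] continuous_on_compose2[OF \<kappa>c[of UNIV] pc'(1)])
        (use p'S in auto)
    show "exp (g (p' t) - \<i> * of_real (\<kappa> (hh (p t)))) = 1" if "t \<in> {0..1}" for t
      using g(2)[OF p'S[OF that]] \<theta>1[of "p t"] pN[OF that] N(2) p'(3)[OF that] by (auto simp: exp_diff)
  qed auto
  moreover have "p' 0 = x" "p 0 = b" "p 1 = b'" using p'(2) p(3,4) by (auto simp: pathstart_def pathfinish_def)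
  ultimately have "g x = g x' - \<i> * of_real (2 * pi)" using \<kappa>lo[of "hh b"] \<kappa>hi[of "hh b'"] b(3) b'(3) by (simp add: x'_def)
  then have Im1: "Im (g x') = Im (g x) + 2 * pi" by (simp add: complex_eq_iff)
  have x': "x' \<in> - (F -` L)" "F x' = b'" using p'(3)[of 1] \<open>p 1 = b'\<close> b' by (auto simp: x'_def)
  obtain q' where q': "path q'" "pathstart q' = x'" "\<And>t. t \<in> {0..1} \<Longrightarrow> F (q' t) = q t"
    using covering_space_lift_path_strong[OF F_covering x'(1) q(1)] q(2,3) x'(2) by (metis DiffE ComplI subset_iff)
  have qV: "q t \<in> V" if "t \<in> {0..1}" for t using q(2) that unfolding path_image_def by blast
  have q'S: "q' t \<in> S" if "t \<in> {0..1}" for t by (rule inS) (use q'(3) qV that V(2) in auto)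
  \<comment> \<open>On the way back \<open>\<theta>\<close> is constantly 1, so the logarithm does
    not change.\<close>
  have "g (q' 0) = g (q' 1)"
  proof (rule exp_eq_1_constant[of "{0..1}" "\<lambda>t. g (q' t)"])
    have "continuous_on {0..1} q'" using q'(1) by (simp add: path_def)
    then show "continuous_on {0..1} (\<lambda>t. g (q' t))"
      by (rule continuous_on_compose2[OF g(1)]) (use q'S in auto)
    show "exp (g (q' t)) = 1" if "t \<in> {0..1}" for t
      using g(2)[OF q'S[OF that]] \<theta>2[of "q t"] qV[OF that] V(3) q'(3)[OF that] by auto
  qed auto
  moreover have "q' 0 = x'" using q'(2) by (simp add: pathstart_def)
  moreover have "q' 1 \<in> D" using q'(3)[of 1] q(4) by (simp add: D_def pathfinish_def)
  ultimately show False using xmax[of "q' 1"] Im1 pi_gt_zero by simp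
qed

section \<open>Sections near the line\<close>

text \<open>The section lives over \<open>S - L\<close>, while \<open>S\<close> itself is meant to
  be a full neighbourhood of points of \<open>L\<close>.\<close>

definition section_on :: "'a set \<Rightarrow> ('a \<Rightarrow> 'a) \<Rightarrow> bool" where
  "section_on S \<sigma> \<longleftrightarrow> continuous_on (S - L) \<sigma> \<and> (\<forall>y\<in>S - L. F (\<sigma> y) = y)"

text \<open>The sheet through \<open>x\<close> is the image of a section, that is, no loop in
  \<open>S - L\<close> moves it. This is the property that spreads along a connected
  preimage.\<close>

definition liftable :: "'a set \<Rightarrow> 'a \<Rightarrow> bool" where
  "liftable S x \<longleftrightarrow> F x \<in> S - L \<and> (\<exists>\<sigma>. section_on S \<sigma> \<and> \<sigma> (F x) = x)"

lemma section_on_subset: "section_on S \<sigma> \<Longrightarrow> S' \<subseteq> S \<Longrightarrow> section_on S' \<sigma>"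
  unfolding section_on_def by (meson Diff_mono continuous_on_subset order_refl subsetD)

lemma section_onD: "section_on S \<sigma> \<Longrightarrow> y \<in> S - L \<Longrightarrow> F (\<sigma> y) = y"
  by (simp add: section_on_def)

lemma liftable_mono: "liftable S x \<Longrightarrow> S' \<subseteq> S \<Longrightarrow> F x \<in> S' \<Longrightarrow> liftable S' x"
  unfolding liftable_def using section_on_subset by blast

lemma section_on_unique:
  assumes "connected (S - L)" "section_on S \<sigma>" "section_on S \<tau>" "p \<in> S - L" "\<sigma> p = \<tau> p" "q \<in> S - L"
  shows "\<sigma> q = \<tau> q"
proof (rule covering_section_unique[OF F_covering assms(1), of \<sigma> \<tau> p q])
  show "continuous_on (S - L) \<sigma>" "continuous_on (S - L) \<tau>" using assms(2,3) by (auto simp: section_on_def)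
  show "F (\<sigma> y) = y" "F (\<tau> y) = y" if "y \<in> S - L" for y using assms(2,3) that by (auto simp: section_on_def)
  then show "\<sigma> \<in> S - L \<rightarrow> - (F -` L)" "\<tau> \<in> S - L \<rightarrow> - (F -` L)" by auto
qed (use assms in auto)

lemma local_inverse_section:
  assumes "open S" "F x \<in> S"
  obtains A e G where "open A" "x \<in> A" "0 < e" "ball (F x) e \<subseteq> S" "F ` A \<subseteq> ball (F x) e"
    "section_on (ball (F x) e) G" "\<And>z. z \<in> A \<Longrightarrow> G (F z) = z" "\<And>y. y \<in> ball (F x) e \<Longrightarrow> F (G y) = y"
proof -
  obtain U V G where U: "open U" "x \<in> U" "homeomorphism U V F G" using local_homeo by blast
  have "open (F ` U \<inter> S)" "F x \<in> F ` U \<inter> S" using F_open[OF U(1)] assms U(2) by auto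
  then obtain e where e: "e > 0" "ball (F x) e \<subseteq> F ` U \<inter> S" by (meson open_contains_ball)
  define A where "A = U \<inter> F -` ball (F x) e"
  have "open A" unfolding A_def by (intro open_Int U(1) F_vimage_open open_ball)
  moreover have GF: "G (F z) = z" if "z \<in> U" for z using homeomorphism_apply1[OF U(3) that] .
  moreover have FG: "F (G y) = y" if y: "y \<in> ball (F x) e" for y
  proof -
    obtain z where "z \<in> U" "y = F z" using e(2) y by blast
    then show ?thesis using GF by simp
  qed
  moreover have "section_on (ball (F x) e) G"
  proof -
    have "ball (F x) e \<subseteq> V" using e(2) U(3) by (auto simp: homeomorphism_def)
    then have "continuous_on (ball (F x) e - L) G" using U(3) by (meson Diff_subset continuous_on_subset homeomorphism_def order_trans)
    then show ?thesis using FG by (auto simp: section_on_def)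
  qed
  moreover have "x \<in> A" "F ` A \<subseteq> ball (F x) e" using U(2) e(1) by (auto simp: A_def)
  ultimately show ?thesis using that[of A e G] e by (auto simp: A_def)
qed

text \<open>A section through a point near \<open>x\<close> agrees there with the local inverse,
  hence on a whole connected ball, and therefore passes through all the nearby points.\<close>

lemma liftable_locally_constant:
  assumes S: "open S" "F x \<in> S - L"
  obtains A where "open A" "x \<in> A" "\<And>x'. x' \<in> A \<Longrightarrow> F x' \<in> S - L" "\<And>x'. x' \<in> A \<Longrightarrow> liftable S x' = liftable S x"
proof -
  obtain A e G where A: "open A" "x \<in> A" "0 < e" "ball (F x) e \<subseteq> S - L" "F ` A \<subseteq> ball (F x) e"
    "section_on (ball (F x) e) G" "\<And>z. z \<in> A \<Longrightarrow> G (F z) = z"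
    using local_inverse_section[of "S - L" x] S cl open_Diff by metis
  have "liftable S x2" if x: "x1 \<in> A" "x2 \<in> A" and lift: "liftable S x1" for x1 x2
  proof -
    obtain \<sigma> where \<sigma>: "section_on S \<sigma>" "\<sigma> (F x1) = x1" using lift by (auto simp: liftable_def)
    have "\<sigma> (F x2) = G (F x2)"
    proof (rule section_on_unique[of "ball (F x) e" \<sigma> G "F x1"])
      show "connected (ball (F x) e - L)" by (intro connected_minus_line) auto
      show "section_on (ball (F x) e) \<sigma>" by (rule section_on_subset[OF \<sigma>(1)]) (use A(4) in blast)
      show "F x1 \<in> ball (F x) e - L" "F x2 \<in> ball (F x) e - L" using x A(4,5) by blast+
      show "\<sigma> (F x1) = G (F x1)" using \<sigma>(2) A(7) x(1) by simp
    qed (rule A(6))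
    then have "\<sigma> (F x2) = x2" using A(7) x(2) by simp
    moreover have "F x2 \<in> S - L" using x(2) A(4,5) by blast
    ultimately show ?thesis using \<sigma>(1) unfolding liftable_def by blast
  qed
  then show ?thesis using that[of A] A(1,2,4,5) by blast
qed

text \<open>It matters that \<open>N\<close> meets \<open>L\<close>: a small ball off
  \<open>L\<close> always carries sections, and extending those would already mean that the covering
  is trivial over \<open>G - L\<close>. Connectedness of \<open>N - L\<close> makes the extension
  agree with \<open>s\<close> on all of it.\<close>

definition extension_domain :: "'a set \<Rightarrow> bool" where
  "extension_domain G \<longleftrightarrow> (\<forall>N s. open N \<and> N \<subseteq> G \<and> N \<inter> L \<noteq> {} \<and> connected (N - L) \<and> section_on N s \<longrightarrow>
     (\<exists>\<sigma>. section_on G \<sigma> \<and> (\<forall>y\<in>N - L. \<sigma> y = s y)))"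

text \<open>The centre of a ball lies on the line but not in the shell; the last hypothesis provides
  a base point of \<open>N\<close> on the line at which the chart is available.\<close>

lemma extension_domain_two_curves:
  assumes tc: "two_curves L c I a b v" and I: "open I" "connected I"
    and G: "G - L = shell c I - L"
    and N: "\<And>N. open N \<Longrightarrow> N \<subseteq> G \<Longrightarrow> N \<inter> L \<noteq> {} \<Longrightarrow> N \<inter> L \<inter> shell c I \<noteq> {}"
  shows "extension_domain G"
  unfolding extension_domain_def
proof (intro allI impI, elim conjE)
  fix N s assume N': "open N" "N \<subseteq> G" "N \<inter> L \<noteq> {}" "connected (N - L)" and s: "section_on N s"
  obtain z0 where z0: "z0 \<in> L" "z0 \<in> shell c I" "z0 \<in> N" using N[OF N'(1-3)] by blast
  have sX: "s \<in> (N - L) \<rightarrow> - (F -` L)" using s by (auto simp: section_on_def)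
  obtain \<sigma> y where \<sigma>: "continuous_on (shell c I - L) \<sigma>" "\<And>y. y \<in> shell c I - L \<Longrightarrow> F (\<sigma> y) = y"
    "y \<in> N - L" "y \<in> shell c I" "\<sigma> y = s y"
    by (rule two_curves_section_extend[OF tc dim I F_covering _ z0(1,2) N'(1) z0(3) _ sX])
      (use s in \<open>auto simp: section_on_def\<close>)
  have sec: "section_on G \<sigma>" using \<sigma>(1,2) G by (simp add: section_on_def)
  have "\<sigma> z = s z" if "z \<in> N - L" for z
    by (rule section_on_unique[OF N'(4) section_on_subset[OF sec N'(2)] s \<sigma>(3,5) that])
  then show "\<exists>\<sigma>. section_on G \<sigma> \<and> (\<forall>y\<in>N - L. \<sigma> y = s y)" using sec by blast
qed

lemma extension_domain_ball:
  assumes c: "c \<in> L" and tc: "two_curves L c {0<..<r} a b v"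
  shows "extension_domain (ball c r)"
proof (rule extension_domain_two_curves[OF tc _ _ ball_minus_line[OF c]])
  fix N assume N: "open N" "N \<subseteq> ball c r" "N \<inter> L \<noteq> {}"
  then obtain z where z: "z \<in> N" "z \<in> L" by blast
  show "N \<inter> L \<inter> shell c {0<..<r} \<noteq> {}"
  proof (cases "z = c")
    case False
    have "z \<in> ball c r" using z(1) N(2) by blast
    then have "z \<in> shell c {0<..<r}" using False by (simp add: shell_def dist_norm norm_minus_commute)
    then show ?thesis using z by blast
  next
    case True
    then obtain e where e: "e > 0" "ball c e \<subseteq> N" using N(1) z(1) by (meson open_contains_ball)
    have "c \<in> ball c r" using True z(1) N(2) by blast
    then have r: "0 < r" by simp
    \<comment> \<open>If the given point is the centre, a point of the first curve at the small
      distance \<open>t\<close> replaces it.\<close>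
    define t where "t = min r e / 2"
    have t: "0 < t" "t < r" "t < e" using e(1) r by (auto simp: t_def)
    have a: "norm (a t) = 1" using tc t by (auto simp: two_curves_def)
    have "c + t *\<^sub>R a t \<in> L \<inter> shell c {0<..<r}" using tc t unfolding two_curves_def by auto
    moreover have "c + t *\<^sub>R a t \<in> ball c e" using a t by (simp add: dist_norm)
    ultimately show ?thesis using e(2) by blast
  qed
qed auto

lemma extension_domain_infinity:
  assumes tc: "two_curves L 0 {R<..} a b v"
  shows "extension_domain {y. R < norm y}"
  by (rule extension_domain_two_curves[OF tc]) (auto simp: shell_def)

lemma extension_domain_liftable:
  assumes "extension_domain G" "open N" "connected N" "N \<subseteq> G" "N \<inter> L \<noteq> {}" "liftable N x"
  shows "liftable G x"
proof -
  obtain s where s: "section_on N s" "s (F x) = x" "F x \<in> N - L" using assms(6) by (auto simp: liftable_def)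
  have "connected (N - L)" by (rule connected_minus_line[OF assms(2,3)])
  then obtain \<sigma> where "section_on G \<sigma>" "\<forall>y\<in>N - L. \<sigma> y = s y"
    using assms(1,2,4,5) s(1) unfolding extension_domain_def by blast
  then show ?thesis using s assms(4) by (auto simp: liftable_def)
qed

lemma unbounded_line: "\<exists>z\<in>L. R < norm z"
proof -
  obtain B where "\<And>t. norm (l t) \<le> R \<Longrightarrow> \<bar>t\<bar> \<le> B"
    using compact_imp_bounded[OF line_compact_preimage[OF hom cl, of R]] by (auto simp: bounded_iff)
  then have "\<not> norm (l (\<bar>B\<bar> + 1)) \<le> R" by force
  moreover have "l (\<bar>B\<bar> + 1) \<in> L" using hom by (auto simp: homeomorphism_def)
  ultimately show ?thesis by force
qed

text \<open>One point over \<open>L\<close> settles all sheets: lying on a local section does not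
  depend on the neighbourhood used, is locally constant over a neighbourhood \<open>W\<close> of
  \<open>L\<close> and infinity, and holds for points near \<open>x0\<close> that are off the
  preimage of \<open>L\<close>. The preimage of \<open>W - L\<close> being connected, it holds
  throughout.\<close>

lemma all_locally_liftable:
  assumes x0: "F x0 \<in> L"
  shows "\<exists>\<delta>>0. \<forall>x. F x \<in> ball z \<delta> - L \<longrightarrow> liftable (ball z \<delta>) x"
proof -
  obtain R0 a0 b0 v0 where R0: "R0 > 0" "two_curves L 0 {R0<..} a0 b0 v0" using infty by blast
  define V0 where "V0 = {y :: 'a. R0 < norm y}"
  have V0: "extension_domain V0" unfolding V0_def by (rule extension_domain_infinity[OF R0(2)])
  have opV0: "open V0" unfolding V0_def by (intro open_Collect_less continuous_intros)
  define R1 where "R1 = R0 + 1"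
  define V1 where "V1 = {y :: 'a. R1 < norm y}"
  have opV1: "open V1" unfolding V1_def by (intro open_Collect_less continuous_intros)
  have V10: "V1 \<subseteq> V0" by (auto simp: V1_def V0_def R1_def)
  have "\<forall>c\<in>L. \<exists>r>0. extension_domain (ball c r)" using near extension_domain_ball by meson
  then obtain rr where rr: "\<And>c. c \<in> L \<Longrightarrow> rr c > 0" "\<And>c. c \<in> L \<Longrightarrow> extension_domain (ball c (rr c))" by metis
  define \<Lambda> where "\<Lambda> = L \<inter> cball 0 (R1 + 1)"
  have "compact \<Lambda>" unfolding \<Lambda>_def using cl by (intro closed_Int_compact) auto
  moreover have "\<Lambda> \<subseteq> \<Union> ((\<lambda>c. ball c (rr c)) ` \<Lambda>)" using rr(1) by (force simp: \<Lambda>_def)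
  ultimately obtain \<mu> where \<mu>: "0 < \<mu>" "\<And>x. x \<in> \<Lambda> \<Longrightarrow> \<exists>G\<in>(\<lambda>c. ball c (rr c)) ` \<Lambda>. ball x \<mu> \<subseteq> G"
    by (rule Heine_Borel_lemma) auto
  have good: "\<exists>G. extension_domain G \<and> ball z \<mu> \<subseteq> G" if "z \<in> \<Lambda>" for z
    using \<mu>(2)[OF that] rr(2) by (auto simp: \<Lambda>_def)
  \<comment> \<open>One third of the Lebesgue number, so that two such balls with a common point lie
    in one extension domain. The bound \<open>1 / 2\<close> and the choice
    \<open>R1 = R0 + 1\<close> put every such ball that contains a point of \<open>V1\<close> inside
    \<open>V0\<close>.\<close>
  define \<epsilon> where "\<epsilon> = min (\<mu> / 3) (1 / 2)"
  have \<epsilon>: "0 < \<epsilon>" "3 * \<epsilon> \<le> \<mu>" "\<epsilon> \<le> 1 / 2" using \<mu>(1) by (auto simp: \<epsilon>_def)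
  have \<Lambda>L: "ball z \<epsilon> \<inter> L \<noteq> {}" if "z \<in> \<Lambda>" for z
    using that centre_in_ball[of z \<epsilon>] \<epsilon>(1) unfolding \<Lambda>_def by blast
  have lift_shift: "liftable (ball z' \<epsilon>) x"
    if z: "z \<in> \<Lambda>" and x: "F x \<in> ball z' \<epsilon>" and lift: "liftable (ball z \<epsilon>) x" for z z' x
  proof -
    obtain G where G: "extension_domain G" "ball z \<mu> \<subseteq> G" using good[OF z] by blast
    have "ball z \<epsilon> \<subseteq> ball z \<mu>" using \<epsilon> by (intro subset_ball) auto
    then have "ball z \<epsilon> \<subseteq> G" using G(2) by blast
    then have "liftable G x" using \<Lambda>L[OF z] by (intro extension_domain_liftable[OF G(1) _ _ _ _ lift]) simp_all
    moreover have "ball z' \<epsilon> \<subseteq> ball z \<mu>"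
    proof
      fix y assume y: "y \<in> ball z' \<epsilon>"
      have "dist z y \<le> dist z (F x) + dist z' (F x) + dist z' y" 
        using dist_triangle[of z y "F x"] dist_triangle[of "F x" y z'] by (simp add: dist_commute)
      also have "\<dots> < 3 * \<epsilon>" using y x lift by (auto simp: liftable_def)
      finally show "y \<in> ball z \<mu>" using \<epsilon>(2) by simp
    qed
    ultimately show ?thesis using liftable_mono G(2) x by (meson order_trans)
  qed
  have near_inf: "ball z \<epsilon> \<subseteq> V0" if "F x \<in> ball z \<epsilon>" "R1 < norm (F x)" for z x
  proof
    fix y assume y: "y \<in> ball z \<epsilon>"
    have "dist (F x) y < 1" using dist_triangle[of "F x" y z] y that(1) \<epsilon>(3) by (simp add: dist_commute)
    then have "norm (F x) < norm y + 1" using norm_triangle_ineq2[of "F x" y] by (simp add: dist_norm)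
    then show "y \<in> V0" using that(2) by (simp add: V0_def R1_def)
  qed
  have lift_inf: "liftable (ball z \<epsilon>) x = liftable V0 x" if "z \<in> \<Lambda>" "F x \<in> ball z \<epsilon>" "R1 < norm (F x)" for z x
  proof
    assume "liftable (ball z \<epsilon>) x"
    then show "liftable V0 x" using \<Lambda>L[OF that(1)] near_inf[OF that(2,3)]
      by (intro extension_domain_liftable[OF V0, of "ball z \<epsilon>"]) simp_all
  qed (rule liftable_mono[OF _ near_inf[OF that(2,3)] that(2)])
  define W where "W = V1 \<union> (\<Union>z\<in>\<Lambda>. ball z \<epsilon>)"
  have opW: "open W" unfolding W_def by (intro open_Un opV1 open_UN) auto
  have LW: "L \<subseteq> W" using \<epsilon>(1) by (force simp: W_def V1_def \<Lambda>_def)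
  have conL: "connected L"
    using hom by (metis connected_UNIV connected_continuous_image homeomorphism_def)
  have "connected W"
  proof -
    have conV1: "connected V1"
    proof -
      have "V1 = - cball 0 R1" by (auto simp: V1_def)
      then show ?thesis using connected_complement_bounded_convex[of "cball (0::'a) R1"] dim by simp
    qed
    have "V1 \<inter> L \<noteq> {}" using unbounded_line[of R1] by (auto simp: V1_def)
    then have 1: "connected (V1 \<union> L)" by (intro connected_Un conV1 conL)
    have 2: "connected (ball z \<epsilon> \<union> L)" if "z \<in> \<Lambda>" for z
      by (intro connected_Un conL connected_ball \<Lambda>L that)
    have "connected (\<Union> (insert (V1 \<union> L) ((\<lambda>z. ball z \<epsilon> \<union> L) ` \<Lambda>)))"
    proof (rule connected_Union)
      have "l 0 \<in> \<Inter> (insert (V1 \<union> L) ((\<lambda>z. ball z \<epsilon> \<union> L) ` \<Lambda>))" using hom by (auto simp: homeomorphism_def)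
      then show "\<Inter> (insert (V1 \<union> L) ((\<lambda>z. ball z \<epsilon> \<union> L) ` \<Lambda>)) \<noteq> {}" by blast
    qed (use 1 2 in auto)
    moreover have "\<Union> (insert (V1 \<union> L) ((\<lambda>z. ball z \<epsilon> \<union> L) ` \<Lambda>)) = W" using LW by (auto simp: W_def)
    ultimately show ?thesis by simp
  qed
  define P where "P = F -` (W - L)"
  have conP: "connected P" unfolding P_def
    by (rule connected_preimage_neighbourhood[OF opW \<open>connected W\<close> LW, of R1]) (auto simp: W_def V1_def)
  \<comment> \<open>Lying on a local section, regardless of the member of the cover;
    \<open>char1\<close> and \<open>char2\<close> show that all members that apply give the same
    answer.\<close>
  define \<chi>' where "\<chi>' x \<longleftrightarrow> (\<exists>z\<in>\<Lambda>. F x \<in> ball z \<epsilon> \<and> liftable (ball z \<epsilon>) x) \<or> (F x \<in> V1 \<and> liftable V0 x)" for x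
  have char1: "\<chi>' x = liftable (ball z \<epsilon>) x" if "z \<in> \<Lambda>" "F x \<in> ball z \<epsilon>" for z x
    using that lift_shift lift_inf unfolding \<chi>'_def V1_def by blast
  have char2: "\<chi>' x = liftable V0 x" if "F x \<in> V1" for x
    using that lift_inf unfolding \<chi>'_def V1_def by blast
  have loc: "\<exists>A. open A \<and> x \<in> A \<and> (\<forall>x'\<in>A. \<chi>' x' = \<chi>' x)" if x: "x \<in> P" for x
  proof (cases "F x \<in> V1")
    case True
    have "F x \<in> V0 - L" using x True V10 by (auto simp: P_def)
    then obtain A where A: "open A" "x \<in> A" "\<And>x'. x' \<in> A \<Longrightarrow> liftable V0 x' = liftable V0 x"
      using liftable_locally_constant[OF opV0] by metis
    have "\<chi>' x' = \<chi>' x" if "x' \<in> A \<inter> F -` V1" for x'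
      using char2[of x'] char2[OF True] A(3)[of x'] that by simp
    moreover have "open (A \<inter> F -` V1)" by (intro open_Int A(1) F_vimage_open opV1)
    moreover have "x \<in> A \<inter> F -` V1" using A(2) True by simp
    ultimately show ?thesis by blast
  next
    case False
    then obtain z where z: "z \<in> \<Lambda>" "F x \<in> ball z \<epsilon>" "F x \<in> ball z \<epsilon> - L" using x by (auto simp: P_def W_def)
    then obtain A where A: "open A" "x \<in> A" "\<And>x'. x' \<in> A \<Longrightarrow> F x' \<in> ball z \<epsilon> - L"
        "\<And>x'. x' \<in> A \<Longrightarrow> liftable (ball z \<epsilon>) x' = liftable (ball z \<epsilon>) x"
      using liftable_locally_constant[OF open_ball] by metis
    have "\<chi>' x' = \<chi>' x" if "x' \<in> A" for x'
      using char1[OF z(1), of x'] char1[OF z(1,2)] A(3,4)[OF that] by simp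
    then show ?thesis using A(1,2) by blast
  qed
  have opset: "open (\<Union>{A. open A \<and> (\<forall>x\<in>A. Q x)})" for Q :: "'a \<Rightarrow> bool" by auto
  have const: "\<chi>' x" if "x \<in> P" "y \<in> P" "\<chi>' y" for x y
  proof (rule ccontr)
    assume nx: "\<not> \<chi>' x"
    let ?A = "\<Union>{A. open A \<and> (\<forall>x\<in>A. \<chi>' x)}" and ?B = "\<Union>{A. open A \<and> (\<forall>x\<in>A. \<not> \<chi>' x)}"
    have "u \<in> ?A \<union> ?B" if "u \<in> P" for u using loc[OF that] by (cases "\<chi>' u") auto
    then have "P \<subseteq> ?A \<union> ?B" by blast
    moreover have "?A \<inter> ?B \<inter> P = {}" by blast
    ultimately have "?A \<inter> P = {} \<or> ?B \<inter> P = {}" by (intro connectedD[OF conP] opset) auto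
    moreover have "y \<in> ?A" using loc[OF that(2)] that(3) by blast
    moreover have "x \<in> ?B" using loc[OF that(1)] nx by blast
    ultimately show False using that by blast
  qed
  have "\<exists>x\<in>P. \<chi>' x"
  proof -
    \<comment> \<open>\<open>S\<close> surrounds \<open>F x0\<close> inside one extension domain.
      The local inverse at \<open>x0\<close> is a section near a point of \<open>L\<close>, so it
      extends to that domain, and its values off the preimage of \<open>L\<close> satisfy
      \<open>\<chi>'\<close>.\<close>
    have "\<exists>S G. open S \<and> F x0 \<in> S \<and> extension_domain G \<and> S \<subseteq> G \<and> (\<forall>x. F x \<in> S - L \<longrightarrow> liftable G x \<longrightarrow> \<chi>' x \<and> x \<in> P)"
    proof (cases "F x0 \<in> \<Lambda>")
      case True
      obtain G where G: "extension_domain G" "ball (F x0) \<mu> \<subseteq> G" using good[OF True] by blast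
      have "ball (F x0) \<epsilon> \<subseteq> ball (F x0) \<mu>" using \<epsilon> by (intro subset_ball) auto
      then have sub: "ball (F x0) \<epsilon> \<subseteq> G" using G(2) by blast
      have "\<chi>' x \<and> x \<in> P" if "F x \<in> ball (F x0) \<epsilon> - L" "liftable G x" for x
      proof -
        have "liftable (ball (F x0) \<epsilon>) x" by (rule liftable_mono[OF that(2) sub]) (use that(1) in auto)
        then show ?thesis using char1[OF True, of x] that(1) True by (auto simp: P_def W_def)
      qed
      then show ?thesis using G(1) sub \<epsilon>(1) by (intro exI[of _ "ball (F x0) \<epsilon>"] exI[of _ G]) auto
    next
      case False
      then have "F x0 \<in> V1" using x0 by (auto simp: V1_def \<Lambda>_def)
      then show ?thesis using V0 V10 opV1 char2 by (intro exI[of _ V1] exI[of _ V0]) (auto simp: P_def W_def)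
    qed
    then obtain S G where S: "open S" "F x0 \<in> S" "extension_domain G" "S \<subseteq> G"
      "\<And>x. F x \<in> S - L \<Longrightarrow> liftable G x \<Longrightarrow> \<chi>' x \<and> x \<in> P" by blast
    obtain e H where e: "0 < e" "ball (F x0) e \<subseteq> S" "section_on (ball (F x0) e) H"
      "\<And>y. y \<in> ball (F x0) e \<Longrightarrow> F (H y) = y"
      using local_inverse_section[OF S(1,2)] by metis
    have "ball (F x0) e - L \<noteq> {}" using e(1) by (intro open_minus_line_nonempty) auto
    then obtain y where y: "y \<in> ball (F x0) e - L" by blast
    have "liftable (ball (F x0) e) (H y)" using e(3,4) y by (auto simp: liftable_def)
    moreover have "ball (F x0) e \<inter> L \<noteq> {}" using x0 centre_in_ball[of "F x0" e] e(1) by blast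
    moreover have "ball (F x0) e \<subseteq> G" using e(2) S(4) by blast
    ultimately have "liftable G (H y)"
      by (intro extension_domain_liftable[OF S(3), of "ball (F x0) e"]) simp_all
    moreover have "F (H y) \<in> S - L" using e(2) e(4)[of y] y by auto
    ultimately show ?thesis using S(5) by blast
  qed
  then have all: "\<chi>' x" if "x \<in> P" for x using const that by blast
  \<comment> \<open>Off \<open>L\<close> any ball avoiding \<open>L\<close> is evenly covered, on
    the compact part the radius \<open>\<epsilon>\<close> works, and farther out the radius 1 works
    since \<open>R1 + 1\<close> keeps the ball inside \<open>V1\<close>.\<close>
  consider "z \<notin> L" | "z \<in> \<Lambda>" | "z \<in> L" "R1 + 1 < norm z"
    by (cases "norm z \<le> R1 + 1") (auto simp: \<Lambda>_def)
  then show ?thesis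
  proof cases
    case 1
    then obtain \<delta> where \<delta>: "\<delta> > 0" "ball z \<delta> \<subseteq> - L" using cl by (metis ComplI open_Compl open_contains_ball)
    have "liftable (ball z \<delta>) x" if x: "F x \<in> ball z \<delta> - L" for x
    proof -
      have sc: "simply_connected (ball z \<delta>)" by (simp add: convex_imp_simply_connected)
      have lp: "locally path_connected (ball z \<delta>)" by (simp add: convex_imp_locally_path_connected)
      have id: "continuous_on (ball z \<delta>) (\<lambda>y. y)" "(\<lambda>y. y) \<in> ball z \<delta> \<rightarrow> - L" using \<delta>(2) by auto
      have xX: "x \<in> - (F -` L)" "F x \<in> ball z \<delta>" using x by auto
      obtain g where "continuous_on (ball z \<delta>) g" "g (F x) = x" "\<And>y. y \<in> ball z \<delta> \<Longrightarrow> F (g y) = y"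
        using covering_space_lift_strong[OF F_covering xX(1) xX(2) sc lp id refl] by metis
      then have "section_on (ball z \<delta>) g" "g (F x) = x" by (auto simp: section_on_def intro: continuous_on_subset)
      then show ?thesis using x by (auto simp: liftable_def)
    qed
    then show ?thesis using \<delta>(1) by blast
  next
    case 2
    have "liftable (ball z \<epsilon>) x" if "F x \<in> ball z \<epsilon> - L" for x
      using all[of x] char1[OF 2, of x] that 2 by (auto simp: P_def W_def)
    then show ?thesis using \<epsilon>(1) by blast
  next
    case 3
    have sub: "ball z 1 \<subseteq> V1"
    proof
      fix y assume "y \<in> ball z 1"
      then have "norm z < norm y + 1" using norm_triangle_ineq2[of z y] by (simp add: dist_norm)
      then show "y \<in> V1" using 3(2) by (simp add: V1_def)
    qed
    have "liftable (ball z 1) x" if x: "F x \<in> ball z 1 - L" for x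
    proof -
      have "F x \<in> V1" "x \<in> P" using x sub by (auto simp: P_def W_def)
      then have "liftable V0 x" using all char2 by blast
      then show ?thesis using liftable_mono sub V10 x by blast
    qed
    then show ?thesis by (intro exI[of _ 1]) auto
  qed
qed

section \<open>A global section\<close>

lemma section_on_glue:
  assumes op: "\<And>i. i \<in> I \<Longrightarrow> open (S i)" and sec: "\<And>i. i \<in> I \<Longrightarrow> section_on (S i) (\<tau> i)"
    and eq: "\<And>i y. i \<in> I \<Longrightarrow> y \<in> S i - L \<Longrightarrow> \<sigma> y = \<tau> i y"
  shows "section_on (\<Union>i\<in>I. S i) \<sigma>"
  unfolding section_on_def
proof
  have "continuous_on (\<Union>i\<in>I. S i - L) \<sigma>"
  proof (rule continuous_on_open_UN)
    fix i assume i: "i \<in> I"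
    show "open (S i - L)" using op[OF i] cl by (rule open_Diff)
    show "continuous_on (S i - L) \<sigma>"
      by (rule continuous_on_eq[of _ "\<tau> i"]) (use sec[OF i] eq[OF i] in \<open>auto simp: section_on_def\<close>)
  qed
  moreover have "(\<Union>i\<in>I. S i) - L = (\<Union>i\<in>I. S i - L)" by blast
  ultimately show "continuous_on ((\<Union>i\<in>I. S i) - L) \<sigma>" by (simp only:)
  show "\<forall>y\<in>(\<Union>i\<in>I. S i) - L. F (\<sigma> y) = y"
  proof
    fix y assume "y \<in> (\<Union>i\<in>I. S i) - L"
    then obtain i where "i \<in> I" "y \<in> S i - L" by blast
    then show "F (\<sigma> y) = y" using eq section_onD[OF sec] by metis
  qed
qed

text \<open>Any two of the sections agree on the smaller of their concentric balls because they
  agree at the centre, which lies off \<open>L\<close>.\<close>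

lemma sections_on_balls_union:
  assumes o: "o' \<notin> L" and T: "\<And>t. t \<in> T \<Longrightarrow> 0 < t \<and> section_on (ball o' t) (\<tau> t) \<and> \<tau> t o' = x"
    and ne: "T \<noteq> {}"
  shows "\<exists>\<sigma>. section_on (\<Union>t\<in>T. ball o' t) \<sigma> \<and> \<sigma> o' = x"
proof -
  have agree: "\<tau> t y = \<tau> u y" if t: "t \<in> T" and u: "u \<in> T" and y: "y \<in> ball o' t" "y \<in> ball o' u" "y \<notin> L" for t u y
  proof (rule section_on_unique[of "ball o' (min t u)" "\<tau> t" "\<tau> u" o' y])
    show "connected (ball o' (min t u) - L)" by (intro connected_minus_line) auto
    show "section_on (ball o' (min t u)) (\<tau> t)" by (rule section_on_subset[of "ball o' t"]) (use T t in auto)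
    show "section_on (ball o' (min t u)) (\<tau> u)" by (rule section_on_subset[of "ball o' u"]) (use T u in auto)
    show "o' \<in> ball o' (min t u) - L" using T[OF t] T[OF u] o by simp
    show "\<tau> t o' = \<tau> u o'" using T[OF t] T[OF u] by simp
    show "y \<in> ball o' (min t u) - L" using y by simp
  qed
  define k where "k y = (SOME t. t \<in> T \<and> y \<in> ball o' t)" for y
  have k: "k y \<in> T" "y \<in> ball o' (k y)" if "t \<in> T" "y \<in> ball o' t" for t y
    using someI[of "\<lambda>t. t \<in> T \<and> y \<in> ball o' t" t] that unfolding k_def by blast+
  define \<sigma> where "\<sigma> y = \<tau> (k y) y" for y
  have "section_on (\<Union>t\<in>T. ball o' t) \<sigma>"
  proof (rule section_on_glue[where \<tau> = \<tau>])
    show "section_on (ball o' t) (\<tau> t)" if "t \<in> T" for t using T[OF that] by blast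
    show "\<sigma> y = \<tau> t y" if t: "t \<in> T" and y: "y \<in> ball o' t - L" for t y
      unfolding \<sigma>_def using y by (intro agree[OF k(1)[OF t] t k(2)[OF t]]) auto
  qed auto
  moreover have "\<sigma> o' = x"
  proof -
    obtain t where t: "t \<in> T" using ne by blast
    have "o' \<in> ball o' t" using T[OF t] by simp
    from T[OF k(1)[OF t this]] show ?thesis by (simp add: \<sigma>_def)
  qed
  ultimately show ?thesis by blast
qed

text \<open>By compactness the local triviality holds with one radius \<open>\<mu>\<close> along the
  closed ball. Each ball of this radius meets the open ball in a convex set, connected even without
  \<open>L\<close>, so \<open>\<sigma>\<close> singles out one section on it, and these sections fit
  together.\<close>

lemma section_on_ball_extend:
  assumes lift: "\<And>z. \<exists>\<delta>>0. \<forall>x. F x \<in> ball z \<delta> - L \<longrightarrow> liftable (ball z \<delta>) x"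
    and s: "0 < s" and \<sigma>: "section_on (ball o' s) \<sigma>" and o: "o' \<notin> L"
  shows "\<exists>s'>s. \<exists>\<tau>. section_on (ball o' s') \<tau> \<and> \<tau> o' = \<sigma> o'"
proof -
  obtain \<delta> where \<delta>: "\<And>z. 0 < \<delta> z" "\<And>z x. F x \<in> ball z (\<delta> z) - L \<Longrightarrow> liftable (ball z (\<delta> z)) x"
    using lift by metis
  have "cball o' s \<subseteq> \<Union> (range (\<lambda>z. ball z (\<delta> z)))"
  proof
    fix z
    have "z \<in> ball z (\<delta> z)" using \<delta>(1) by simp
    then show "z \<in> \<Union> (range (\<lambda>z. ball z (\<delta> z)))" by blast
  qed
  from Heine_Borel_lemma[OF compact_cball this]
  obtain \<mu> where \<mu>: "0 < \<mu>" "\<And>x. x \<in> cball o' s \<Longrightarrow> \<exists>G\<in>range (\<lambda>z. ball z (\<delta> z)). ball x \<mu> \<subseteq> G" by auto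
  have uni: "liftable (ball z \<mu>) x" if z: "z \<in> cball o' s" and x: "F x \<in> ball z \<mu> - L" for z x
  proof -
    obtain c where c: "ball z \<mu> \<subseteq> ball c (\<delta> c)" using \<mu>(2)[OF z] by blast
    then have "liftable (ball c (\<delta> c)) x" using x by (intro \<delta>(2)) blast
    then show ?thesis by (rule liftable_mono[OF _ c]) (use x in blast)
  qed
  have meet: "ball z r \<inter> ball o' s - L \<noteq> {}" if "z \<in> cball o' s" "0 < r" for z r
  proof (rule open_minus_line_nonempty)
    have "z \<in> closure (ball o' s)" using that(1) s by simp
    then show "ball z r \<inter> ball o' s \<noteq> {}" using that(2) 
      by (metis Int_commute centre_in_ball disjoint_iff open_Int_closure_eq_empty open_ball)
  qed auto
  have con: "connected (ball z r \<inter> ball o' s - L)" for z r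
    by (intro connected_minus_line) (auto intro!: convex_connected convex_Int)
  have "\<exists>\<tau>. section_on (ball z \<mu>) \<tau> \<and> (\<forall>y\<in>ball z \<mu> \<inter> ball o' s - L. \<tau> y = \<sigma> y)" if z: "z \<in> cball o' s" for z
  proof -
    obtain y where y: "y \<in> ball z \<mu> \<inter> ball o' s - L" using meet[OF z \<mu>(1)] by blast
    then have Fy: "F (\<sigma> y) = y" using section_onD[OF \<sigma>] by blast
    have "liftable (ball z \<mu>) (\<sigma> y)" by (rule uni[OF z]) (use Fy y in simp)
    then obtain \<tau> where \<tau>: "section_on (ball z \<mu>) \<tau>" "\<tau> y = \<sigma> y" using Fy by (auto simp: liftable_def)
    have "\<tau> w = \<sigma> w" if "w \<in> ball z \<mu> \<inter> ball o' s - L" for w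
      by (rule section_on_unique[OF con section_on_subset[OF \<tau>(1)] section_on_subset[OF \<sigma>] y \<tau>(2) that]) auto
    then show ?thesis using \<tau>(1) by blast
  qed
  then obtain \<tau> where \<tau>: "\<And>z. z \<in> cball o' s \<Longrightarrow> section_on (ball z \<mu>) (\<tau> z)"
    "\<And>z y. z \<in> cball o' s \<Longrightarrow> y \<in> ball z \<mu> \<inter> ball o' s - L \<Longrightarrow> \<tau> z y = \<sigma> y" by metis
  \<comment> \<open>With a third of the radius, two overlapping small balls satisfy: one of them
    lies in the \<open>\<mu>\<close>-ball about the centre of the other, where the comparison with
    \<open>\<sigma>\<close> is possible.\<close>
  define \<nu> where "\<nu> = \<mu> / 3"
  have \<nu>: "0 < \<nu>" "3 * \<nu> = \<mu>" using \<mu>(1) by (auto simp: \<nu>_def)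
  have agree: "\<tau> z y = \<tau> w y" if z: "z \<in> cball o' s" and w: "w \<in> cball o' s" and y: "y \<in> ball z \<nu>" "y \<in> ball w \<nu>" "y \<notin> L" for z w y
  proof -
    have sub: "ball w \<nu> \<subseteq> ball z \<mu>"
    proof
      fix u assume u: "u \<in> ball w \<nu>"
      have "dist z u \<le> dist z y + dist w y + dist w u"
        using dist_triangle[of z u y] dist_triangle[of y u w] by (simp add: dist_commute)
      then show "u \<in> ball z \<mu>" using u y \<nu> by simp
    qed
    have sub': "ball w \<nu> \<subseteq> ball w \<mu>" using \<nu> by (intro subset_ball) auto
    obtain p where p: "p \<in> ball w \<nu> \<inter> ball o' s - L" using meet[OF w \<nu>(1)] by blast
    show ?thesis
    proof (rule section_on_unique[of "ball w \<nu>" "\<tau> z" "\<tau> w" p y])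
      show "connected (ball w \<nu> - L)" by (intro connected_minus_line) auto
      show "section_on (ball w \<nu>) (\<tau> z)" by (rule section_on_subset[OF \<tau>(1)[OF z] sub])
      show "section_on (ball w \<nu>) (\<tau> w)" by (rule section_on_subset[OF \<tau>(1)[OF w] sub'])
      show "p \<in> ball w \<nu> - L" using p by blast
      have "p \<in> ball z \<mu> \<inter> ball o' s - L" "p \<in> ball w \<mu> \<inter> ball o' s - L" using p sub sub' by blast+
      then show "\<tau> z p = \<tau> w p" using \<tau>(2)[OF z] \<tau>(2)[OF w] by metis
      show "y \<in> ball w \<nu> - L" using y by blast
    qed
  qed
  define k where "k y = (SOME z. z \<in> cball o' s \<and> y \<in> ball z \<nu>)" for y
  have k: "k y \<in> cball o' s" "y \<in> ball (k y) \<nu>" if "z \<in> cball o' s" "y \<in> ball z \<nu>" for z y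
    using someI[of "\<lambda>z. z \<in> cball o' s \<and> y \<in> ball z \<nu>" z] that unfolding k_def by blast+
  define \<omega> where "\<omega> y = \<tau> (k y) y" for y
  have sec: "section_on (\<Union>z\<in>cball o' s. ball z \<nu>) \<omega>"
  proof (rule section_on_glue[where \<tau> = \<tau>])
    show "section_on (ball z \<nu>) (\<tau> z)" if "z \<in> cball o' s" for z
      by (rule section_on_subset[OF \<tau>(1)[OF that]]) (use \<nu> in auto)
    show "\<omega> y = \<tau> z y" if "z \<in> cball o' s" "y \<in> ball z \<nu> - L" for z y
      unfolding \<omega>_def by (rule agree) (use k[OF that(1), of y] that in auto)
  qed auto
  have "ball o' (s + \<nu>) \<subseteq> (\<Union>z\<in>cball o' s. ball z \<nu>)"
  proof
    fix y assume y: "y \<in> ball o' (s + \<nu>)"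
    show "y \<in> (\<Union>z\<in>cball o' s. ball z \<nu>)"
    proof (cases "y \<in> cball o' s")
      case True then show ?thesis using \<nu>(1) by force
    next
      case False
      define n where "n = norm (y - o')"
      have n: "s < n" "n < s + \<nu>" using False y by (auto simp: n_def dist_norm norm_minus_commute)
      \<comment> \<open>The radial projection of \<open>y\<close> to the sphere of radius
        \<open>s\<close>, at distance \<open>n - s\<close> from \<open>y\<close>.\<close>
      define z where "z = o' + (s / n) *\<^sub>R (y - o')"
      have "norm (z - o') = s" using n s by (simp add: z_def n_def[symmetric])
      then have zs: "z \<in> cball o' s" by (simp add: dist_norm norm_minus_commute)
      have "y - z = (1 - s / n) *\<^sub>R (y - o')" by (simp add: z_def algebra_simps)
      then have "norm (y - z) = \<bar>1 - s / n\<bar> * n" by (simp add: n_def)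
      also have "\<dots> = n - s" using n s by (simp add: abs_if field_simps)
      finally have "y \<in> ball z \<nu>" using n by (simp add: dist_norm norm_minus_commute)
      then show ?thesis using zs by blast
    qed
  qed
  then have "section_on (ball o' (s + \<nu>)) \<omega>" by (rule section_on_subset[OF sec])
  moreover have "\<omega> o' = \<sigma> o'"
  proof -
    have "o' \<in> cball o' s" "o' \<in> ball o' \<nu>" using s \<nu> by auto
    note ko = k[OF this]
    show ?thesis unfolding \<omega>_def by (rule \<tau>(2)[OF ko(1)]) (use ko(2) o s \<nu> in auto)
  qed
  ultimately show ?thesis using \<nu>(1) by (intro exI[of _ "s + \<nu>"]) auto
qed

text \<open>The radii of balls about \<open>F x\<close> with a section through \<open>x\<close> have
  no finite supremum: the sections on smaller balls unite to one on the open ball of supremal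
  radius, which extends to a larger ball.\<close>

lemma global_section:
  assumes lift: "\<And>z. \<exists>\<delta>>0. \<forall>x. F x \<in> ball z \<delta> - L \<longrightarrow> liftable (ball z \<delta>) x"
    and x: "F x \<notin> L"
  shows "\<exists>\<sigma>. section_on UNIV \<sigma> \<and> \<sigma> (F x) = x"
proof -
  define Q where "Q t \<longleftrightarrow> (\<exists>\<sigma>. section_on (ball (F x) t) \<sigma> \<and> \<sigma> (F x) = x)" for t
  have down: "Q t" if "Q u" "t \<le> u" for t u
    using that section_on_subset[OF _ subset_ball] unfolding Q_def by blast
  have all: "Q t" if "0 < t" for t
  proof (rule ccontr)
    assume nt: "\<not> Q t"
    define T where "T = {u. 0 < u \<and> Q u}"
    have bd: "u \<le> t" if "u \<in> T" for u using that nt down[of u t] by (force simp: T_def)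
    obtain \<delta> where \<delta>: "0 < \<delta>" "liftable (ball (F x) \<delta>) x" using lift[of "F x"] x by force
    then have \<delta>T: "\<delta> \<in> T" by (auto simp: T_def Q_def liftable_def)
    define s where "s = Sup T"
    have bdd: "bdd_above T" using bd by (auto simp: bdd_above_def)
    have us: "u \<le> s" if "u \<in> T" for u unfolding s_def by (rule cSup_upper[OF that bdd])
    have s0: "0 < s" using us[OF \<delta>T] \<delta>(1) by simp
    have "\<forall>u\<in>T. \<exists>\<tau>. 0 < u \<and> section_on (ball (F x) u) \<tau> \<and> \<tau> (F x) = x" by (auto simp: T_def Q_def)
    then obtain \<tau> where "\<And>u. u \<in> T \<Longrightarrow> 0 < u \<and> section_on (ball (F x) u) (\<tau> u) \<and> \<tau> u (F x) = x" by metis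
    from sections_on_balls_union[OF x this] \<delta>T
    obtain \<sigma> where \<sigma>: "section_on (\<Union>u\<in>T. ball (F x) u) \<sigma>" "\<sigma> (F x) = x" by blast
    have "ball (F x) s \<subseteq> (\<Union>u\<in>T. ball (F x) u)"
    proof
      fix y assume "y \<in> ball (F x) s"
      then have "dist (F x) y < Sup T" by (simp add: s_def)
      then obtain u where "u \<in> T" "dist (F x) y < u" using less_cSup_iff[OF _ bdd] \<delta>T by blast
      then show "y \<in> (\<Union>u\<in>T. ball (F x) u)" by auto
    qed
    then have "section_on (ball (F x) s) \<sigma>" by (rule section_on_subset[OF \<sigma>(1)])
    from section_on_ball_extend[OF lift s0 this x] \<sigma>(2)
    obtain s' where "s < s'" "Q s'" unfolding Q_def by auto
    then have "s' \<in> T" using s0 by (simp add: T_def)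
    then show False using us[of s'] \<open>s < s'\<close> by simp
  qed
  then have "\<forall>t\<in>{0<..}. \<exists>\<tau>. 0 < t \<and> section_on (ball (F x) t) \<tau> \<and> \<tau> (F x) = x" unfolding Q_def by blast
  then obtain \<tau> where "\<And>t. t \<in> {0<..} \<Longrightarrow> 0 < t \<and> section_on (ball (F x) t) (\<tau> t) \<and> \<tau> t (F x) = x" by metis
  moreover have "{0::real<..} \<noteq> {}" by auto
  ultimately obtain \<sigma> where \<sigma>: "section_on (\<Union>t\<in>{0<..}. ball (F x) t) \<sigma>" "\<sigma> (F x) = x"
    using sections_on_balls_union[OF x, of "{0<..}" \<tau> x] by blast
  have "(\<Union>t\<in>{0<..}. ball (F x) t) = UNIV"
  proof -
    have "y \<in> ball (F x) (dist (F x) y + 1)" "dist (F x) y + 1 \<in> {0<..}" for y by (auto intro: add_nonneg_pos)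
    then show ?thesis by blast
  qed
  then show ?thesis using \<sigma> by auto
qed

theorem inconsistent: False
proof -
  obtain x0 where x0: "F x0 \<in> L" using preimage_line_nonempty by blast
  note lift = all_locally_liftable[OF x0]
  obtain x1 where x1: "F x1 \<notin> L" using preimage_complement_nonempty by blast
  obtain \<sigma> where \<sigma>: "section_on UNIV \<sigma>" "\<sigma> (F x1) = x1" using global_section[OF lift x1] by blast
  have conX: "connected (- (F -` L))"
    using connected_minus_preimage[OF open_UNIV connected_UNIV] by (simp add: Compl_eq_Diff_UNIV)
  have FX: "F \<in> - (F -` L) \<rightarrow> - L" by auto
  have \<sigma>c: "continuous_on (- L) \<sigma>" and F\<sigma>: "\<And>y. y \<in> - L \<Longrightarrow> F (\<sigma> y) = y"
    using \<sigma>(1) by (auto simp: section_on_def Compl_eq_Diff_UNIV)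
  \<comment> \<open>Composing \<open>F\<close> with the section and the identity are two lifts of
    \<open>F\<close> on a connected set, equal at \<open>x1\<close>.\<close>
  have inv: "\<sigma> (F x) = x" if x: "x \<in> - (F -` L)" for x
  proof (rule covering_space_lift_unique[OF F_covering, where f = F and T = "- (F -` L)" and a = x1
        and ?g1.0 = "\<lambda>x. \<sigma> (F x)" and ?g2.0 = "\<lambda>x. x"])
    show "continuous_on (- (F -` L)) (\<lambda>x. \<sigma> (F x))"
      by (rule continuous_on_compose2[OF \<sigma>c F_cont]) auto
    show "(\<lambda>x. \<sigma> (F x)) \<in> - (F -` L) \<rightarrow> - (F -` L)" using F\<sigma> by auto
    show "F x = F (\<sigma> (F x))" if "x \<in> - (F -` L)" for x using F\<sigma> that by auto
  qed (use \<sigma>(2) x1 x FX conX F_cont in auto)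
  \<comment> \<open>Injectivity passes to the points over \<open>L\<close>: the images of two
    disjoint neighbourhoods would overlap in an open set, which contains points off
    \<open>L\<close>.\<close>
  have inj: "x = y" if eq: "F x = F y" for x y
  proof (rule ccontr)
    assume "x \<noteq> y"
    then obtain A B where AB: "open A" "open B" "x \<in> A" "y \<in> B" "A \<inter> B = {}" using hausdorff by metis
    have "open (F ` A \<inter> F ` B)" by (intro open_Int F_open AB)
    moreover have "F x \<in> F ` A \<inter> F ` B" using AB(3,4) eq by (metis IntI imageI)
    ultimately have "F ` A \<inter> F ` B - L \<noteq> {}" by (intro open_minus_line_nonempty) auto
    then obtain a b where ab: "a \<in> A" "b \<in> B" "F a = F b" "F a \<notin> L" by blast
    have "\<sigma> (F a) = a" "\<sigma> (F b) = b" by (rule inv, use ab(3,4) in simp)+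
    then have "a = b" using ab(3) by metis
    then show False using ab AB(5) by blast
  qed
  \<comment> \<open>\<open>F x0\<close> is both a value and a limit along an unbounded sequence. The
    images enter the open image of a ball about \<open>x0\<close>, so by injectivity the sequence
    itself enters the ball.\<close>
  obtain s where s: "\<not> bounded (range s)" "(\<lambda>k. F (s k)) \<longlonglongrightarrow> F x0"
    using x0 nonproper unfolding nonproper_set_def by blast
  have "open (F ` ball x0 1)" by (intro F_open) auto
  moreover have "F x0 \<in> F ` ball x0 1" by simp
  ultimately have "eventually (\<lambda>k. F (s k) \<in> F ` ball x0 1) sequentially" using s(2) by (rule topological_tendstoD[rotated])
  then obtain N where N: "\<And>k. k \<ge> N \<Longrightarrow> F (s k) \<in> F ` ball x0 1" by (auto simp: eventually_sequentially)
  have "s ` {N..} \<subseteq> ball x0 1"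
  proof (rule image_subsetI)
    fix k assume "k \<in> {N..}"
    then obtain z where "z \<in> ball x0 1" "F (s k) = F z" using N[of k] by auto
    then show "s k \<in> ball x0 1" using inj by metis
  qed
  then have "bounded (s ` {N..})" using bounded_ball bounded_subset by blast
  moreover have "range s = s ` {..<N} \<union> s ` {N..}"
  proof -
    have "(UNIV :: nat set) = {..<N} \<union> {N..}" by auto
    then show ?thesis by (metis image_Un)
  qed
  ultimately show False using s(1) by (simp add: finite_imp_bounded)
qed

end

section \<open>Local structure of semialgebraic lines\<close>

lemma semialgebraic_all_upd: "semialgebraic P \<Longrightarrow> semialgebraic (\<lambda>e. \<forall>x. P (e(i := x)))"
  using semialgebraic_not[OF semialgebraic_ex_upd[OF semialgebraic_not, of P i]] by simp

lemma mpoly_fun_subst: "p \<in> mpoly_fun \<Longrightarrow> (\<And>i. g i \<in> mpoly_fun) \<Longrightarrow> (\<lambda>e. p (\<lambda>i. g i e)) \<in> mpoly_fun"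
  by (induction rule: mpoly_fun.induct) (simp_all add: mpoly_fun.const mpoly_fun.add mpoly_fun.mult)

lemma semialgebraic_subst:
  assumes "semialgebraic P" "\<And>i. g i \<in> mpoly_fun"
  shows "semialgebraic (\<lambda>e. P (\<lambda>i. g i e))"
proof -
  obtain Q where Q: "finite Q" "Q \<subseteq> mpoly_fun" "\<And>e e'. (\<forall>q\<in>Q. sgn (q e) = sgn (q e')) \<Longrightarrow> P e = P e'"
    using assms(1) unfolding semialgebraic_def by blast
  show ?thesis unfolding semialgebraic_def
  proof (intro exI[of _ "(\<lambda>q e. q (\<lambda>i. g i e)) ` Q"] conjI allI impI)
    show "(\<lambda>q e. q (\<lambda>i. g i e)) ` Q \<subseteq> mpoly_fun" using Q(2) mpoly_fun_subst assms(2) by blast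
    fix e e'
    assume "\<forall>r\<in>(\<lambda>q e. q (\<lambda>i. g i e)) ` Q. sgn (r e) = sgn (r e')"
    then show "P (\<lambda>i. g i e) = P (\<lambda>i. g i e')" by (intro Q(3)) simp
  qed (use Q in simp)
qed

lemma poly_fun3_mpoly_fun:
  assumes "p \<in> poly_fun3" "f \<in> mpoly_fun" "g \<in> mpoly_fun" "h \<in> mpoly_fun"
  shows "(\<lambda>e. p (vector [f e, g e, h e])) \<in> mpoly_fun"
  using assms(1)
proof induction
  case (coord i)
  show ?case using assms exhaust_3[of i] by (elim disjE) auto
qed (auto intro: mpoly_fun.const mpoly_fun.add mpoly_fun.mult)

lemma mpoly_fun_dist2:
  assumes "\<And>i. (\<lambda>e. x e $ i) \<in> mpoly_fun" "\<And>i. (\<lambda>e. y e $ i) \<in> mpoly_fun"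
  shows "(\<lambda>e. (norm (x e - y e :: real^3))\<^sup>2) \<in> mpoly_fun"
proof -
  have "(norm (x e - y e))\<^sup>2 = (\<Sum>i\<in>UNIV. (x e $ i - y e $ i) * (x e $ i - y e $ i))" for e
    by (simp add: power2_norm_eq_inner inner_vec_def)
  then show ?thesis by (auto intro!: mpoly_fun_sum mpoly_fun.mult mpoly_fun_diff assms)
qed

lemma mpoly_fun_vector3:
  "f \<in> mpoly_fun \<Longrightarrow> g \<in> mpoly_fun \<Longrightarrow> h \<in> mpoly_fun \<Longrightarrow> (\<lambda>e. vector [f e, g e, h e] $ (i::3)) \<in> mpoly_fun"
  using exhaust_3[of i] by (elim disjE) auto

lemma vector3_eta: "vector [z $ 1, z $ 2, z $ 3] = (z :: real^3)"
  by (simp add: vec_eq_iff forall_3)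

lemma ex_vector3: "(\<exists>x y z. P (vector [x, y, z] :: real^3)) \<longleftrightarrow> (\<exists>v. P v)"
  by (metis vector3_eta)

lemma all_vector3: "(\<forall>x y z. P (vector [x, y, z] :: real^3)) \<longleftrightarrow> (\<forall>v. P v)"
  by (metis vector3_eta)

section \<open>The non-properness set is semialgebraic\<close>

text \<open>The sequence is traded for quantifiers over reals and points, and squared norms make the
  inequalities polynomial in the coordinates.\<close>

lemma nonproper_set_iff:
  fixes F :: "'a::real_normed_vector \<Rightarrow> 'b::real_normed_vector"
  shows "y \<in> nonproper_set F \<longleftrightarrow> (\<forall>\<epsilon>>0. \<forall>R. \<exists>x. R < (norm x)\<^sup>2 \<and> (norm (F x - y))\<^sup>2 < \<epsilon>)"
proof
  assume "y \<in> nonproper_set F"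
  then obtain x :: "nat \<Rightarrow> 'a" where x: "\<not> bounded (range x)" "(\<lambda>k. F (x k)) \<longlonglongrightarrow> y"
    by (auto simp: nonproper_set_def)
  show "\<forall>\<epsilon>>0. \<forall>R. \<exists>x. R < (norm x)\<^sup>2 \<and> (norm (F x - y))\<^sup>2 < \<epsilon>"
  proof (intro allI impI)
    fix \<epsilon> R :: real assume "0 < \<epsilon>"
    then obtain N where N: "\<And>k. k \<ge> N \<Longrightarrow> norm (F (x k) - y) < sqrt \<epsilon>"
      using LIMSEQ_D[OF x(2), of "sqrt \<epsilon>"] by auto
    have "\<exists>k\<ge>N. R < (norm (x k))\<^sup>2"
    proof (rule ccontr)
      assume "\<not> ?thesis"
      then have le: "(norm (x k))\<^sup>2 \<le> R" if "k \<ge> N" for k using that by force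
      have "norm (x k) \<le> sqrt \<bar>R\<bar>" if "k \<ge> N" for k
        by (rule real_le_rsqrt) (use le[OF that] in linarith)
      then have "bounded (x ` {N..})" unfolding bounded_iff by force
      moreover have "range x = x ` {..<N} \<union> x ` {N..}"
      proof -
        have "(UNIV :: nat set) = {..<N} \<union> {N..}" by auto
        then show ?thesis by (metis image_Un)
      qed
      ultimately show False using x(1) by (simp add: finite_imp_bounded)
    qed
    then obtain k where k: "k \<ge> N" "R < (norm (x k))\<^sup>2" by blast
    have "(norm (F (x k) - y))\<^sup>2 < (sqrt \<epsilon>)\<^sup>2" using N[OF k(1)] by (intro power_strict_mono) auto
    then show "\<exists>x. R < (norm x)\<^sup>2 \<and> (norm (F x - y))\<^sup>2 < \<epsilon>" using k \<open>0 < \<epsilon>\<close> by auto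
  qed
next
  assume *: "\<forall>\<epsilon>>0. \<forall>R. \<exists>x. R < (norm x)\<^sup>2 \<and> (norm (F x - y))\<^sup>2 < \<epsilon>"
  have "\<exists>x. (real k)\<^sup>2 < (norm x)\<^sup>2 \<and> (norm (F x - y))\<^sup>2 < (1 / (real k + 1))\<^sup>2" for k
    by (rule *[rule_format]) auto
  then obtain x where x: "\<And>k. (real k)\<^sup>2 < (norm (x k))\<^sup>2" "\<And>k. (norm (F (x k) - y))\<^sup>2 < (1 / (real k + 1))\<^sup>2"
    by metis
  have xk: "real k < norm (x k)" for k using x(1)[of k] by (rule power2_less_imp_less) simp
  have "\<not> bounded (range x)"
  proof
    assume "bounded (range x)"
    then obtain B where "\<And>k. norm (x k) \<le> B" by (auto simp: bounded_iff)
    then show False using xk reals_Archimedean2[of B] by (meson less_le_not_le less_trans order_less_le_trans)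
  qed
  moreover have "(\<lambda>k. F (x k)) \<longlonglongrightarrow> y"
  proof (rule LIM_zero_cancel, rule Lim_null_comparison)
    have "norm (F (x k) - y) \<le> 1 / (real k + 1)" for k
      by (rule less_imp_le, rule power2_less_imp_less[OF x(2)]) simp
    then show "\<forall>\<^sub>F k in sequentially. norm (F (x k) - y) \<le> inverse (real (Suc k))" 
      by (simp add: inverse_eq_divide add.commute)
    show "(\<lambda>k. inverse (real (Suc k))) \<longlonglongrightarrow> 0" by (rule LIMSEQ_inverse_real_of_nat)
  qed
  ultimately show "y \<in> nonproper_set F" by (auto simp: nonproper_set_def)
qed

definition semialgebraic3 :: "(real^3) set \<Rightarrow> bool" where
  "semialgebraic3 S \<longleftrightarrow> semialgebraic (\<lambda>e. vector [e 0, e 1, e 2] \<in> S)"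

lemma semialgebraic3_mem:
  assumes "semialgebraic3 S" "f \<in> mpoly_fun" "g \<in> mpoly_fun" "h \<in> mpoly_fun"
  shows "semialgebraic (\<lambda>e. vector [f e, g e, h e] \<in> S)"
proof -
  let ?g = "\<lambda>i::nat. if i = 0 then f else if i = 1 then g else h"
  have "semialgebraic (\<lambda>e. vector [?g 0 e, ?g 1 e, ?g 2 e] \<in> S)"
    by (rule semialgebraic_subst[OF assms(1)[unfolded semialgebraic3_def], of ?g]) (use assms in auto)
  then show ?thesis by simp
qed

lemma semialgebraic3_nonproper_set:
  fixes F :: "real^3 \<Rightarrow> real^3"
  assumes "polynomial_map3 F"
  shows "semialgebraic3 (nonproper_set F)"
proof -
  define P where "P e \<longleftrightarrow> e 4 < (norm (vector [e 5, e 6, e 7] :: real^3))\<^sup>2 \<and>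
     (norm (F (vector [e 5, e 6, e 7]) - vector [e 0, e 1, e 2]))\<^sup>2 < e 3" for e :: "nat \<Rightarrow> real"
  have "(\<lambda>e. (norm (vector [e 5, e 6, e 7] - 0 :: real^3))\<^sup>2) \<in> mpoly_fun"
    by (rule mpoly_fun_dist2) (auto intro!: mpoly_fun_vector3 mpoly_fun.coord mpoly_fun.const)
  moreover have "(\<lambda>e. (norm (F (vector [e 5, e 6, e 7]) - vector [e 0, e 1, e 2]))\<^sup>2) \<in> mpoly_fun"
    by (rule mpoly_fun_dist2) 
      (use assms in \<open>auto intro!: mpoly_fun_vector3 mpoly_fun.coord poly_fun3_mpoly_fun simp: polynomial_map3_def\<close>)
  ultimately have "semialgebraic P" unfolding P_def
    by (intro semialgebraic_conj semialgebraic_less mpoly_fun.coord) simp_all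
  then have "semialgebraic (\<lambda>e. \<exists>x y z. P (e(5 := x, 6 := y, 7 := z)))"
    by (intro semialgebraic_ex_upd[of "\<lambda>e. \<exists>y z. P (e(6 := y, 7 := z))"]
          semialgebraic_ex_upd[of "\<lambda>e. \<exists>z. P (e(7 := z))"] semialgebraic_ex_upd[of P])
  then have "semialgebraic (\<lambda>e. \<forall>R. \<exists>x y z. P (e(4 := R, 5 := x, 6 := y, 7 := z)))"
    by (rule semialgebraic_all_upd)
  then have "semialgebraic (\<lambda>e. 0 < e 3 \<longrightarrow> (\<forall>R. \<exists>x y z. P (e(4 := R, 5 := x, 6 := y, 7 := z))))"
    by (intro semialgebraic_imp semialgebraic_less mpoly_fun.const mpoly_fun.coord)
  then have "semialgebraic (\<lambda>e. \<forall>\<epsilon>. 0 < (e(3 := \<epsilon>)) 3 \<longrightarrow> (\<forall>R. \<exists>x y z. P (e(3 := \<epsilon>, 4 := R, 5 := x, 6 := y, 7 := z))))"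
    by (rule semialgebraic_all_upd)
  then have "semialgebraic (\<lambda>e. \<forall>\<epsilon>>0. \<forall>R. \<exists>x y z. R < (norm (vector [x, y, z] :: real^3))\<^sup>2 \<and>
     (norm (F (vector [x, y, z]) - vector [e 0, e 1, e 2]))\<^sup>2 < \<epsilon>)"
    by (simp add: P_def)
  moreover have "(\<exists>x y z. R < (norm (vector [x, y, z] :: real^3))\<^sup>2 \<and>
     (norm (F (vector [x, y, z]) - u))\<^sup>2 < \<epsilon>) \<longleftrightarrow> (\<exists>x. R < (norm x)\<^sup>2 \<and> (norm (F x - u))\<^sup>2 < \<epsilon>)" for R \<epsilon> u
    by (rule ex_vector3)
  ultimately show ?thesis unfolding semialgebraic3_def nonproper_set_iff by simp
qed

definition extremal_radius :: "'a::real_normed_vector set \<Rightarrow> 'a \<Rightarrow> real \<Rightarrow> bool" where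
  "extremal_radius S c r \<longleftrightarrow> (\<exists>z\<in>S. norm (z - c) = r \<and> (\<exists>\<epsilon>>0.
     (\<forall>w\<in>S. (norm (w - z))\<^sup>2 < \<epsilon> \<longrightarrow> norm (w - c) \<le> r) \<or>
     (\<forall>w\<in>S. (norm (w - z))\<^sup>2 < \<epsilon> \<longrightarrow> r \<le> norm (w - c))))"

lemma semialgebraic_extremal_radius:
  fixes S :: "(real^3) set"
  assumes S: "semialgebraic3 S"
  shows "\<exists>P. semialgebraic P \<and> (\<forall>e r. 0 < r \<longrightarrow> P (e(0 := r)) = extremal_radius S c r)"
proof -
  define z w where "z e = (vector [e 1, e 2, e 3] :: real^3)" and "w e = (vector [e 5, e 6, e 7] :: real^3)"
    for e :: "nat \<Rightarrow> real"
  have zi: "(\<lambda>e. z e $ i) \<in> mpoly_fun" and wi: "(\<lambda>e. w e $ i) \<in> mpoly_fun" for i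
    unfolding z_def w_def by (auto intro!: mpoly_fun_vector3 mpoly_fun.coord)
  have d: "(\<lambda>e. (norm (z e - c))\<^sup>2) \<in> mpoly_fun" "(\<lambda>e. (norm (w e - c))\<^sup>2) \<in> mpoly_fun"
    "(\<lambda>e. (norm (w e - z e))\<^sup>2) \<in> mpoly_fun"
    by (auto intro!: mpoly_fun_dist2 zi wi mpoly_fun.const)
  have zw: "semialgebraic (\<lambda>e. z e \<in> S)" "semialgebraic (\<lambda>e. w e \<in> S)"
    unfolding z_def w_def by (auto intro!: semialgebraic3_mem[OF S] mpoly_fun.coord)
  have r2: "(\<lambda>e. (e 0)\<^sup>2) \<in> mpoly_fun" by (intro mpoly_fun_power mpoly_fun.coord)
  define A where "A e \<longleftrightarrow> (w e \<in> S \<longrightarrow> (norm (w e - z e))\<^sup>2 < e 4 \<longrightarrow> (norm (w e - c))\<^sup>2 \<le> (e 0)\<^sup>2)" for e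
  define B where "B e \<longleftrightarrow> (w e \<in> S \<longrightarrow> (norm (w e - z e))\<^sup>2 < e 4 \<longrightarrow> (e 0)\<^sup>2 \<le> (norm (w e - c))\<^sup>2)" for e
  have AB: "semialgebraic A" "semialgebraic B" unfolding A_def B_def
    by (intro semialgebraic_imp semialgebraic_less semialgebraic_le mpoly_fun.coord d r2 zw)+
  have all3: "semialgebraic (\<lambda>e. \<forall>x y z. Q (e(5 := x, 6 := y, 7 := z)))" if "semialgebraic Q" for Q
    using that by (intro semialgebraic_all_upd[of "\<lambda>e. \<forall>y z. Q (e(6 := y, 7 := z))"]
          semialgebraic_all_upd[of "\<lambda>e. \<forall>z. Q (e(7 := z))"] semialgebraic_all_upd[of Q])
  define C where "C e \<longleftrightarrow> 0 < e 4 \<and> ((\<forall>x y z. A (e(5 := x, 6 := y, 7 := z))) \<or> (\<forall>x y z. B (e(5 := x, 6 := y, 7 := z))))" for e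
  have C: "semialgebraic C" unfolding C_def
    by (intro semialgebraic_conj semialgebraic_disj semialgebraic_less mpoly_fun.coord mpoly_fun.const all3 AB)
  define D where "D e \<longleftrightarrow> z e \<in> S \<and> (norm (z e - c))\<^sup>2 = (e 0)\<^sup>2 \<and> (\<exists>\<epsilon>. C (e(4 := \<epsilon>)))" for e
  have D: "semialgebraic D" unfolding D_def
    by (intro semialgebraic_conj semialgebraic_eq semialgebraic_ex_upd d r2 zw C)
  have sa: "semialgebraic (\<lambda>e. \<exists>x y z. D (e(1 := x, 2 := y, 3 := z)))"
    using D by (intro semialgebraic_ex_upd[of "\<lambda>e. \<exists>y z. D (e(2 := y, 3 := z))"]
          semialgebraic_ex_upd[of "\<lambda>e. \<exists>z. D (e(3 := z))"] semialgebraic_ex_upd[of D])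
  have sq: "(norm (u :: real^3))\<^sup>2 \<le> r\<^sup>2 \<longleftrightarrow> norm u \<le> r" "r\<^sup>2 \<le> (norm u)\<^sup>2 \<longleftrightarrow> r \<le> norm u"
    "(norm u)\<^sup>2 = r\<^sup>2 \<longleftrightarrow> norm u = r" if "0 < r" for u and r :: real
    using that by (auto simp: power2_le_iff_abs_le abs_le_square_iff[symmetric] power2_eq_iff_nonneg)
  have "(\<exists>x y z. D ((e(0 := r))(1 := x, 2 := y, 3 := z))) = extremal_radius S c r" if r: "0 < r" for e r
  proof -
    have "(\<exists>x y z. D ((e(0 := r))(1 := x, 2 := y, 3 := z))) \<longleftrightarrow>
      (\<exists>x y z. vector [x, y, z] \<in> S \<and> norm (vector [x, y, z] - c) = r \<and> (\<exists>\<epsilon>>0.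
       (\<forall>x' y' z'. vector [x', y', z'] \<in> S \<longrightarrow> (norm (vector [x', y', z'] - vector [x, y, z] :: real^3))\<^sup>2 < \<epsilon> \<longrightarrow> norm (vector [x', y', z'] - c) \<le> r) \<or>
       (\<forall>x' y' z'. vector [x', y', z'] \<in> S \<longrightarrow> (norm (vector [x', y', z'] - vector [x, y, z] :: real^3))\<^sup>2 < \<epsilon> \<longrightarrow> r \<le> norm (vector [x', y', z'] - c))))"
      by (simp add: D_def C_def A_def B_def z_def w_def sq[OF r])
    also have "\<dots> \<longleftrightarrow> extremal_radius S c r"
    proof -
      have all: "(\<forall>x' y' z'. vector [x', y', z'] \<in> S \<longrightarrow> (norm (vector [x', y', z'] - v :: real^3))\<^sup>2 < \<epsilon> \<longrightarrow> norm (vector [x', y', z'] - c) \<le> r)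
          \<longleftrightarrow> (\<forall>w. w \<in> S \<longrightarrow> (norm (w - v))\<^sup>2 < \<epsilon> \<longrightarrow> norm (w - c) \<le> r)"
        "(\<forall>x' y' z'. vector [x', y', z'] \<in> S \<longrightarrow> (norm (vector [x', y', z'] - v :: real^3))\<^sup>2 < \<epsilon> \<longrightarrow> r \<le> norm (vector [x', y', z'] - c))
          \<longleftrightarrow> (\<forall>w. w \<in> S \<longrightarrow> (norm (w - v))\<^sup>2 < \<epsilon> \<longrightarrow> r \<le> norm (w - c))" for v \<epsilon>
        by (rule all_vector3)+
      show ?thesis unfolding extremal_radius_def Bex_def Ball_def all by (rule ex_vector3)
    qed
    finally show ?thesis .
  qed
  then show ?thesis using sa by blast
qed

lemma semialgebraic3_ray:
  assumes S: "semialgebraic3 S" and F: "F = at_top \<or> F = at_right 0"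
  shows "eventually (\<lambda>r. c + r *\<^sub>R v \<in> S) F \<or> eventually (\<lambda>r. c + r *\<^sub>R v \<notin> S) F"
proof -
  have "semialgebraic (\<lambda>e. vector [c $ 1 + e 0 * v $ 1, c $ 2 + e 0 * v $ 2, c $ 3 + e 0 * v $ 3] \<in> S)"
    by (intro semialgebraic3_mem[OF S] mpoly_fun.intros)
  from semialgebraic_eventually[OF this F, of "\<lambda>_. 0" 0] show ?thesis
    using vector3_eta[of "c + _ *\<^sub>R v"] by simp
qed

lemma countable_local_max_values:
  fixes f :: "real \<Rightarrow> real"
  shows "countable {v. \<exists>t. f t = v \<and> (\<exists>\<delta>>0. \<forall>s. \<bar>s - t\<bar> < \<delta> \<longrightarrow> f s \<le> v)}" (is "countable ?V")
proof -
  have "?V \<subseteq> (\<lambda>(p, q). Sup (f ` {p<..<q})) ` (\<rat> \<times> \<rat>)"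
  proof
    fix v assume "v \<in> ?V"
    then obtain t \<delta> where t: "f t = v" "0 < \<delta>" "\<And>s. \<bar>s - t\<bar> < \<delta> \<Longrightarrow> f s \<le> v" by blast
    obtain p where p: "p \<in> \<rat>" "t - \<delta> < p" "p < t" using Rats_dense_in_real[of "t - \<delta>" t] t(2) by auto
    obtain q where q: "q \<in> \<rat>" "t < q" "q < t + \<delta>" using Rats_dense_in_real[of t "t + \<delta>"] t(2) by auto
    have "Sup (f ` {p<..<q}) = v"
    proof (rule cSup_eq_maximum)
      show "v \<in> f ` {p<..<q}" using t p q by (intro image_eqI[of _ _ t]) auto
      fix x assume "x \<in> f ` {p<..<q}" then show "x \<le> v" using t(3) p q by (auto simp: abs_less_iff)
    qed
    then show "v \<in> (\<lambda>(p, q). Sup (f ` {p<..<q})) ` (\<rat> \<times> \<rat>)" using p q by force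
  qed
  moreover have "countable (\<rat> \<times> \<rat> :: (real \<times> real) set)" by (intro countable_SIGMA countable_rat)
  ultimately show ?thesis by (meson countable_image countable_subset)
qed

lemma countable_local_min_values:
  fixes f :: "real \<Rightarrow> real"
  shows "countable {v. \<exists>t. f t = v \<and> (\<exists>\<delta>>0. \<forall>s. \<bar>s - t\<bar> < \<delta> \<longrightarrow> v \<le> f s)}" (is "countable ?V")
proof -
  let ?W = "{v. \<exists>t. - f t = v \<and> (\<exists>\<delta>>0. \<forall>s. \<bar>s - t\<bar> < \<delta> \<longrightarrow> - f s \<le> v)}"
  have "?V \<subseteq> uminus ` ?W"
  proof
    fix v assume "v \<in> ?V"
    then have "- v \<in> ?W" by auto
    then show "v \<in> uminus ` ?W" by (rule image_eqI[rotated]) simp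
  qed
  moreover have "countable ?W" using countable_local_max_values[of "\<lambda>t. - f t"] .
  ultimately show ?thesis by (meson countable_image countable_subset)
qed

lemma countable_not_eventually:
  fixes D :: "real set"
  assumes "countable D" "F = at_top \<or> F = at_right 0"
  shows "\<not> eventually (\<lambda>r. r \<in> D) F"
proof
  assume ev: "eventually (\<lambda>r. r \<in> D) F"
  have "\<exists>a b. a < b \<and> {a<..<b} \<subseteq> D"
    using assms(2)
  proof
    assume "F = at_top"
    with ev obtain N where "\<forall>r\<ge>N. r \<in> D" by (auto simp: eventually_at_top_linorder)
    then show ?thesis by (intro exI[of _ N] exI[of _ "N + 1"]) auto
  next
    assume "F = at_right 0"
    with ev obtain b where "b > 0" "\<forall>r>0. r < b \<longrightarrow> r \<in> D" by (auto simp: eventually_at_right[of 0 1])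
    then show ?thesis by (intro exI[of _ 0] exI[of _ b]) auto
  qed
  then obtain a b where ab: "a < b" "{a<..<b} \<subseteq> D" by blast
  then have "countable {a<..<b}" using assms(1) countable_subset by blast
  then show False using ab(1) uncountable_open_interval[of a b] by simp
qed

lemma inj_on_no_local_extremum:
  fixes f :: "real \<Rightarrow> real"
  assumes J: "convex J" and f: "continuous_on J f"
    and max: "\<And>t. t \<in> J \<Longrightarrow> \<not> (\<exists>\<delta>>0. \<forall>s. \<bar>s - t\<bar> < \<delta> \<longrightarrow> f s \<le> f t)"
    and min: "\<And>t. t \<in> J \<Longrightarrow> \<not> (\<exists>\<delta>>0. \<forall>s. \<bar>s - t\<bar> < \<delta> \<longrightarrow> f t \<le> f s)"
  shows "inj_on f J"
proof -
  have False if xy: "x \<in> J" "y \<in> J" "x < y" "f x = f y" for x y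
  proof -
    have sub: "{x..y} \<subseteq> J"
      using closed_segment_subset[OF xy(1,2) J] closed_segment_eq_real_ivl[of x y] xy(3) by simp
    have c: "continuous_on {x..y} f" using f sub by (rule continuous_on_subset)
    obtain u where u: "u \<in> {x..y}" "\<And>s. s \<in> {x..y} \<Longrightarrow> f s \<le> f u"
      using continuous_attains_sup[OF compact_Icc _ c] xy by auto
    obtain w where w: "w \<in> {x..y}" "\<And>s. s \<in> {x..y} \<Longrightarrow> f w \<le> f s"
      using continuous_attains_inf[OF compact_Icc _ c] xy by auto
    have inside: "\<exists>\<delta>>0. \<forall>s. \<bar>s - t\<bar> < \<delta> \<longrightarrow> s \<in> {x..y}" if "x < t" "t < y" for t
      using that by (intro exI[of _ "min (t - x) (y - t)"]) (auto simp: abs_less_iff)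
    have "u = x \<or> u = y"
    proof (rule ccontr)
      assume "\<not> (u = x \<or> u = y)"
      then have "x < u" "u < y" using u by auto
      from inside[OF this] show False using max[of u] u sub by blast
    qed
    moreover have "w = x \<or> w = y"
    proof (rule ccontr)
      assume "\<not> (w = x \<or> w = y)"
      then have "x < w" "w < y" using w by auto
      from inside[OF this] show False using min[of w] w sub by blast
    qed
    ultimately have const: "f s \<le> f x" "f x \<le> f s" if "s \<in> {x..y}" for s using u(2)[OF that] w(2)[OF that] xy(4) by auto
    define m where "m = (x + y) / 2"
    have m: "x < m" "m < y" using xy by (auto simp: m_def)
    obtain \<delta> where "\<delta> > 0" "\<And>s. \<bar>s - m\<bar> < \<delta> \<Longrightarrow> s \<in> {x..y}" using inside[OF m] by blast
    moreover have "m \<in> {x..y}" using m by auto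
    ultimately have "\<exists>\<delta>>0. \<forall>s. \<bar>s - m\<bar> < \<delta> \<longrightarrow> f s \<le> f m"
      using const by (meson order_trans)
    then show False using max[of m] sub \<open>m \<in> {x..y}\<close> by blast
  qed
  then show ?thesis by (metis inj_onI linorder_neqE_linordered_idom)
qed

text \<open>Countably many extremal radii, and a semialgebraic set of them: so there are none near \<open>0\<close> or
  infinity.\<close>
lemma extremal_radius_param:
  fixes l :: "real \<Rightarrow> 'a::real_normed_vector"
  assumes hom: "homeomorphism UNIV L l h"
  shows "countable {r. extremal_radius L c r}"
    and "0 < \<delta> \<Longrightarrow> (\<forall>s. \<bar>s - t\<bar> < \<delta> \<longrightarrow> norm (l s - c) \<le> norm (l t - c)) \<Longrightarrow> extremal_radius L c (norm (l t - c))"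
    and "0 < \<delta> \<Longrightarrow> (\<forall>s. \<bar>s - t\<bar> < \<delta> \<longrightarrow> norm (l t - c) \<le> norm (l s - c)) \<Longrightarrow> extremal_radius L c (norm (l t - c))"
proof -
  have lL: "l t \<in> L" "h (l t) = t" for t using hom by (auto simp: homeomorphism_def)
  have hL: "l (h w) = w" if "w \<in> L" for w using hom that by (auto simp: homeomorphism_def)
  have lc: "continuous_on UNIV l" and hc: "continuous_on L h" using hom by (auto simp: homeomorphism_def)
  have near: "\<exists>\<epsilon>>0. \<forall>w\<in>L. (norm (w - l t))\<^sup>2 < \<epsilon> \<longrightarrow> \<bar>h w - t\<bar> < \<delta>" if pos: "0 < \<delta>" for \<delta> t
  proof -
    obtain d where d: "d > 0" "\<And>w. w \<in> L \<Longrightarrow> dist w (l t) < d \<Longrightarrow> dist (h w) (h (l t)) < \<delta>"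
      using hc lL(1)[of t] pos unfolding continuous_on_iff by blast
    have "\<bar>h w - t\<bar> < \<delta>" if "w \<in> L" "(norm (w - l t))\<^sup>2 < d\<^sup>2" for w
    proof -
      have "norm (w - l t) < d" using that(2) d(1) by (simp add: power2_less_imp_less)
      then show ?thesis using d(2)[OF that(1)] lL(2) by (simp add: dist_norm)
    qed
    then show ?thesis using d(1) by (intro exI[of _ "d\<^sup>2"]) auto
  qed
  show "extremal_radius L c (norm (l t - c))"
    if pos: "0 < \<delta>" and all: "\<forall>s. \<bar>s - t\<bar> < \<delta> \<longrightarrow> norm (l s - c) \<le> norm (l t - c)" for \<delta> t
  proof -
    obtain \<epsilon> where e: "\<epsilon> > 0" "\<And>w. w \<in> L \<Longrightarrow> (norm (w - l t))\<^sup>2 < \<epsilon> \<Longrightarrow> \<bar>h w - t\<bar> < \<delta>" using near[OF pos] by blast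
    have "\<forall>w\<in>L. (norm (w - l t))\<^sup>2 < \<epsilon> \<longrightarrow> norm (w - c) \<le> norm (l t - c)" using e(2) all hL by metis
    then show ?thesis unfolding extremal_radius_def using lL(1) e(1) by blast
  qed
  show "extremal_radius L c (norm (l t - c))"
    if pos: "0 < \<delta>" and all: "\<forall>s. \<bar>s - t\<bar> < \<delta> \<longrightarrow> norm (l t - c) \<le> norm (l s - c)" for \<delta> t
  proof -
    obtain \<epsilon> where e: "\<epsilon> > 0" "\<And>w. w \<in> L \<Longrightarrow> (norm (w - l t))\<^sup>2 < \<epsilon> \<Longrightarrow> \<bar>h w - t\<bar> < \<delta>" using near[OF pos] by blast
    have "\<forall>w\<in>L. (norm (w - l t))\<^sup>2 < \<epsilon> \<longrightarrow> norm (l t - c) \<le> norm (w - c)" using e(2) all hL by metis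
    then show ?thesis unfolding extremal_radius_def using lL(1) e(1) by blast
  qed
  have "{r. extremal_radius L c r} \<subseteq> 
     {v. \<exists>t. norm (l t - c) = v \<and> (\<exists>\<delta>>0. \<forall>s. \<bar>s - t\<bar> < \<delta> \<longrightarrow> norm (l s - c) \<le> v)} \<union>
     {v. \<exists>t. norm (l t - c) = v \<and> (\<exists>\<delta>>0. \<forall>s. \<bar>s - t\<bar> < \<delta> \<longrightarrow> v \<le> norm (l s - c))}"
  proof clarify
    fix r assume ext: "extremal_radius L c r"
      and no: "\<not> (\<exists>t. norm (l t - c) = r \<and> (\<exists>\<delta>>0. \<forall>s. \<bar>s - t\<bar> < \<delta> \<longrightarrow> r \<le> norm (l s - c)))"
    obtain z \<epsilon> where z: "z \<in> L" "norm (z - c) = r" "0 < \<epsilon>"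
      "(\<forall>w\<in>L. (norm (w - z))\<^sup>2 < \<epsilon> \<longrightarrow> norm (w - c) \<le> r) \<or> (\<forall>w\<in>L. (norm (w - z))\<^sup>2 < \<epsilon> \<longrightarrow> r \<le> norm (w - c))"
      using ext unfolding extremal_radius_def by blast
    obtain \<delta> where d: "\<delta> > 0" "\<And>s. dist s (h z) < \<delta> \<Longrightarrow> dist (l s) (l (h z)) < sqrt \<epsilon>"
      using lc z(3) unfolding continuous_on_iff by (metis UNIV_I real_sqrt_gt_zero)
    have "(norm (l s - z))\<^sup>2 < \<epsilon>" if "\<bar>s - h z\<bar> < \<delta>" for s
    proof -
      have "norm (l s - z) < sqrt \<epsilon>" using d(2)[of s] that hL[OF z(1)] by (simp add: dist_norm)
      then have "(norm (l s - z))\<^sup>2 < (sqrt \<epsilon>)\<^sup>2" by (intro power_strict_mono) auto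
      then show ?thesis using z(3) by simp
    qed
    then have "(\<forall>s. \<bar>s - h z\<bar> < \<delta> \<longrightarrow> norm (l s - c) \<le> r) \<or> (\<forall>s. \<bar>s - h z\<bar> < \<delta> \<longrightarrow> r \<le> norm (l s - c))"
      using z(4) lL(1) by blast
    then show "\<exists>t. norm (l t - c) = r \<and> (\<exists>\<delta>>0. \<forall>s. \<bar>s - t\<bar> < \<delta> \<longrightarrow> norm (l s - c) \<le> r)"
      using no d(1) z(2) hL[OF z(1)] by metis
  qed
  then show "countable {r. extremal_radius L c r}"
    using countable_local_max_values[of "\<lambda>t. norm (l t - c)"] countable_local_min_values[of "\<lambda>t. norm (l t - c)"]
    by (meson countable_Un countable_subset)
qed

lemma two_curves_of_branches:
  fixes l :: "real \<Rightarrow> 'a::real_normed_vector"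
  assumes hom: "homeomorphism UNIV L l h" and J: "convex J1" "convex J2" "J1 \<inter> J2 = {}"
    and inj: "inj_on (\<lambda>t. norm (l t - c)) J1" "inj_on (\<lambda>t. norm (l t - c)) J2"
    and I: "I \<subseteq> (\<lambda>t. norm (l t - c)) ` J1" "I \<subseteq> (\<lambda>t. norm (l t - c)) ` J2" "\<And>r. r \<in> I \<Longrightarrow> 0 < r"
    and J12: "\<And>t. norm (l t - c) \<in> I \<Longrightarrow> t \<in> J1 \<union> J2"
    and v: "norm v = 1" "\<And>r. r \<in> I \<Longrightarrow> c + r *\<^sub>R v \<notin> L"
  shows "\<exists>a b. two_curves L c I a b v"
proof -
  define \<rho> where "\<rho> t = norm (l t - c)" for t
  have lL: "l t \<in> L" "h (l t) = t" for t using hom by (auto simp: homeomorphism_def)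
  have Lim: "L = range l" using hom by (auto simp: homeomorphism_def)
  have lc: "continuous_on S l" for S using hom by (meson continuous_on_subset homeomorphism_def subset_UNIV)
  have \<rho>c: "continuous_on S \<rho>" for S unfolding \<rho>_def by (intro continuous_intros lc)
  have "\<exists>g. homeomorphism J (\<rho> ` J) \<rho> g" if "convex J" "inj_on \<rho> J" for J
    by (rule homeomorphism_into_1d[OF _ \<rho>c refl]) (use that in \<open>auto simp: convex_imp_path_connected\<close>)
  from this[OF J(1) inj(1)[folded \<rho>_def]] this[OF J(2) inj(2)[folded \<rho>_def]]
  obtain g1 g2 where g: "homeomorphism J1 (\<rho> ` J1) \<rho> g1" "homeomorphism J2 (\<rho> ` J2) \<rho> g2"
    by blast
  have I': "I \<subseteq> \<rho> ` J1" "I \<subseteq> \<rho> ` J2" using I by (auto simp: \<rho>_def)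
  have gc: "continuous_on I g1" "continuous_on I g2"
    using g I' by (meson continuous_on_subset homeomorphism_def)+
  have g\<rho>: "g1 (\<rho> t) = t" if "t \<in> J1" for t by (rule homeomorphism_apply1[OF g(1) that])
  have g\<rho>2: "g2 (\<rho> t) = t" if "t \<in> J2" for t by (rule homeomorphism_apply1[OF g(2) that])
  have gJ: "g1 r \<in> J1" "g2 r \<in> J2" "\<rho> (g1 r) = r" "\<rho> (g2 r) = r" if r: "r \<in> I" for r
  proof -
    obtain t1 t2 where "t1 \<in> J1" "r = \<rho> t1" "t2 \<in> J2" "r = \<rho> t2" using I' r by blast
    then show "g1 r \<in> J1" "g2 r \<in> J2" "\<rho> (g1 r) = r" "\<rho> (g2 r) = r" using g\<rho> g\<rho>2 by metis+
  qed
  define a where "a r = (l (g1 r) - c) /\<^sub>R r" for r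
  define b where "b r = (l (g2 r) - c) /\<^sub>R r" for r
  have ca: "c + r *\<^sub>R a r = l (g1 r)" and cb: "c + r *\<^sub>R b r = l (g2 r)" if "r \<in> I" for r
    using I(3)[OF that] by (simp_all add: a_def b_def)
  have na: "norm (a r) = 1" and nb: "norm (b r) = 1" if "r \<in> I" for r
    using I(3)[OF that] gJ(3,4)[OF that] by (simp_all add: a_def b_def \<rho>_def)
  have lc': "continuous_on I (\<lambda>r. l (g1 r))" "continuous_on I (\<lambda>r. l (g2 r))"
    by (auto intro!: continuous_on_compose2[OF lc[of UNIV]] gc)
  have cont: "continuous_on I a" "continuous_on I b" unfolding a_def b_def
    by (intro continuous_intros lc'; use I(3) in force)+
  have neq: "a r \<noteq> b r" if "r \<in> I" for r
  proof
    assume "a r = b r"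
    then have "g1 r = g2 r" using ca[OF that] cb[OF that] lL(2) by metis
    then show False using gJ(1,2)[OF that] J(3) by auto
  qed
  have miss: "a r \<noteq> v" "b r \<noteq> v" if "r \<in> I" for r
    using ca[OF that] cb[OF that] v(2)[OF that] lL(1) by metis+
  have Leq: "L \<inter> shell c I = (\<lambda>r. c + r *\<^sub>R a r) ` I \<union> (\<lambda>r. c + r *\<^sub>R b r) ` I"
  proof (intro equalityI subsetI)
    fix z assume "z \<in> L \<inter> shell c I"
    then obtain t where t: "z = l t" "\<rho> t \<in> I" by (auto simp: Lim shell_def \<rho>_def)
    then have "t \<in> J1 \<or> t \<in> J2" using J12 by (auto simp: \<rho>_def)
    then have "z = c + \<rho> t *\<^sub>R a (\<rho> t) \<or> z = c + \<rho> t *\<^sub>R b (\<rho> t)"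
      using ca[OF t(2)] cb[OF t(2)] g\<rho> g\<rho>2 t(1) by auto
    then show "z \<in> (\<lambda>r. c + r *\<^sub>R a r) ` I \<union> (\<lambda>r. c + r *\<^sub>R b r) ` I" using t(2) by blast
  next
    fix z assume "z \<in> (\<lambda>r. c + r *\<^sub>R a r) ` I \<union> (\<lambda>r. c + r *\<^sub>R b r) ` I"
    then obtain r where r: "r \<in> I" "z = l (g1 r) \<or> z = l (g2 r)" using ca cb by auto
    then have "norm (z - c) = r" using gJ(3,4)[OF r(1)] by (auto simp: \<rho>_def)
    moreover have "z \<in> L" using r(2) lL(1) by metis
    ultimately show "z \<in> L \<inter> shell c I" using r(1) by (simp add: shell_def)
  qed
  have "two_curves L c I a b v"
    unfolding two_curves_def using cont neq miss Leq na nb v(1) I(3) by simp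
  then show ?thesis by blast
qed

lemma ex_missed_direction:
  fixes c :: "'a::euclidean_space"
  assumes dim: "2 \<le> DIM('a)"
    and ray: "\<And>v. eventually (\<lambda>r. c + r *\<^sub>R v \<in> L) F \<or> eventually (\<lambda>r. c + r *\<^sub>R v \<notin> L) F"
    and F: "F \<noteq> bot"
    and two: "eventually (\<lambda>r. \<exists>p q. \<forall>v. norm v = 1 \<longrightarrow> c + r *\<^sub>R v \<in> L \<longrightarrow> v = p \<or> v = q) F"
  shows "\<exists>v. norm v = 1 \<and> eventually (\<lambda>r. c + r *\<^sub>R v \<notin> L) F"
proof (rule ccontr)
  assume no: "\<not> ?thesis"
  then have all: "eventually (\<lambda>r. c + r *\<^sub>R v \<in> L) F" if "norm v = 1" for v using ray that by blast
  obtain i j :: 'a where ij: "i \<in> Basis" "j \<in> Basis" "i \<noteq> j"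
    using dim that card_le_Suc0_iff_eq[of "Basis :: 'a set"] by fastforce
  have "eventually (\<lambda>r. c + r *\<^sub>R i \<in> L \<and> c + r *\<^sub>R j \<in> L \<and> c + r *\<^sub>R (- i) \<in> L \<and>
      (\<exists>p q. \<forall>v. norm v = 1 \<longrightarrow> c + r *\<^sub>R v \<in> L \<longrightarrow> v = p \<or> v = q)) F"
    by (intro eventually_conj all two) (use ij in auto)
  then obtain r where r: "c + r *\<^sub>R i \<in> L" "c + r *\<^sub>R j \<in> L" "c + r *\<^sub>R (- i) \<in> L"
      "\<exists>p q. \<forall>v. norm v = 1 \<longrightarrow> c + r *\<^sub>R v \<in> L \<longrightarrow> v = p \<or> v = q"
    using eventually_happens'[OF F] by blast
  have "i \<bullet> i = 1" "j \<bullet> i = 0" using ij by (auto simp: inner_not_same_Basis)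
  then have "i \<noteq> - i" "j \<noteq> - i" by (metis inner_minus_left one_neq_neg_one neg_equal_0_iff_equal zero_neq_one)+
  moreover obtain p q where "\<And>v. norm v = 1 \<Longrightarrow> c + r *\<^sub>R v \<in> L \<Longrightarrow> v = p \<or> v = q" using r(4) by blast
  then have "i = p \<or> i = q" "j = p \<or> j = q" "- i = p \<or> - i = q" using ij r(1-3) by (metis norm_Basis norm_minus_cancel)+
  ultimately show False using ij(3) by metis
qed

lemma branches_two_points:
  fixes l :: "real \<Rightarrow> 'a::real_normed_vector"
  assumes hom: "homeomorphism UNIV L l h"
    and inj: "inj_on (\<lambda>t. norm (l t - c)) J1" "inj_on (\<lambda>t. norm (l t - c)) J2"
    and J12: "\<And>t. norm (l t - c) \<in> I \<Longrightarrow> t \<in> J1 \<union> J2" and r: "r \<in> I" "0 < r"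
  shows "\<exists>p q. \<forall>u. norm u = 1 \<longrightarrow> c + r *\<^sub>R u \<in> L \<longrightarrow> u = p \<or> u = q"
proof -
  have "\<exists>p. \<forall>u t. norm u = 1 \<longrightarrow> c + r *\<^sub>R u = l t \<longrightarrow> t \<in> J \<longrightarrow> u = p"
    if inj: "inj_on (\<lambda>t. norm (l t - c)) J" for J
  proof (cases "\<exists>u t. norm u = 1 \<and> c + r *\<^sub>R u = l t \<and> t \<in> J")
    case True
    then obtain p s where p: "norm p = 1" "c + r *\<^sub>R p = l s" "s \<in> J" by blast
    have "u = p" if u: "norm u = 1" "c + r *\<^sub>R u = l t" "t \<in> J" for u t
    proof -
      have "norm (l t - c) = norm (l s - c)" using p u by (metis add_diff_cancel_left' norm_scaleR)
      then have "t = s" using inj_onD[OF inj] p(3) u(3) by blast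
      then have "c + r *\<^sub>R u = c + r *\<^sub>R p" using p(2) u(2) by simp
      then show ?thesis using r by simp
    qed
    then show ?thesis by blast
  qed blast
  then obtain p q where pq: "\<And>u t. norm u = 1 \<Longrightarrow> c + r *\<^sub>R u = l t \<Longrightarrow> t \<in> J1 \<Longrightarrow> u = p"
    "\<And>u t. norm u = 1 \<Longrightarrow> c + r *\<^sub>R u = l t \<Longrightarrow> t \<in> J2 \<Longrightarrow> u = q" using inj by meson
  have "u = p \<or> u = q" if u: "norm u = 1" "c + r *\<^sub>R u \<in> L" for u
  proof -
    have "c + r *\<^sub>R u \<in> range l" using hom u(2) by (simp add: homeomorphism_def)
    then obtain t where t: "c + r *\<^sub>R u = l t" by blast
    then have "norm (l t - c) = r" using u(1) r(2) by (metis abs_of_pos add_diff_cancel_left' mult.right_neutral norm_scaleR)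
    then show ?thesis using J12[of t] r(1) pq[OF u(1) t] by blast
  qed
  then show ?thesis by blast
qed

lemma line_two_curves_near:
  fixes l :: "real \<Rightarrow> 'a::euclidean_space"
  assumes dim: "2 \<le> DIM('a)" and hom: "homeomorphism UNIV L l h" and cl: "closed L" and c: "c \<in> L"
    and ext: "eventually (\<lambda>r. \<not> extremal_radius L c r) (at_right 0)"
    and ray: "\<And>v. eventually (\<lambda>r. c + r *\<^sub>R v \<in> L) (at_right 0) \<or> eventually (\<lambda>r. c + r *\<^sub>R v \<notin> L) (at_right 0)"
  shows "\<exists>r>0. \<exists>a b v. two_curves L c {0<..<r} a b v"
proof -
  define \<rho> where "\<rho> t = norm (l t - c)" for t
  obtain r0 where r0: "r0 > 0" "\<And>r. 0 < r \<Longrightarrow> r < r0 \<Longrightarrow> \<not> extremal_radius L c r"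
    using ext by (auto simp: eventually_at_right[of 0 1])
  have lL: "l t \<in> L" "h (l t) = t" for t using hom by (auto simp: homeomorphism_def)
  have lc: "continuous_on S l" for S using hom by (meson continuous_on_subset homeomorphism_def subset_UNIV)
  have \<rho>c: "continuous_on S \<rho>" for S unfolding \<rho>_def by (intro continuous_intros lc)
  define t0 where "t0 = h c"
  have lt0: "l t0 = c" using hom c by (auto simp: homeomorphism_def t0_def)
  have \<rho>0: "\<rho> t0 = 0" by (simp add: \<rho>_def lt0)
  have \<rho>pos: "0 < \<rho> t" if "t \<noteq> t0" for t
    using that lL(2) lt0 by (metis \<rho>_def right_minus_eq zero_less_norm_iff)
  obtain \<eta> where \<eta>: "\<eta> > 0" "\<And>t. \<bar>t - t0\<bar> < 2 * \<eta> \<Longrightarrow> \<rho> t < r0"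
  proof -
    obtain d where d: "d > 0" "\<And>t. dist t t0 < d \<Longrightarrow> dist (\<rho> t) (\<rho> t0) < r0"
      using \<rho>c[of UNIV] r0(1) unfolding continuous_on_iff by (metis UNIV_I)
    have "\<rho> t < r0" if "\<bar>t - t0\<bar> < d" for t using d(2)[of t] that \<rho>0 by (simp add: dist_real_def)
    then show ?thesis using that[of "d / 2"] d(1) by simp
  qed
  define J1 where "J1 = {t0<..<t0 + \<eta>}"
  define J2 where "J2 = {t0 - \<eta><..<t0}"
  have noext: "\<not> (\<exists>\<delta>>0. \<forall>s. \<bar>s - t\<bar> < \<delta> \<longrightarrow> \<rho> s \<le> \<rho> t)" "\<not> (\<exists>\<delta>>0. \<forall>s. \<bar>s - t\<bar> < \<delta> \<longrightarrow> \<rho> t \<le> \<rho> s)"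
    if "t \<in> J1 \<union> J2" for t
  proof -
    have "0 < \<rho> t" "\<rho> t < r0" using that \<rho>pos \<eta> by (auto simp: J1_def J2_def)
    then have "\<not> extremal_radius L c (norm (l t - c))" using r0(2) by (simp add: \<rho>_def)
    then show "\<not> (\<exists>\<delta>>0. \<forall>s. \<bar>s - t\<bar> < \<delta> \<longrightarrow> \<rho> s \<le> \<rho> t)" "\<not> (\<exists>\<delta>>0. \<forall>s. \<bar>s - t\<bar> < \<delta> \<longrightarrow> \<rho> t \<le> \<rho> s)"
      using extremal_radius_param(2,3)[OF hom] unfolding \<rho>_def by blast+
  qed
  have inj: "inj_on \<rho> J1" "inj_on \<rho> J2"
    by (rule inj_on_no_local_extremum[OF _ \<rho>c]; use noext in \<open>simp add: J1_def J2_def\<close>)+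
  have "closed (l ` {t. \<eta> \<le> \<bar>t - t0\<bar>})"
  proof (rule closedin_closed_trans[OF homeomorphism_imp_closed_map[OF hom] cl])
    have "closed {t. \<eta> \<le> \<bar>t - t0\<bar>}" by (intro closed_Collect_le continuous_intros)
    then show "closedin (top_of_set UNIV) {t. \<eta> \<le> \<bar>t - t0\<bar>}" by simp
  qed
  moreover have "c \<notin> l ` {t. \<eta> \<le> \<bar>t - t0\<bar>}" using lL(2) lt0 \<eta>(1) by (auto simp: image_iff) (metis abs_zero diff_self less_le_not_le)
  ultimately obtain m where m: "m > 0" "\<And>t. \<eta> \<le> \<bar>t - t0\<bar> \<Longrightarrow> m \<le> \<rho> t"
    using separate_point_closed[of "l ` {t. \<eta> \<le> \<bar>t - t0\<bar>}" c] by (auto simp: \<rho>_def dist_norm norm_minus_commute)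
  have mI: "t \<in> J1 \<union> J2" if "0 < \<rho> t" "\<rho> t < m" for t
  proof -
    have "\<not> \<eta> \<le> \<bar>t - t0\<bar>" using that m(2)[of t] by auto
    moreover have "t \<noteq> t0" using that \<rho>0 by auto
    ultimately show ?thesis by (simp add: J1_def J2_def abs_if split: if_splits)
  qed
  define I where "I = {0<..<m}"
  have "\<exists>p q. \<forall>u. norm u = 1 \<longrightarrow> c + r *\<^sub>R u \<in> L \<longrightarrow> u = p \<or> u = q" if "r \<in> I" for r
    by (rule branches_two_points[OF hom inj[unfolded \<rho>_def], of I]) (use mI that in \<open>auto simp: I_def \<rho>_def\<close>)
  then have "eventually (\<lambda>r. \<exists>p q. \<forall>u. norm u = 1 \<longrightarrow> c + r *\<^sub>R u \<in> L \<longrightarrow> u = p \<or> u = q) (at_right 0)"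
    using m(1) unfolding I_def eventually_at_right[OF zero_less_one] by auto
  then obtain v where v: "norm v = 1" "eventually (\<lambda>r. c + r *\<^sub>R v \<notin> L) (at_right 0)"
    using ex_missed_direction[OF dim ray] by auto
  then obtain r1 where r1: "r1 > 0" "\<And>r. 0 < r \<Longrightarrow> r < r1 \<Longrightarrow> c + r *\<^sub>R v \<notin> L"
    by (auto simp: eventually_at_right[of 0 1])
  define R where "R = Min {m, r1}"
  have R: "R > 0" "R \<le> m" "R \<le> r1" using m r1 by (auto simp: R_def)
  have sub: "{0<..<R} \<subseteq> \<rho> ` J1" "{0<..<R} \<subseteq> \<rho> ` J2"
  proof -
    have "m \<le> \<rho> (t0 + \<eta>)" "m \<le> \<rho> (t0 - \<eta>)" using m(2) \<eta>(1) by auto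
    then show "{0<..<R} \<subseteq> \<rho> ` J1"
    proof (intro subsetI)
      fix r assume r: "r \<in> {0<..<R}"
      obtain x where "t0 \<le> x" "x \<le> t0 + \<eta>" "\<rho> x = r"
        using IVT'[of \<rho> t0 r "t0 + \<eta>"] r R \<rho>0 \<open>m \<le> \<rho> (t0 + \<eta>)\<close> \<eta>(1) \<rho>c by auto
      moreover from this have "x \<noteq> t0" "x \<noteq> t0 + \<eta>" using r R \<rho>0 \<open>m \<le> \<rho> (t0 + \<eta>)\<close> by auto
      ultimately show "r \<in> \<rho> ` J1" by (auto simp: J1_def)
    qed
    show "{0<..<R} \<subseteq> \<rho> ` J2"
    proof (intro subsetI)
      fix r assume r: "r \<in> {0<..<R}"
      obtain x where "t0 - \<eta> \<le> x" "x \<le> t0" "\<rho> x = r"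
        using IVT2'[of \<rho> t0 r "t0 - \<eta>"] r R \<rho>0 \<open>m \<le> \<rho> (t0 - \<eta>)\<close> \<eta>(1) \<rho>c by auto
      moreover from this have "x \<noteq> t0" "x \<noteq> t0 - \<eta>" using r R \<rho>0 \<open>m \<le> \<rho> (t0 - \<eta>)\<close> by auto
      ultimately show "r \<in> \<rho> ` J2" by (auto simp: J2_def)
    qed
  qed
  have "\<exists>a b. two_curves L c {0<..<R} a b v"
    by (rule two_curves_of_branches[OF hom _ _ _ inj[unfolded \<rho>_def] sub[unfolded \<rho>_def]])
      (use mI R r1 v in \<open>auto simp: J1_def J2_def \<rho>_def\<close>)
  then show ?thesis using R(1) by blast
qed

lemma line_two_curves_at_infinity:
  fixes l :: "real \<Rightarrow> 'a::euclidean_space"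
  assumes dim: "2 \<le> DIM('a)" and hom: "homeomorphism UNIV L l h" and cl: "closed L"
    and ext: "eventually (\<lambda>r. \<not> extremal_radius L 0 r) at_top"
    and ray: "\<And>v. eventually (\<lambda>r. 0 + r *\<^sub>R v \<in> L) at_top \<or> eventually (\<lambda>r. 0 + r *\<^sub>R v \<notin> L) at_top"
  shows "\<exists>R>0. \<exists>a b v. two_curves L 0 {R<..} a b v"
proof -
  define \<rho> where "\<rho> t = norm (l t - 0)" for t
  obtain r0 where r0: "\<And>r. r0 \<le> r \<Longrightarrow> \<not> extremal_radius L 0 r"
    using ext by (auto simp: eventually_at_top_linorder)
  have lc: "continuous_on S l" for S using hom by (meson continuous_on_subset homeomorphism_def subset_UNIV)
  have \<rho>c: "continuous_on S \<rho>" for S unfolding \<rho>_def by (intro continuous_intros lc)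
  have comp: "compact {t. \<rho> t \<le> R}" for R using line_compact_preimage[OF hom cl] by (simp add: \<rho>_def)
  have noext: "\<not> (\<exists>\<delta>>0. \<forall>s. \<bar>s - t\<bar> < \<delta> \<longrightarrow> \<rho> s \<le> \<rho> t)" "\<not> (\<exists>\<delta>>0. \<forall>s. \<bar>s - t\<bar> < \<delta> \<longrightarrow> \<rho> t \<le> \<rho> s)"
    if "r0 \<le> \<rho> t" for t
    using extremal_radius_param(2,3)[OF hom, of _ t 0] r0[OF that] unfolding \<rho>_def by blast+
  define R where "R = Max {r0, \<rho> 0, 1}"
  have R: "r0 \<le> R" "\<rho> 0 \<le> R" "1 \<le> R" by (auto simp: R_def)
  define K where "K = {t. \<rho> t \<le> R}"
  have K: "compact K" "0 \<in> K" using comp R by (auto simp: K_def)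
  obtain b where b: "b \<in> K" "\<And>t. t \<in> K \<Longrightarrow> t \<le> b" using compact_attains_sup[OF K(1)] K(2) by blast
  obtain a where a: "a \<in> K" "\<And>t. t \<in> K \<Longrightarrow> a \<le> t" using compact_attains_inf[OF K(1)] K(2) by blast
  have ab: "a \<le> b" using a b by auto
  have mid: "\<rho> t \<le> R" if t: "a \<le> t" "t \<le> b" for t
  proof (rule ccontr)
    assume nt: "\<not> \<rho> t \<le> R"
    obtain u where u: "u \<in> {a..b}" "\<And>s. s \<in> {a..b} \<Longrightarrow> \<rho> s \<le> \<rho> u"
      using continuous_attains_sup[OF compact_Icc _ \<rho>c, of a b] ab by auto
    have ru: "\<rho> u > R" using u(2)[of t] t nt by auto
    then have "u \<noteq> a" "u \<noteq> b" using a(1) b(1) by (auto simp: K_def)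
    then have "a < u" "u < b" using u(1) by auto
    then have "\<exists>\<delta>>0. \<forall>s. \<bar>s - u\<bar> < \<delta> \<longrightarrow> \<rho> s \<le> \<rho> u"
      by (intro exI[of _ "min (u - a) (b - u)"]) (auto intro!: u(2) simp: abs_less_iff)
    moreover have "r0 \<le> \<rho> u" using ru R by linarith
    ultimately show False using noext(1) by blast
  qed
  have big: "R < \<rho> t" if "t < a \<or> b < t" for t
    using that a(2)[of t] b(2)[of t] by (force simp: K_def)
  define J1 where "J1 = {b<..}"
  define J2 where "J2 = {..<a}"
  have JR: "r0 \<le> \<rho> t" if "t \<in> J1 \<union> J2" for t
    using that big[of t] R(1) by (auto simp: J1_def J2_def)
  have ne: "\<not> (\<exists>\<delta>>0. \<forall>s. \<bar>s - t\<bar> < \<delta> \<longrightarrow> \<rho> s \<le> \<rho> t)" "\<not> (\<exists>\<delta>>0. \<forall>s. \<bar>s - t\<bar> < \<delta> \<longrightarrow> \<rho> t \<le> \<rho> s)"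
    if "t \<in> J1 \<union> J2" for t
    by (rule noext[OF JR[OF that]])+
  have inj: "inj_on \<rho> J1" "inj_on \<rho> J2"
    by (rule inj_on_no_local_extremum[OF _ \<rho>c]; use ne in \<open>simp add: J1_def J2_def\<close>)+
  have JI: "t \<in> J1 \<union> J2" if "R < \<rho> t" for t
  proof (rule ccontr)
    assume "t \<notin> J1 \<union> J2"
    then have "a \<le> t" "t \<le> b" by (auto simp: J1_def J2_def)
    then show False using mid that by fastforce
  qed
  have sub: "{R<..} \<subseteq> \<rho> ` J1" "{R<..} \<subseteq> \<rho> ` J2"
  proof -
    show "{R<..} \<subseteq> \<rho> ` J1"
    proof
      fix r assume r: "r \<in> {R<..}"
      obtain B where B: "\<And>t. \<rho> t \<le> r \<Longrightarrow> t \<le> B"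
        using compact_imp_bounded[OF comp[of r]] by (auto simp: bounded_iff) (metis abs_le_D1)
      define y where "y = max (B + 1) (b + 1)"
      have "\<not> \<rho> y \<le> r" using B[of y] by (auto simp: y_def)
      then have "r \<le> \<rho> y" "b \<le> y" by (auto simp: y_def)
      then obtain x where "b \<le> x" "x \<le> y" "\<rho> x = r"
        using IVT'[of \<rho> b r y] r b(1) \<rho>c by (auto simp: K_def)
      moreover from this have "x \<noteq> b" using r b(1) by (auto simp: K_def)
      ultimately show "r \<in> \<rho> ` J1" by (auto simp: J1_def)
    qed
    show "{R<..} \<subseteq> \<rho> ` J2"
    proof
      fix r assume r: "r \<in> {R<..}"
      obtain B where B: "\<And>t. \<rho> t \<le> r \<Longrightarrow> - B \<le> t"
        using compact_imp_bounded[OF comp[of r]] by (auto simp: bounded_iff) (metis abs_le_D2 minus_le_iff)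
      define y where "y = min (- B - 1) (a - 1)"
      have "\<not> \<rho> y \<le> r" using B[of y] by (auto simp: y_def)
      then have "r \<le> \<rho> y" "y \<le> a" by (auto simp: y_def)
      then obtain x where "y \<le> x" "x \<le> a" "\<rho> x = r"
        using IVT2'[of \<rho> a r y] r a(1) \<rho>c by (auto simp: K_def)
      moreover from this have "x \<noteq> a" using r a(1) by (auto simp: K_def)
      ultimately show "r \<in> \<rho> ` J2" by (auto simp: J2_def)
    qed
  qed
  have "\<exists>p q. \<forall>u. norm u = 1 \<longrightarrow> 0 + r *\<^sub>R u \<in> L \<longrightarrow> u = p \<or> u = q" if "R < r" for r
    by (rule branches_two_points[OF hom inj[unfolded \<rho>_def], of "{R<..}"]) (use JI that R in \<open>auto simp: \<rho>_def\<close>)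
  then have "eventually (\<lambda>r. \<exists>p q. \<forall>u. norm u = 1 \<longrightarrow> 0 + r *\<^sub>R u \<in> L \<longrightarrow> u = p \<or> u = q) at_top"
    using eventually_gt_at_top[of R] by (rule eventually_mono[rotated])
  then obtain v where v: "norm v = 1" "eventually (\<lambda>r. 0 + r *\<^sub>R v \<notin> L) at_top"
    using ex_missed_direction[OF dim ray] by auto
  then obtain r1 where r1: "\<And>r. r1 \<le> r \<Longrightarrow> 0 + r *\<^sub>R v \<notin> L"
    by (auto simp: eventually_at_top_linorder)
  define R' where "R' = max R r1"
  have sub': "{R'<..} \<subseteq> \<rho> ` J1" "{R'<..} \<subseteq> \<rho> ` J2" using sub by (auto simp: R'_def)
  have "\<exists>a b. two_curves L 0 {R'<..} a b v"
    by (rule two_curves_of_branches[OF hom _ _ _ inj[unfolded \<rho>_def] sub'[unfolded \<rho>_def]])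
      (use JI R r1 v ab in \<open>auto simp: J1_def J2_def \<rho>_def R'_def\<close>)
  then show ?thesis using R(3) by (intro exI[of _ R']) (auto simp: R'_def)
qed

lemma semialgebraic3_eventually_not_extremal:
  fixes l :: "real \<Rightarrow> real^3"
  assumes "semialgebraic3 L" "homeomorphism UNIV L l h" "F = at_top \<or> F = at_right 0"
  shows "eventually (\<lambda>r. \<not> extremal_radius L c r) F"
proof -
  obtain P where P: "semialgebraic P" "\<And>e r. 0 < r \<Longrightarrow> P (e(0 := r)) = extremal_radius L c r"
    using semialgebraic_extremal_radius[OF assms(1)] by blast
  have pos: "eventually (\<lambda>r::real. 0 < r) F"
    using assms(3) eventually_gt_at_top[of "0::real"] eventually_at_right_less[of "0::real"] by auto
  define e where "e = (\<lambda>_ :: nat. 0 :: real)"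
  have eq: "eventually (\<lambda>r. P (e(0 := r)) = extremal_radius L c r) F"
    using pos by eventually_elim (rule P(2))
  have "\<not> eventually (\<lambda>r. P (e(0 := r))) F"
  proof
    assume "eventually (\<lambda>r. P (e(0 := r))) F"
    with eq have "eventually (\<lambda>r. r \<in> {r. extremal_radius L c r}) F" by eventually_elim simp
    then show False using countable_not_eventually[OF extremal_radius_param(1)[OF assms(2)] assms(3)] by blast
  qed
  then have "eventually (\<lambda>r. \<not> P (e(0 := r))) F" using semialgebraic_eventually[OF P(1) assms(3)] by blast
  with eq show ?thesis by eventually_elim simp
qed

theorem theorem2:
  fixes F :: "real^3 \<Rightarrow> real^3"
  assumes "polynomial_map3 F" and "local_diffeo F"
  shows "\<not> is_line (nonproper_set F)"
proof
  assume line: "is_line (nonproper_set F)"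
  define L where "L = nonproper_set F"
  have cl: "closed L" and "L homeomorphic (UNIV :: real set)" using line by (simp_all add: is_line_def L_def)
  then obtain h l where "homeomorphism L (UNIV :: real set) h l" unfolding homeomorphic_def by blast
  then have hom: "homeomorphism UNIV L l h" by (rule homeomorphism_symD)
  have sa: "semialgebraic3 L" unfolding L_def by (rule semialgebraic3_nonproper_set[OF assms(1)])
  have "line_nonproper F L l h"
  proof
    show "3 \<le> DIM(real^3)" by simp
    show "\<exists>U V G. open U \<and> x \<in> U \<and> open V \<and> homeomorphism U V F G" for x
      using assms(2) unfolding local_diffeo_def by blast
    show "nonproper_set F = L" by (simp add: L_def)
    show "closed L" by (rule cl)
    show "homeomorphism UNIV L l h" by (rule hom)
    show "\<exists>r>0. \<exists>a b v. two_curves L c {0<..<r} a b v" if "c \<in> L" for c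
      by (rule line_two_curves_near[OF _ hom cl that semialgebraic3_eventually_not_extremal[OF sa hom] semialgebraic3_ray[OF sa]])
        simp_all
    show "\<exists>R>0. \<exists>a b v. two_curves L 0 {R<..} a b v"
      by (rule line_two_curves_at_infinity[OF _ hom cl semialgebraic3_eventually_not_extremal[OF sa hom] semialgebraic3_ray[OF sa]])
        simp_all
  qed
  then show False by (rule line_nonproper.inconsistent)
qed

end
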